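(* Let $n\ge 1$. Suppose $a,\tau>0$ and $\beta>1$ satisfy $\beta\big(1-\frac1a\big)<1$. Let $\beta(a)>1$ be given by $$\frac1{\beta(a)}=1-a\Big(1-\frac1\beta\Big).$$ For all twice differentiable $f:\mathbb{R}^n\to\mathbb{R}$ such that $f(x)\ge-C(1+|x|)$ for all $x\in\mathbb{R}^n$ and some $C>0$, and $$\Delta f\ge n\Big(1-\frac1\beta\Big)\ \text{ on }\mathbb{R}^n,\qquad \int_{\mathbb{R}^n}e^{2af}\frac{\gamma}{\gamma_{\beta(a)}}\,d\gamma<\infty,$$ we have $$\big\|e^{Q_\tau f}\big\|_{L^{a+\tau}(\gamma)}\le\Big\|e^{Q_\tau\left[\frac1a\log\frac{\gamma_{\beta(a)}}{\gamma}\right]}\Big\|_{L^{a+\tau}(\gamma)}\,\|e^f\|_{L^a(\gamma)}.$$ In particular, this inequality holds for all $f=\frac1a\log\frac v\gamma$ where $v\in\mathrm{FP}(\beta(a))$.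
   Context: For $\alpha>0$, $\gamma_\alpha(x)=(2\pi\alpha)^{-n/2}e^{-|x|^2/(2\alpha)}$ on $\mathbb{R}^n$, $\gamma=\gamma_1$, $d\gamma=\gamma(x)\,dx$. For $r>0$, $\|g\|_{L^r(\gamma)}=(\int|g|^r\,d\gamma)^{1/r}$. The Hopf–Lax formula is $$Q_\tau f(x)=\inf_{y\in\mathbb{R}^n}\Big\{f(y)+\frac1{2\tau}|x-y|^2\Big\},\qquad\tau>0,\ x\in\mathbb{R}^n.$$ The class $\mathrm{FP}(\beta)$, $\beta>0$, consists of all functions $v=v_*(t_*,\cdot)$ with $t_*=\frac12\log2$, where $v_*$ is the non-negative solution of $\partial_tv_*=2\beta\Delta v_*+x\cdot\nabla v_*+nv_*$ on $(0,\infty)\times\mathbb{R}^n$ with initial data a non-negative finite (here nonzero) Borel measure $\mu$ on $\mathbb{R}^n$; explicitly $v_*(t,x)=(4\pi\beta(1-e^{-2t}))^{-n/2}\int_{\mathbb{R}^n}e^{-\frac{|x-e^{-t}y|^2}{4\beta(1-e^{-2t})}}\,d\mu(y)$. *)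

theory Defs
  imports "HOL-Analysis.Analysis"
begin

definition gauss :: "real \<Rightarrow> real^'n \<Rightarrow> real" where
  "gauss \<alpha> x = (2 * pi * \<alpha>) powr (- real CARD('n) / 2) * exp (- (norm x)\<^sup>2 / (2 * \<alpha>))"

definition gauss_measure :: "(real^'n) measure" where
  "gauss_measure = density lborel (\<lambda>x. ennreal (gauss 1 x))"

text \<open>The norm (quasi-norm if \<open>r < 1\<close>) of \<open>L\<^sup>r(\<gamma>)\<close>, with value \<open>\<infinity>\<close> when the integral diverges.
  As \<^const>\<open>enn2real\<close> sends \<open>\<infinity>\<close> to \<open>0\<close>, that case is split off.\<close>

definition gauss_norm :: "real \<Rightarrow> (real^'n \<Rightarrow> real) \<Rightarrow> ennreal" where
  "gauss_norm r g =
     (let I = (\<integral>\<^sup>+ x. ennreal (\<bar>g x\<bar> powr r) \<partial>gauss_measure)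
      in if I = \<infinity> then \<infinity> else ennreal (enn2real I powr (1 / r)))"

text \<open>The infimum is taken in the reals, so it is meaningful only if the set of values is bounded
  below; a bound \<open>f y \<ge> - C * (1 + norm y)\<close> guarantees this.\<close>

definition hopf_lax :: "real \<Rightarrow> (real^'n \<Rightarrow> real) \<Rightarrow> real^'n \<Rightarrow> real" where
  "hopf_lax \<tau> f x = (INF y. f y + 1 / (2 * \<tau>) * (norm (x - y))\<^sup>2)"

definition grad :: "(real^'n \<Rightarrow> real) \<Rightarrow> real^'n \<Rightarrow> real^'n" where
  "grad f x = (THE D. GDERIV f x :> D)"

text \<open>Pointwise second-order Frechet differentiability; continuity of the second derivative is not
  required.\<close>

definition twice_differentiable :: "(real^'n \<Rightarrow> real) \<Rightarrow> bool" where
  "twice_differentiable f \<longleftrightarrow>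
     (\<forall>x. f differentiable (at x)) \<and> (\<forall>x. grad f differentiable (at x))"

definition laplacian :: "(real^'n \<Rightarrow> real) \<Rightarrow> real^'n \<Rightarrow> real" where
  "laplacian f x = trace (jacobian (grad f) (at x))"

text \<open>The non-negative solution, given by its integral representation, of the Fokker--Planck equation
  \<open>\<partial>\<^sub>t v = 2 \<beta> \<Delta> v + x \<bullet> \<nabla> v + n v\<close> on \<open>(0, \<infinity>) \<times> \<real>\<^sup>n\<close> with initial datum \<open>\<mu>\<close>.\<close>

definition fp_solution :: "real \<Rightarrow> (real^'n) measure \<Rightarrow> real \<Rightarrow> real^'n \<Rightarrow> real" where
  "fp_solution \<beta> \<mu> t x =
     (4 * pi * \<beta> * (1 - exp (- 2 * t))) powr (- real CARD('n) / 2) *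
     (\<integral> y. exp (- (norm (x - exp (- t) *\<^sub>R y))\<^sup>2 / (4 * \<beta> * (1 - exp (- 2 * t)))) \<partial>\<mu>)"

definition FP :: "real \<Rightarrow> (real^'n \<Rightarrow> real) set" where
  "FP \<beta> = {fp_solution \<beta> \<mu> (1 / 2 * ln 2) | \<mu>.
             finite_measure \<mu> \<and> sets \<mu> = sets borel \<and> emeasure \<mu> UNIV \<noteq> 0}"

end

theory Submission
  imports Defs "HOL-Probability.Distributions"
begin

text \<open>Put \<open>t = \<tau> / (a + \<tau>)\<close>, \<open>\<sigma> = \<beta>a\<close>, \<open>v = exp (a f) \<gamma>\<close> and \<open>F = exp ((a + \<tau>) Q f) \<gamma>\<close>. The
  definition of \<open>Q\<close> says \<open>ln v(\<xi>) \<ge> (1 - t) ln F(z) - |\<xi> - (1 - t) z|^2 / (2 t) - const\<close>, a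
  Prekopa--Leindler hypothesis. The Laplacian bound says that \<open>ln (v / gauss \<sigma>)\<close> is subharmonic, so
  on average \<open>ln (v / gauss \<sigma>)\<close> does not decrease when independent Gaussian noise \<open>e g\<close> is added to
  \<open>\<xi>\<close>. Hence \<open>E ln v((1 - t) z + b x + e g) \<ge> (1 - t) ln F(z) - q |x|^2 - const\<close> for all \<open>z\<close> and
  \<open>x\<close>, with \<open>g\<close> standard Gaussian. Take \<open>z = T(x)\<close> with \<open>x\<close> standard Gaussian and \<open>T\<close> transporting
  it to the normalised \<open>F\<close>. With \<open>p = c x + s g\<close>, \<open>q = s x - c g\<close>, \<open>c^2 + s^2 = 1\<close>, the map
  \<open>p \<mapsto> (1 - t) T(x) + b x + e g\<close> is increasing for fixed \<open>q\<close>; changing variables, Jensen's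
  inequality and concavity of \<open>ln\<close> give \<open>ln (\<integral>v) \<ge> (1 - t) ln (\<integral>F) + const\<close>. For
  \<open>v = gauss \<sigma>\<close> and the values of \<open>b, c, e, s\<close> chosen below every step is an equality. The transport
  is only needed in dimension one, because the averaged hypothesis passes to marginals one coordinate
  at a time.\<close>

subsection \<open>Subharmonic functions and Gaussian means\<close>

text \<open>A Laplacian bound controls \<open>ln v\<close> only in the mean, not along segments, so
  a second transport, onto \<open>v\<close>, would have nothing pointwise to act on. Hence
  \<open>v\<close> enters only through a change of variables for fixed \<open>q\<close>, and the
  noise sits inside the interpolation point.

  All integrals must be finite, which is arranged by keeping \<open>v\<close> and \<open>F\<close>
  between two Gaussians. The lower bound on \<open>f\<close> gives one side. The other comes from
  the integrability hypothesis, which says that the square of \<open>v / gauss \<sigma>\<close> is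
  integrable against \<open>gauss \<sigma>\<close>: Gaussian means of that square are then finite,
  and the mean value inequality turns them into a pointwise bound.

  A member of \<open>FP \<sigma>\<close> can have tails so heavy that this integral diverges, so the
  second half of the theorem is no instance of the first. There the mean inequality comes from
  log-convexity of \<open>v / gauss \<sigma>\<close>, the bounds from cutting the initial measure
  down to balls, and the limit from Fatou's lemma.

  The norm of the extremizer is not computed. It is only bounded below by the constant that
  transport produces, which is the direction that the inequality needs.\<close>

definition upd :: "'a::euclidean_space \<Rightarrow> real \<Rightarrow> 'a \<Rightarrow> 'a" where
  "upd i r y = y + (r - y \<bullet> i) *\<^sub>R i"

lemma upd_inner: "i \<in> Basis \<Longrightarrow> j \<in> Basis \<Longrightarrow> upd i r y \<bullet> j = (if i = j then r else y \<bullet> j)"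
  by (auto simp: upd_def inner_add_left inner_Basis)

lemma upd_upd [simp]: "i \<in> Basis \<Longrightarrow> upd i r (upd i s y) = upd i r y"
  by (auto simp: upd_def inner_add_left inner_Basis algebra_simps)

lemma upd_affine: "i \<in> Basis \<Longrightarrow> upd i r y + c *\<^sub>R upd i s z = upd i (r + c * s) (y + c *\<^sub>R z)"
  by (auto simp: upd_def inner_add_left inner_Basis algebra_simps)

lemma upd_scale: "i \<in> Basis \<Longrightarrow> c *\<^sub>R upd i s z = upd i (c * s) (c *\<^sub>R z)"
  by (auto simp: upd_def inner_add_left inner_Basis algebra_simps)

lemma upd_shift: "i \<in> Basis \<Longrightarrow> upd i r (y + c *\<^sub>R i) = upd i r y"
  by (auto simp: upd_def inner_add_left inner_Basis algebra_simps)

lemma continuous_on_upd [continuous_intros]: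
  "continuous_on S f \<Longrightarrow> continuous_on S g \<Longrightarrow> continuous_on S (\<lambda>x. upd i (f x) (g x))"
  unfolding upd_def by (intro continuous_intros)

text \<open>Flux of \<open>G\<close> through the boundary of the box minus the integral of \<open>h\<close> over it. Each face
  integral is written as a volume integral divided by a side length.\<close>

definition flux_excess :: "('a::euclidean_space \<Rightarrow> 'a) \<Rightarrow> ('a \<Rightarrow> real) \<Rightarrow> 'a \<Rightarrow> 'a \<Rightarrow> real" where
  "flux_excess G h a b =
     (\<Sum>i\<in>Basis. integral (cbox a b) (\<lambda>x. G (upd i (b \<bullet> i) x) \<bullet> i - G (upd i (a \<bullet> i) x) \<bullet> i)
        / ((b - a) \<bullet> i)) - integral (cbox a b) h"

lemma integral_cbox_split:
  fixes f :: "'a::euclidean_space \<Rightarrow> real"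
  assumes "j \<in> Basis" "continuous_on UNIV f" "a \<bullet> j \<le> m" "m \<le> b \<bullet> j"
  shows "integral (cbox a b) f = integral (cbox a (upd j m b)) f + integral (cbox (upd j m a) b) f"
proof -
  have i: "f integrable_on cbox a b"
    using assms(2) continuous_on_subset integrable_continuous by blast
  have "cbox a b \<inter> {x. x \<bullet> j \<le> m} = cbox a (upd j m b)" "cbox a b \<inter> {x. x \<bullet> j \<ge> m} = cbox (upd j m a) b"
    using assms by (auto simp: mem_box upd_inner split: if_splits; metis order_trans)+
  then show ?thesis
    using integral_split[OF i assms(1), of m] by simp
qed

lemma integral_cbox_shift:
  fixes f :: "'a::euclidean_space \<Rightarrow> real"
  assumes "continuous_on UNIV f"
  shows "integral (cbox (a + c) (b + c)) f = integral (cbox a b) (\<lambda>x. f (x + c))"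
proof -
  have i: "f integrable_on cbox (a + c) (b + c)"
    using assms continuous_on_subset integrable_continuous by blast
  have "((\<lambda>x. f (1 *\<^sub>R x + c)) has_integral (1 / (\<bar>1\<bar> ^ DIM('a))) *\<^sub>R integral (cbox (a + c) (b + c)) f)
      ((\<lambda>x. (1 / 1) *\<^sub>R x + - ((1 / 1) *\<^sub>R c)) ` cbox (a + c) (b + c))"
    by (rule has_integral_affinity[OF integrable_integral[OF i]]) auto
  moreover have "(\<lambda>x. (1 / 1) *\<^sub>R x + - ((1 / 1) *\<^sub>R c)) ` cbox (a + c) (b + c) = cbox a b"
    using cbox_translation[of "-c" "a + c" "b + c"] by (simp add: add.commute)
  ultimately show ?thesis by (simp add: integral_unique)
qed

text \<open>The flux through the cutting face is counted twice with opposite signs. The cut is at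
  the midpoint so that both halves have the same width and volume, which makes the quotients by the
  side length comparable.\<close>

lemma flux_excess_bisect:
  fixes G :: "'a::euclidean_space \<Rightarrow> 'a"
  assumes "j \<in> Basis" and G: "continuous_on UNIV G" and h: "continuous_on UNIV h"
    and ab: "\<And>i. i \<in> Basis \<Longrightarrow> a \<bullet> i < b \<bullet> i" and m: "m = (a \<bullet> j + b \<bullet> j) / 2"
  shows "flux_excess G h a b = flux_excess G h a (upd j m b) + flux_excess G h (upd j m a) b"
proof -
  have m': "a \<bullet> j \<le> m" "m \<le> b \<bullet> j" using ab[OF assms(1)] m by auto
  have cG: "continuous_on UNIV (\<lambda>x. G (f x))" if "continuous_on UNIV f" for f :: "'a \<Rightarrow> 'a"
    using continuous_on_compose2[OF G that] by auto
  let ?b = "upd j m b" let ?a = "upd j m a"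
  have face: "integral (cbox a b) (\<lambda>x. G (upd i (b \<bullet> i) x) \<bullet> i - G (upd i (a \<bullet> i) x) \<bullet> i) / ((b - a) \<bullet> i)
     = integral (cbox a ?b) (\<lambda>x. G (upd i (?b \<bullet> i) x) \<bullet> i - G (upd i (a \<bullet> i) x) \<bullet> i) / ((?b - a) \<bullet> i)
     + integral (cbox ?a b) (\<lambda>x. G (upd i (b \<bullet> i) x) \<bullet> i - G (upd i (?a \<bullet> i) x) \<bullet> i) / ((b - ?a) \<bullet> i)"
    if i: "i \<in> Basis" for i
  proof (cases "i = j")
    case False
    then have e: "?b \<bullet> i = b \<bullet> i" "?a \<bullet> i = a \<bullet> i" using i assms(1) by (auto simp: upd_inner)
    show ?thesis unfolding inner_diff_left e
      by (subst integral_cbox_split[OF assms(1) _ m'])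
        (auto intro!: continuous_intros cG simp: add_divide_distrib)
  next
    case True
    define w where "w = (b \<bullet> j - a \<bullet> j) / 2"
    have w: "w > 0" using ab[OF assms(1)] by (simp add: w_def)
    \<comment> \<open>The value on the hyperplane with \<open>j\<close>-th coordinate
      \<open>c\<close>, extended constantly in direction \<open>j\<close>. Its integrals over the
      two halves therefore agree by translation.\<close>
    define P where "P c x = G (upd j c x) \<bullet> j" for c x
    have cP: "continuous_on UNIV (P c)" for c unfolding P_def
      by (intro continuous_intros cG)
    have iP: "P c integrable_on cbox u v" for c u v
      using cP continuous_on_subset integrable_continuous by blast
    have ea: "?a = a + w *\<^sub>R j" "b = ?b + w *\<^sub>R j"
      by (auto simp: upd_def w_def m algebra_simps) (auto simp flip: scaleR_add_left simp: field_simps)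
    have half: "integral (cbox ?a b) (P c) = integral (cbox a ?b) (P c)" for c
    proof -
      have "integral (cbox ?a b) (P c) = integral (cbox (a + w *\<^sub>R j) (?b + w *\<^sub>R j)) (P c)"
        using ea by simp
      also have "\<dots> = integral (cbox a ?b) (\<lambda>x. P c (x + w *\<^sub>R j))"
        by (rule integral_cbox_shift[OF cP])
      also have "\<dots> = integral (cbox a ?b) (P c)"
        unfolding P_def by (simp add: upd_shift[OF assms(1)])
      finally show ?thesis .
    qed
    have full: "integral (cbox a b) (P c) = 2 * integral (cbox a ?b) (P c)" for c
      using integral_cbox_split[OF assms(1) cP m', of c] half[of c] by simp
    have d: "\<And>u v. integral (cbox u v) (\<lambda>x. P c x - P c' x) = integral (cbox u v) (P c) - integral (cbox u v) (P c')" for c c'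
      by (rule integral_diff[OF iP iP])
    have s: "(b - a) \<bullet> j = 2 * w" "(?b - a) \<bullet> j = w" "(b - ?a) \<bullet> j = w" "?b \<bullet> j = m" "?a \<bullet> j = m"
      using assms(1) by (auto simp: inner_diff_left upd_inner w_def m field_simps)
    have "integral (cbox a b) (\<lambda>x. P (b \<bullet> j) x - P (a \<bullet> j) x) / (2 * w)
       = integral (cbox a ?b) (\<lambda>x. P m x - P (a \<bullet> j) x) / w
       + integral (cbox ?a b) (\<lambda>x. P (b \<bullet> j) x - P m x) / w"
      unfolding d half full using w by (simp add: field_simps)
    then show ?thesis unfolding True s P_def .
  qed
  show ?thesis unfolding flux_excess_def integral_cbox_split[OF assms(1) h m']
    using sum.cong[OF refl face, of Basis] unfolding sum.distrib by simp
qed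

text \<open>Near \<open>p\<close> the field is affine up to an error of \<open>e\<close> times the
  distance. The affine part has flux exactly trace times volume. The error on two opposite faces is
  at most \<open>2 * e\<close> times the diameter and gets divided by a side length, so a bound
  \<open>K\<close> on the ratio of diameter to side is what keeps it small.\<close>

lemma flux_excess_local:
  fixes G :: "'a::euclidean_space \<Rightarrow> 'a"
  assumes G: "continuous_on UNIV G" and h: "continuous_on UNIV h"
    and D: "(G has_derivative DG) (at p)" and e: "e > 0"
  shows "\<exists>d>0. \<forall>a b. p \<in> cbox a b \<longrightarrow> (\<forall>i\<in>Basis. a \<bullet> i < b \<bullet> i) \<longrightarrow> (\<Sum>i\<in>Basis. (b - a) \<bullet> i) < d \<longrightarrow>
     (\<forall>j\<in>Basis. (\<Sum>i\<in>Basis. (b - a) \<bullet> i) \<le> K * ((b - a) \<bullet> j)) \<longrightarrow>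
     flux_excess G h a b \<ge> ((\<Sum>i\<in>Basis. DG i \<bullet> i - 2 * e * K) - h p - e) * (\<Prod>i\<in>Basis. (b - a) \<bullet> i)"
proof -
  have bl: "linear DG" using D has_derivative_linear by blast
  obtain d1 where d1: "d1 > 0" "\<And>y. norm (y - p) < d1 \<Longrightarrow> norm (G y - G p - DG (y - p)) \<le> e * norm (y - p)"
    using D e unfolding has_derivative_at_alt by blast
  have "isCont h p" using h by (simp add: continuous_on_eq_continuous_at)
  then obtain d2 where d2: "d2 > 0" "\<And>y. norm (y - p) < d2 \<Longrightarrow> norm (h y - h p) < e"
    using e unfolding continuous_at_eps_delta by (auto simp: dist_norm)
  show ?thesis
  proof (intro exI conjI allI impI)
    show "min d1 d2 > 0" using d1 d2 by simp
    fix a b :: 'a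
    assume p: "p \<in> cbox a b" and ab: "\<forall>i\<in>Basis. a \<bullet> i < b \<bullet> i" and sm: "(\<Sum>i\<in>Basis. (b - a) \<bullet> i) < min d1 d2"
      and K: "\<forall>j\<in>Basis. (\<Sum>i\<in>Basis. (b - a) \<bullet> i) \<le> K * ((b - a) \<bullet> j)"
    define V where "V = (\<Prod>i\<in>Basis. (b - a) \<bullet> i)"
    have c: "measure lborel (cbox a b) = V"
      using ab unfolding V_def by (subst content_cbox) (auto simp: less_imp_le inner_diff_left)
    have ni: "norm (x - p) \<le> (\<Sum>i\<in>Basis. (b - a) \<bullet> i)" if "x \<in> cbox a b" for x
    proof -
      have "norm (x - p) \<le> (\<Sum>i\<in>Basis. \<bar>(x - p) \<bullet> i\<bar>)" by (rule norm_le_l1)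
      also have "\<dots> \<le> (\<Sum>i\<in>Basis. (b - a) \<bullet> i)"
        using that p by (intro sum_mono) (fastforce simp: mem_box inner_diff_left abs_le_iff)
      finally show ?thesis .
    qed
    have cI: "f integrable_on cbox a b" if "continuous_on UNIV f" for f :: "'a \<Rightarrow> real"
      using that continuous_on_subset integrable_continuous by blast
    have lb: "B * V \<le> integral (cbox a b) f" if "continuous_on UNIV f" "\<And>x. x \<in> cbox a b \<Longrightarrow> B \<le> f x" for f :: "'a \<Rightarrow> real" and B
    proof -
      have "integral (cbox a b) (\<lambda>_. B) \<le> integral (cbox a b) f"
        by (rule integral_le[OF _ cI[OF that(1)]]) (use that in auto)
      then show ?thesis by (simp add: c mult.commute)
    qed
    have cG: "continuous_on UNIV (\<lambda>x. G (f x))" if "continuous_on UNIV f" for f :: "'a \<Rightarrow> 'a"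
      using continuous_on_compose2[OF G that] by auto
    have 1: "(DG i \<bullet> i - 2 * e * K) * V \<le> integral (cbox a b) (\<lambda>x. G (upd i (b \<bullet> i) x) \<bullet> i - G (upd i (a \<bullet> i) x) \<bullet> i) / ((b - a) \<bullet> i)"
      if i: "i \<in> Basis" for i
    proof -
      define w where "w = (b - a) \<bullet> i"
      have w: "w > 0" using ab i by (simp add: w_def inner_diff_left)
      have "(w * (DG i \<bullet> i - 2 * e * K)) * V \<le> integral (cbox a b) (\<lambda>x. G (upd i (b \<bullet> i) x) \<bullet> i - G (upd i (a \<bullet> i) x) \<bullet> i)"
      proof (rule lb)
        show "continuous_on UNIV (\<lambda>x. G (upd i (b \<bullet> i) x) \<bullet> i - G (upd i (a \<bullet> i) x) \<bullet> i)"
          by (intro continuous_intros cG)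
        fix x assume x: "x \<in> cbox a b"
        define y1 y0 where "y1 = upd i (b \<bullet> i) x" and "y0 = upd i (a \<bullet> i) x"
        have y: "y1 \<in> cbox a b" "y0 \<in> cbox a b"
          using x i ab by (auto simp: y1_def y0_def mem_box upd_inner less_imp_le)
        have n: "norm (y - p) < d1" "norm (y - p) \<le> K * w" if "y \<in> cbox a b" for y
          using ni[OF that] sm K i unfolding w_def by fastforce+
        have r: "norm (G y - G p - DG (y - p)) \<le> e * (K * w)" if "y \<in> cbox a b" for y
          using order_trans[OF d1(2)[OF n(1)[OF that]] mult_left_mono[OF n(2)[OF that]]] e by simp
        have "y1 - y0 = w *\<^sub>R i" by (simp add: y1_def y0_def upd_def w_def inner_diff_left algebra_simps)
        then have "DG (y1 - p) - DG (y0 - p) = w *\<^sub>R DG i"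
          using bl by (metis (no_types, lifting) diff_diff_eq2 diff_add_cancel linear_cmul linear_diff)
        then have eq: "G y1 - G y0 = w *\<^sub>R DG i + ((G y1 - G p - DG (y1 - p)) - (G y0 - G p - DG (y0 - p)))"
          by (simp add: algebra_simps)
        have "\<bar>((G y1 - G p - DG (y1 - p)) - (G y0 - G p - DG (y0 - p))) \<bullet> i\<bar> \<le> e * (K * w) + e * (K * w)"
          by (rule order_trans[OF Basis_le_norm[OF i] order_trans[OF norm_triangle_ineq4 add_mono[OF r[OF y(1)] r[OF y(2)]]]])
        moreover have "G y1 \<bullet> i - G y0 \<bullet> i = w * (DG i \<bullet> i) + ((G y1 - G p - DG (y1 - p)) - (G y0 - G p - DG (y0 - p))) \<bullet> i"
          using eq by (metis inner_add_left inner_diff_left inner_scaleR_left)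
        ultimately show "w * (DG i \<bullet> i - 2 * e * K) \<le> G (upd i (b \<bullet> i) x) \<bullet> i - G (upd i (a \<bullet> i) x) \<bullet> i"
          unfolding y1_def[symmetric] y0_def[symmetric] by (simp add: algebra_simps)
      qed
      then show ?thesis using w unfolding w_def[symmetric] by (simp add: field_simps)
    qed
    have "- (h p + e) * V \<le> integral (cbox a b) (\<lambda>x. - h x)"
    proof (rule lb)
      show "continuous_on UNIV (\<lambda>x. - h x)" by (intro continuous_intros h)
      fix x assume "x \<in> cbox a b"
      then have "norm (x - p) < d2" using ni sm by fastforce
      from d2(2)[OF this] show "- (h p + e) \<le> - h x" by auto
    qed
    then have 2: "integral (cbox a b) h \<le> (h p + e) * V" by (simp add: algebra_simps)
    have "(\<Sum>i\<in>Basis. (DG i \<bullet> i - 2 * e * K) * V) - (h p + e) * V \<le> flux_excess G h a b"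
      unfolding flux_excess_def by (intro diff_mono sum_mono 1 2)
    then show "flux_excess G h a b \<ge> ((\<Sum>i\<in>Basis. DG i \<bullet> i - 2 * e * K) - h p - e) * (\<Prod>i\<in>Basis. (b - a) \<bullet> i)"
      unfolding V_def[symmetric] sum_distrib_right[symmetric] by (simp add: algebra_simps)
  qed
qed

text \<open>A pigeonhole: the excess is additive and the halves have equal volume, so one half has
  at least the same deficit per unit volume. The induction halves one coordinate of \<open>I\<close>
  at a time.\<close>

lemma flux_excess_shrink:
  fixes G :: "'a::euclidean_space \<Rightarrow> 'a"
  assumes G: "continuous_on UNIV G" and h: "continuous_on UNIV h" and "I \<subseteq> Basis"
    and ab: "\<forall>i\<in>Basis. a \<bullet> i < b \<bullet> i" and neg: "flux_excess G h a b \<le> - \<delta> * (\<Prod>i\<in>Basis. (b - a) \<bullet> i)"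
  shows "\<exists>a' b'. cbox a' b' \<subseteq> cbox a b
     \<and> (\<forall>i\<in>Basis. (b' - a') \<bullet> i = (if i \<in> I then (b - a) \<bullet> i / 2 else (b - a) \<bullet> i))
     \<and> flux_excess G h a' b' \<le> - \<delta> * (\<Prod>i\<in>Basis. (b' - a') \<bullet> i)"
proof -
  have "finite I" using assms(3) finite_subset[OF _ finite_Basis] by blast
  then show ?thesis using assms(3)
  proof (induction I rule: finite_induct)
    case empty
    then show ?case using neg by (intro exI[of _ a] exI[of _ b]) auto
  next
    case (insert j I)
    then obtain a' b' where *: "cbox a' b' \<subseteq> cbox a b"
      "\<forall>i\<in>Basis. (b' - a') \<bullet> i = (if i \<in> I then (b - a) \<bullet> i / 2 else (b - a) \<bullet> i)"
      "flux_excess G h a' b' \<le> - \<delta> * (\<Prod>i\<in>Basis. (b' - a') \<bullet> i)" by auto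
    have j: "j \<in> Basis" using insert by auto
    have ab': "a' \<bullet> i < b' \<bullet> i" if "i \<in> Basis" for i
    proof -
      have "0 < (b' - a') \<bullet> i" using *(2) ab that by (auto simp: inner_diff_left)
      then show ?thesis by (simp add: inner_diff_left)
    qed
    define m where "m = (a' \<bullet> j + b' \<bullet> j) / 2"
    have m': "a' \<bullet> j \<le> m" "m \<le> b' \<bullet> j" using ab'[OF j] m_def by auto
    let ?b = "upd j m b'" let ?a = "upd j m a'"
    have sb: "(?b - a') \<bullet> i = (if i = j then (b' - a') \<bullet> i / 2 else (b' - a') \<bullet> i)"
         "(b' - ?a) \<bullet> i = (if i = j then (b' - a') \<bullet> i / 2 else (b' - a') \<bullet> i)" if "i \<in> Basis" for i
      using that j by (auto simp: inner_diff_left upd_inner m_def field_simps)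
    have vh: "(\<Prod>i\<in>Basis. if i = j then (b' - a') \<bullet> i / 2 else (b' - a') \<bullet> i) = (\<Prod>i\<in>Basis. (b' - a') \<bullet> i) / 2"
      using j by (subst (1 2) prod.remove[OF finite_Basis j]) (auto intro!: prod.cong)
    have sub: "cbox a' ?b \<subseteq> cbox a b" "cbox ?a b' \<subseteq> cbox a b"
    proof -
      have "cbox a' ?b \<subseteq> cbox a' b'" "cbox ?a b' \<subseteq> cbox a' b'"
        unfolding subset_box using m' j by (auto simp: upd_inner)
      then show "cbox a' ?b \<subseteq> cbox a b" "cbox ?a b' \<subseteq> cbox a b" using *(1) by auto
    qed
    have sides: "(if i = j then (b' - a') \<bullet> i / 2 else (b' - a') \<bullet> i) = (if i \<in> insert j I then (b - a) \<bullet> i / 2 else (b - a) \<bullet> i)"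
      if "i \<in> Basis" for i using *(2) that insert(2) by auto
    have "flux_excess G h a' b' = flux_excess G h a' ?b + flux_excess G h ?a b'"
      by (rule flux_excess_bisect[OF j G h ab' m_def])
    then consider "flux_excess G h a' ?b \<le> - \<delta> * ((\<Prod>i\<in>Basis. (b' - a') \<bullet> i) / 2)"
      | "flux_excess G h ?a b' \<le> - \<delta> * ((\<Prod>i\<in>Basis. (b' - a') \<bullet> i) / 2)"
      using *(3) by fastforce
    then show ?case
    proof cases
      case 1
      have "(\<Prod>i\<in>Basis. (?b - a') \<bullet> i) = (\<Prod>i\<in>Basis. (b' - a') \<bullet> i) / 2"
        unfolding vh[symmetric] by (intro prod.cong refl sb(1))
      moreover have "\<forall>i\<in>Basis. (?b - a') \<bullet> i = (if i \<in> insert j I then (b - a) \<bullet> i / 2 else (b - a) \<bullet> i)"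
        using sb(1) sides by metis
      ultimately show ?thesis using sub(1) 1 by metis
    next
      case 2
      have "(\<Prod>i\<in>Basis. (b' - ?a) \<bullet> i) = (\<Prod>i\<in>Basis. (b' - a') \<bullet> i) / 2"
        unfolding vh[symmetric] by (intro prod.cong refl sb(2))
      moreover have "\<forall>i\<in>Basis. (b' - ?a) \<bullet> i = (if i \<in> insert j I then (b - a) \<bullet> i / 2 else (b - a) \<bullet> i)"
        using sb(2) sides by metis
      ultimately show ?thesis using sub(2) 2 by metis
    qed
  qed
qed

text \<open>Goursat's bisection argument: it needs no integrability of the derivative of \<open>G\<close>, which is
  why pointwise second-order differentiability suffices below.\<close>

lemma flux_excess_nonneg:
  fixes G :: "'a::euclidean_space \<Rightarrow> 'a"
  assumes D: "\<And>x. (G has_derivative DG x) (at x)" and h: "continuous_on UNIV h"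
    and le: "\<And>x. h x \<le> (\<Sum>i\<in>Basis. DG x i \<bullet> i)" and ab: "\<forall>i\<in>Basis. a \<bullet> i < b \<bullet> i"
  shows "flux_excess G h a b \<ge> 0"
proof (rule ccontr)
  assume neg: "\<not> ?thesis"
  have G: "continuous_on UNIV G"
    using D by (meson continuous_at_imp_continuous_on has_derivative_continuous)
  define W where "W i = (b - a) \<bullet> i" for i
  have W: "W i > 0" if "i \<in> Basis" for i using ab that by (simp add: W_def inner_diff_left)
  define \<delta> where "\<delta> = - flux_excess G h a b / (\<Prod>i\<in>Basis. W i)"
  have V: "(\<Prod>i\<in>Basis. W i) > 0" using W by (simp add: prod_pos)
  then have \<delta>: "\<delta> > 0" using neg by (simp add: \<delta>_def divide_neg_pos)
  define P where "P k ab = ((\<forall>i\<in>Basis. (snd ab - fst ab) \<bullet> i = W i / 2 ^ k)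
     \<and> flux_excess G h (fst ab) (snd ab) \<le> - \<delta> * (\<Prod>i\<in>Basis. (snd ab - fst ab) \<bullet> i))" for k and ab :: "'a \<times> 'a"
  have "\<exists>f. \<forall>k. P k (f k) \<and> cbox (fst (f (Suc k))) (snd (f (Suc k))) \<subseteq> cbox (fst (f k)) (snd (f k))"
  proof (rule dependent_nat_choice)
    have "- \<delta> * (\<Prod>i\<in>Basis. W i) = flux_excess G h a b"
      unfolding \<delta>_def using less_imp_neq[OF V] by (metis divide_minus_left minus_minus nonzero_eq_divide_eq)
    then have "P 0 (a, b)" unfolding P_def by (simp add: W_def)
    then show "\<exists>x. P 0 x" by blast
    fix x k assume P: "P k x"
    have ab: "\<forall>i\<in>Basis. fst x \<bullet> i < snd x \<bullet> i"
    proof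
      fix i :: 'a assume i: "i \<in> Basis"
      have "0 < (snd x - fst x) \<bullet> i" using P W[OF i] i unfolding P_def by auto
      then show "fst x \<bullet> i < snd x \<bullet> i" by (simp add: inner_diff_left)
    qed
    obtain a' b' where "cbox a' b' \<subseteq> cbox (fst x) (snd x)"
     "\<forall>i\<in>Basis. (b' - a') \<bullet> i = (if i \<in> Basis then (snd x - fst x) \<bullet> i / 2 else (snd x - fst x) \<bullet> i)"
     "flux_excess G h a' b' \<le> - \<delta> * (\<Prod>i\<in>Basis. (b' - a') \<bullet> i)"
      using flux_excess_shrink[OF G h subset_refl ab, of \<delta>] P unfolding P_def by blast
    then show "\<exists>y. P (Suc k) y \<and> cbox (fst y) (snd y) \<subseteq> cbox (fst x) (snd x)"
      using P by (intro exI[of _ "(a', b')"]) (auto simp: P_def)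
  qed
  then obtain f where P: "\<And>k. P k (f k)"
    and ne: "\<And>k. cbox (fst (f (Suc k))) (snd (f (Suc k))) \<subseteq> cbox (fst (f k)) (snd (f k))" by blast
  have lt: "fst (f k) \<bullet> i < snd (f k) \<bullet> i" if "i \<in> Basis" for i k
  proof -
    have "0 < (snd (f k) - fst (f k)) \<bullet> i" using P[of k] W[OF that] that unfolding P_def by auto
    then show "fst (f k) \<bullet> i < snd (f k) \<bullet> i" by (simp add: inner_diff_left)
  qed
  have "\<Inter> (range (\<lambda>k. cbox (fst (f k)) (snd (f k)))) \<noteq> {}"
  proof (rule compact_nest)
    show "compact (cbox (fst (f k)) (snd (f k)))" "cbox (fst (f k)) (snd (f k)) \<noteq> {}" for k
      using lt[of _ k] by (auto simp: box_ne_empty less_imp_le)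
    show "m \<le> n \<Longrightarrow> cbox (fst (f n)) (snd (f n)) \<subseteq> cbox (fst (f m)) (snd (f m))" for m n
      by (rule lift_Suc_antimono_le[of "\<lambda>k. cbox (fst (f k)) (snd (f k))", OF ne])
  qed
  then obtain p where p: "\<And>k. p \<in> cbox (fst (f k)) (snd (f k))" by blast
  \<comment> \<open>Halving all sides preserves their ratios, so one \<open>K\<close> serves every
    box of the nested sequence.\<close>
  define K where "K = (\<Sum>i\<in>Basis. W i) * (\<Sum>i\<in>Basis. 1 / W i)"
  have Kpos: "K \<ge> 0" unfolding K_def using W by (intro mult_nonneg_nonneg sum_nonneg) (auto simp: less_imp_le)
  have KW: "(\<Sum>i\<in>Basis. W i) \<le> K * W j" if j: "j \<in> Basis" for j
  proof -
    have "1 / W j \<le> (\<Sum>i\<in>Basis. 1 / W i)" using W j by (intro member_le_sum) (auto simp: less_imp_le)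
    then have "(\<Sum>i\<in>Basis. W i) * (1 / W j) \<le> K" unfolding K_def
      using W by (intro mult_left_mono sum_nonneg) (auto simp: less_imp_le)
    then show ?thesis using W[OF j] by (simp add: field_simps)
  qed
  \<comment> \<open>Chosen so that all the errors of \<open>flux_excess_local\<close> add up to
    \<open>\<delta> / 2\<close>, which cannot compensate a deficit \<open>\<delta>\<close>.\<close>
  define e where "e = \<delta> / (2 * (2 * K * DIM('a) + 1))"
  have den: "2 * K * DIM('a) + 1 > 0" using Kpos by (intro add_nonneg_pos mult_nonneg_nonneg) auto
  have e: "e > 0" unfolding e_def using \<delta> den by simp
  obtain d where d: "d > 0" "\<forall>a b. p \<in> cbox a b \<longrightarrow> (\<forall>i\<in>Basis. a \<bullet> i < b \<bullet> i) \<longrightarrow> (\<Sum>i\<in>Basis. (b - a) \<bullet> i) < d \<longrightarrow>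
     (\<forall>j\<in>Basis. (\<Sum>i\<in>Basis. (b - a) \<bullet> i) \<le> K * ((b - a) \<bullet> j)) \<longrightarrow>
     flux_excess G h a b \<ge> ((\<Sum>i\<in>Basis. DG p i \<bullet> i - 2 * e * K) - h p - e) * (\<Prod>i\<in>Basis. (b - a) \<bullet> i)"
    by (rule exE[OF flux_excess_local[OF G h D e, of p K]], erule conjE, rule that)
  have "(\<lambda>k. (\<Sum>i\<in>Basis. W i) / 2 ^ k) \<longlonglongrightarrow> 0"
    by (rule LIMSEQ_divide_realpow_zero) simp
  then obtain k where k: "(\<Sum>i\<in>Basis. W i) / 2 ^ k < d"
    using order_tendstoD(2)[OF _ d(1)] by (force simp: eventually_sequentially)
  define a1 b1 where "a1 = fst (f k)" and "b1 = snd (f k)"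
  have sd: "(b1 - a1) \<bullet> i = W i / 2 ^ k" if "i \<in> Basis" for i using P[of k] that by (auto simp: P_def a1_def b1_def)
  have ss: "(\<Sum>i\<in>Basis. (b1 - a1) \<bullet> i) = (\<Sum>i\<in>Basis. W i) / 2 ^ k"
    by (simp add: sd sum_divide_distrib)
  define V1 where "V1 = (\<Prod>i\<in>Basis. (b1 - a1) \<bullet> i)"
  have V1: "V1 > 0" unfolding V1_def using sd W by (intro prod_pos) auto
  have "((\<Sum>i\<in>Basis. DG p i \<bullet> i - 2 * e * K) - h p - e) * V1 \<le> flux_excess G h a1 b1"
    unfolding V1_def
  proof (rule d(2)[rule_format])
    show "p \<in> cbox a1 b1" using p by (simp add: a1_def b1_def)
    show "a1 \<bullet> i < b1 \<bullet> i" if "i \<in> Basis" for i using lt that by (simp add: a1_def b1_def)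
    show "(\<Sum>i\<in>Basis. (b1 - a1) \<bullet> i) < d" using k ss by simp
    show "(\<Sum>i\<in>Basis. (b1 - a1) \<bullet> i) \<le> K * ((b1 - a1) \<bullet> j)" if "j \<in> Basis" for j
      using divide_right_mono[OF KW[OF that], of "2 ^ k"] unfolding ss by (simp add: sd that)
  qed
  also have "\<dots> \<le> - \<delta> * V1" using P[of k] unfolding P_def a1_def b1_def V1_def by blast
  finally have "(\<Sum>i\<in>Basis. DG p i \<bullet> i - 2 * e * K) - h p - e \<le> - \<delta>"
    using V1 by (simp only: mult_le_cancel_right_pos)
  then have "(\<Sum>i\<in>Basis. DG p i \<bullet> i) - h p + \<delta> \<le> e * (2 * K * DIM('a) + 1)"
    by (simp add: sum_subtractf algebra_simps)
  also have "\<dots> = \<delta> / 2" using den unfolding e_def by (simp add: field_simps)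
  finally show False using le[of p] \<delta> by simp
qed

section \<open>Mean values weighted by a bump\<close>

lemma DERIV_max_0_square: "((\<lambda>s::real. (max 0 s)\<^sup>2) has_real_derivative 2 * max 0 s) (at s)"
proof -
  consider "s < 0" | "s > 0" | "s = 0" by linarith
  then show ?thesis
  proof cases
    case 1
    have "eventually (\<lambda>x. x < 0) (nhds s)" using 1 by (simp add: eventually_nhds_in_open lessThan_def[symmetric] open_lessThan order_tendstoD(2)[OF filterlim_ident])
    then have "eventually (\<lambda>x. (max 0 x)\<^sup>2 = 0) (nhds s)" by eventually_elim auto
    then show ?thesis using 1 by (subst DERIV_cong_ev[OF refl _ refl, where g="\<lambda>_. 0"]) auto
  next
    case 2
    have "eventually (\<lambda>x. x > 0) (nhds s)" using 2 by (simp add: order_tendstoD(1)[OF filterlim_ident])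
    then have "eventually (\<lambda>x. (max 0 x)\<^sup>2 = x\<^sup>2) (nhds s)" by eventually_elim auto
    then show ?thesis using 2 by (subst DERIV_cong_ev[OF refl _ refl, where g="\<lambda>x. x\<^sup>2"]) (auto intro!: derivative_eq_intros)
  next
    case 3
    have "((\<lambda>h. (max 0 h)\<^sup>2 / h) \<longlongrightarrow> 0) (at (0::real))"
    proof (rule Lim_null_comparison[OF always_eventually])
      show "\<forall>h. norm ((max 0 h)\<^sup>2 / h) \<le> \<bar>h\<bar>" for h :: real
        by (auto simp: max_def power2_eq_square abs_mult)
      show "((\<lambda>h. \<bar>h\<bar>) \<longlongrightarrow> 0) (at (0::real))" using tendsto_rabs_zero tendsto_ident_at by blast
    qed
    then show ?thesis using 3 by (simp add: DERIV_def)
  qed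
qed

abbreviation bump :: "'a::euclidean_space \<Rightarrow> real" where
  "bump y \<equiv> max 0 (1 - (norm y)\<^sup>2)"

lemma has_derivative_bump_square:
  "((\<lambda>y::'a::euclidean_space. (bump y)\<^sup>2) has_derivative (\<lambda>h. - 4 * bump y * (y \<bullet> h))) (at y)"
proof -
  have "((\<lambda>y::'a. 1 - (norm y)\<^sup>2) has_derivative (\<lambda>h. - (2 * (y \<bullet> h)))) (at y)"
    unfolding power2_norm_eq_inner
    by (auto intro!: derivative_eq_intros simp: inner_commute)
  from diff_chain_at[OF this DERIV_max_0_square[unfolded has_field_derivative_def]]
  show ?thesis by (simp add: o_def mult_ac)
qed

text \<open>The field \<open>(bump y)^2 * G y\<close> vanishes on the faces of the cube, where the
  norm is at least one. Its divergence is \<open>(bump y)^2\<close> times that of \<open>G\<close>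
  minus \<open>4 * bump y * (G y \<bullet> y)\<close>; the first term is nonnegative, so
  \<open>flux_excess_nonneg\<close> with the second as \<open>h\<close> gives the sign. The square
  makes the truncated weight differentiable across the unit sphere.\<close>

lemma bump_flux_nonneg:
  fixes G :: "'a::euclidean_space \<Rightarrow> 'a"
  assumes D: "\<And>x. (G has_derivative DG x) (at x)" and nn: "\<And>x. 0 \<le> (\<Sum>i\<in>Basis. DG x i \<bullet> i)"
  shows "0 \<le> integral (cbox (- One) One) (\<lambda>y. (G y \<bullet> y) * bump y)"
proof -
  have G: "continuous_on UNIV G"
    using D by (meson continuous_at_imp_continuous_on has_derivative_continuous)
  define F where "F y = (bump y)\<^sup>2 *\<^sub>R G y" for y
  define h where "h y = - 4 * ((G y \<bullet> y) * bump y)" for y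
  have "0 \<le> flux_excess F h (- One) One"
  proof (rule flux_excess_nonneg)
    show "(F has_derivative (\<lambda>u. (bump x)\<^sup>2 *\<^sub>R DG x u + (- 4 * bump x * (x \<bullet> u)) *\<^sub>R G x)) (at x)" for x
      unfolding F_def by (rule has_derivative_scaleR[OF has_derivative_bump_square D])
    show "continuous_on UNIV h" unfolding h_def by (intro continuous_intros G)
    fix x
    have "(\<Sum>i\<in>Basis. ((bump x)\<^sup>2 *\<^sub>R DG x i + (- 4 * bump x * (x \<bullet> i)) *\<^sub>R G x) \<bullet> i)
       = (bump x)\<^sup>2 * (\<Sum>i\<in>Basis. DG x i \<bullet> i) + - 4 * bump x * (\<Sum>i\<in>Basis. (x \<bullet> i) * (G x \<bullet> i))"
      by (simp add: inner_add_left inner_diff_left sum_subtractf sum.distrib sum_distrib_left sum_distrib_right mult_ac)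
    also have "(\<Sum>i\<in>Basis. (x \<bullet> i) * (G x \<bullet> i)) = G x \<bullet> x"
      by (subst euclidean_inner[of "G x" x]) (simp add: mult.commute)
    finally show "h x \<le> (\<Sum>i\<in>Basis. ((bump x)\<^sup>2 *\<^sub>R DG x i + (- 4 * bump x * (x \<bullet> i)) *\<^sub>R G x) \<bullet> i)"
      using nn[of x] by (simp add: h_def)
  next
    show "\<forall>i\<in>Basis. (- One::'a) \<bullet> i < One \<bullet> i" by simp
  qed
  also have "flux_excess F h (- One) One = - integral (cbox (- One) One) h"
  proof -
    have z: "F (upd i r x) = 0" if i: "i \<in> Basis" and r: "\<bar>r\<bar> = 1" for i x r
    proof -
      have "1 \<le> norm (upd i r x)" using Basis_le_norm[OF i, of "upd i r x"] i r by (simp add: upd_inner)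
      then have "1 \<le> (norm (upd i r x))\<^sup>2" by (simp add: power2_eq_square mult_ge1_I)
      then show ?thesis by (simp add: F_def)
    qed
    show ?thesis unfolding flux_excess_def by (simp add: z)
  qed
  also have "\<dots> = 4 * integral (cbox (- One) One) (\<lambda>y. (G y \<bullet> y) * bump y)"
    unfolding h_def by simp
  finally show ?thesis by simp
qed

text \<open>The mean is nondecreasing in the radius: its derivative in \<open>r\<close> is the
  bump-weighted radial component of the gradient, and the rescaled gradient again has nonnegative
  divergence, now with the extra factor \<open>r\<close>.\<close>

lemma subharmonic_bump_mean:
  fixes k :: "'a::euclidean_space \<Rightarrow> real"
  assumes D1: "\<And>x. (k has_derivative (\<lambda>h. Dk x \<bullet> h)) (at x)" and D2: "\<And>x. (Dk has_derivative DDk x) (at x)"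
    and nn: "\<And>x. 0 \<le> (\<Sum>i\<in>Basis. DDk x i \<bullet> i)" and r: "0 \<le> r"
  shows "integral (cbox (- One) One) (\<lambda>y::'a. k \<xi> * bump y) \<le> integral (cbox (- One) One) (\<lambda>y. k (\<xi> + r *\<^sub>R y) * bump y)"
proof -
  have kc: "continuous_on UNIV k"
    using D1 by (meson continuous_at_imp_continuous_on has_derivative_continuous)
  have Dc: "continuous_on UNIV Dk"
    using D2 by (meson continuous_at_imp_continuous_on has_derivative_continuous)
  define N where "N r = integral (cbox (- One) One) (\<lambda>y. k (\<xi> + r *\<^sub>R y) * bump y)" for r
  define N' where "N' r = integral (cbox (- One) One) (\<lambda>y. (Dk (\<xi> + r *\<^sub>R y) \<bullet> y) * bump y)" for r
  have der: "(N has_real_derivative N' r) (at r)" for r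
    unfolding N_def N'_def
  proof (rule leibniz_rule_field_derivative[where U=UNIV])
    fix r y
    have "((\<lambda>r. \<xi> + r *\<^sub>R y) has_derivative (\<lambda>s. s *\<^sub>R y)) (at r)"
      by (auto intro!: derivative_eq_intros)
    from diff_chain_at[OF this D1]
    have "((\<lambda>r. k (\<xi> + r *\<^sub>R y)) has_derivative (\<lambda>s. Dk (\<xi> + r *\<^sub>R y) \<bullet> (s *\<^sub>R y))) (at r)"
      by (simp add: o_def)
    then have "((\<lambda>r. k (\<xi> + r *\<^sub>R y)) has_real_derivative (Dk (\<xi> + r *\<^sub>R y) \<bullet> y)) (at r)"
      by (rule has_derivative_imp_has_field_derivative) simp
    then show "((\<lambda>r. k (\<xi> + r *\<^sub>R y) * bump y) has_real_derivative (Dk (\<xi> + r *\<^sub>R y) \<bullet> y) * bump y) (at r within UNIV)"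
      by (rule DERIV_cmult_right)
  next
    fix r show "(\<lambda>y. k (\<xi> + r *\<^sub>R y) * bump y) integrable_on cbox (- One) One"
      by (intro integrable_continuous continuous_intros continuous_on_compose2[OF kc]) auto
  next
    show "continuous_on (UNIV \<times> cbox (- One) One) (\<lambda>(r, y). (Dk (\<xi> + r *\<^sub>R y) \<bullet> y) * bump y)"
      unfolding split_beta by (intro continuous_intros continuous_on_compose2[OF Dc]) auto
  qed auto
  have N'nn: "N' s \<ge> 0" if "s \<ge> 0" for s
    unfolding N'_def
  proof (rule bump_flux_nonneg)
    fix x
    have "((\<lambda>y. \<xi> + s *\<^sub>R y) has_derivative (\<lambda>u. s *\<^sub>R u)) (at x)"
      by (auto intro!: derivative_eq_intros)
    from diff_chain_at[OF this D2]
    show "((\<lambda>y. Dk (\<xi> + s *\<^sub>R y)) has_derivative (\<lambda>u. DDk (\<xi> + s *\<^sub>R x) (s *\<^sub>R u))) (at x)"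
      by (simp add: o_def)
    have "linear (DDk (\<xi> + s *\<^sub>R x))" using D2 has_derivative_linear by blast
    then have "(\<Sum>i\<in>Basis. DDk (\<xi> + s *\<^sub>R x) (s *\<^sub>R i) \<bullet> i) = s * (\<Sum>i\<in>Basis. DDk (\<xi> + s *\<^sub>R x) i \<bullet> i)"
      by (simp add: linear_cmul sum_distrib_left)
    then show "0 \<le> (\<Sum>i\<in>Basis. DDk (\<xi> + s *\<^sub>R x) (s *\<^sub>R i) \<bullet> i)" using nn that by simp
  qed
  have "N 0 \<le> N r"
    by (rule DERIV_nonneg_imp_nondecreasing[OF r]) (use der N'nn in blast)
  then show ?thesis by (simp add: N_def)
qed

section \<open>The standard Gaussian measure\<close>

definition stdn_density :: "'a::euclidean_space \<Rightarrow> real" where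
  "stdn_density y = (\<Prod>b\<in>Basis. std_normal_density (y \<bullet> b))"

text \<open>Polymorphic, so that the same measure describes the noise in space and the
  one-dimensional variables of the transport. On \<open>real^'n\<close> it is
  \<open>gauss_measure\<close>.\<close>

definition stdn :: "'a::euclidean_space measure" where
  "stdn = density lborel (\<lambda>y. ennreal (stdn_density y))"

lemma norm_square_eq_sum_Basis: "(norm x)\<^sup>2 = (\<Sum>i\<in>Basis. (x \<bullet> i)\<^sup>2)"
  using euclidean_inner[of x x] unfolding power2_norm_eq_inner by (simp only: power2_eq_square)

lemma norm_le_one_add_square: "norm x \<le> 1 + (norm x)\<^sup>2"
proof -
  have "2 * norm x \<le> (norm x)\<^sup>2 + 1" using sum_squares_bound[of "norm x" 1] by simp
  then show ?thesis using norm_ge_zero[of x] by linarith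
qed

lemma stdn_density_eq:
  "stdn_density (y::'a::euclidean_space) = (2 * pi) powr (- real DIM('a) / 2) * exp (- (norm y)\<^sup>2 / 2)"
proof -
  have "stdn_density y = (\<Prod>b\<in>(Basis::'a set). 1 / sqrt (2 * pi)) * exp (\<Sum>b\<in>Basis. - (y \<bullet> b)\<^sup>2 / 2)"
    unfolding stdn_density_def std_normal_density_def prod.distrib exp_sum[OF finite_Basis] ..
  moreover have "(\<Sum>b\<in>Basis. - (y \<bullet> b)\<^sup>2 / 2) = - (norm y)\<^sup>2 / 2"
  proof -
    have "(norm y)\<^sup>2 = (\<Sum>b\<in>Basis. (y \<bullet> b)\<^sup>2)"
      by (rule norm_square_eq_sum_Basis)
    then show ?thesis by (simp add: sum_negf sum_divide_distrib)
  qed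
  moreover have "(\<Prod>b\<in>(Basis::'a set). 1 / sqrt (2 * pi)) = (2 * pi) powr (- real DIM('a) / 2)"
  proof -
    have "1 / sqrt (2 * pi) = (2 * pi) powr (- 1 / 2)"
      using powr_minus[of "2 * pi" "1 / 2"] powr_half_sqrt[of "2 * pi"] by (simp add: inverse_eq_divide)
    then have "(1 / sqrt (2 * pi)) ^ DIM('a) = ((2 * pi) powr (- 1 / 2)) powr real DIM('a)"
      using powr_realpow[of "(2 * pi) powr (- 1 / 2)" "DIM('a)"] by simp
    also have "\<dots> = (2 * pi) powr (- real DIM('a) / 2)" by (simp only: powr_powr) simp
    finally show ?thesis by simp
  qed
  ultimately show ?thesis by simp
qed

lemma stdn_density_pos: "stdn_density y > 0"
  by (simp add: stdn_density_eq)

lemma stdn_density_measurable [measurable]: "stdn_density \<in> borel_measurable borel"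
  unfolding stdn_density_def[abs_def] by measurable

lemma sets_stdn [simp, measurable_cong]: "sets stdn = sets borel" and space_stdn [simp]: "space stdn = UNIV"
  by (auto simp: stdn_def)

lemma nn_integral_stdn: "f \<in> borel_measurable borel \<Longrightarrow>
    (\<integral>\<^sup>+y. f y \<partial>stdn) = (\<integral>\<^sup>+y. ennreal (stdn_density y) * f y \<partial>lborel)"
  unfolding stdn_def by (subst nn_integral_density) auto

lemma integral_stdn: "f \<in> borel_measurable borel \<Longrightarrow>
    (\<integral>y. f y \<partial>stdn) = (\<integral>y. stdn_density y * f y \<partial>lborel)" for f :: "_ \<Rightarrow> real"
  unfolding stdn_def by (subst integral_density) (auto intro: less_imp_le[OF stdn_density_pos])

lemma integrable_stdn: "f \<in> borel_measurable borel \<Longrightarrow>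
    integrable stdn f \<longleftrightarrow> integrable lborel (\<lambda>y. stdn_density y * f y)" for f :: "_ \<Rightarrow> real"
  unfolding stdn_def by (subst integrable_density) (auto intro: less_imp_le[OF stdn_density_pos])

lemma prob_space_stdn: "prob_space (stdn :: 'a::euclidean_space measure)"
proof
  have "(\<integral>\<^sup>+y. ennreal (stdn_density (y::'a)) \<partial>lborel) = (\<integral>\<^sup>+(y::'a). (\<Prod>b\<in>Basis. ennreal (std_normal_density (y \<bullet> b))) \<partial>lborel)"
    by (simp add: stdn_density_def prod_ennreal)
  also have "\<dots> = (\<Prod>b\<in>(Basis::'a set). (\<integral>\<^sup>+x. ennreal (std_normal_density x) \<partial>lborel))"
    by (rule nn_integral_lborel_prod) auto
  also have "(\<integral>\<^sup>+x. ennreal (std_normal_density x) \<partial>lborel) = 1"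
    by (subst nn_integral_eq_integral) auto
  finally show "emeasure (stdn :: 'a measure) (space stdn) = 1"
    unfolding stdn_def by (simp add: emeasure_density)
qed

lemma nn_integral_lborel_affine:
  fixes f :: "'a::euclidean_space \<Rightarrow> ennreal"
  assumes [measurable]: "f \<in> borel_measurable borel" and c: "c \<noteq> 0"
  shows "(\<integral>\<^sup>+x. f x \<partial>lborel) = ennreal (\<bar>c\<bar> ^ DIM('a)) * (\<integral>\<^sup>+x. f (t + c *\<^sub>R x) \<partial>lborel)"
  by (subst lborel_affine[OF c, of t]) (simp add: nn_integral_density nn_integral_distr nn_integral_cmult)

lemma integral_lborel_affine:
  fixes f :: "'a::euclidean_space \<Rightarrow> real"
  assumes [measurable]: "f \<in> borel_measurable borel" and c: "c \<noteq> 0"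
  shows "(\<integral>x. f x \<partial>lborel) = \<bar>c\<bar> ^ DIM('a) * (\<integral>x. f (t + c *\<^sub>R x) \<partial>lborel)"
  by (subst lborel_affine[OF c, of t]) (simp add: integral_density integral_distr)

text \<open>The substitution \<open>R = \<rho> + 2 * x\<close> reduces this to the integral of
  \<open>x * exp (- x)\<close> over the half line.\<close>

lemma integral_max_0_exp:
  fixes \<rho> :: real
  shows "has_bochner_integral lborel (\<lambda>R. max 0 (R - \<rho>) * exp (- R / 2)) (4 * exp (- \<rho> / 2))"
proof -
  have "has_bochner_integral lborel (\<lambda>x::real. (x ^ 1 * exp (- x)) * indicator {0..} x) (fact 1)"
  proof (rule has_bochner_integral_nn_integral)
    show "AE x in lborel. 0 \<le> (x ^ 1 * exp (- x)) * indicator {0::real..} x"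
      by (auto simp: indicator_def)
    have "(\<integral>\<^sup>+x. ennreal ((x ^ 1 * exp (- x)) * indicator {0::real..} x) \<partial>lborel)
       = (\<integral>\<^sup>+x. ennreal (x ^ 1 * exp (- x)) * indicator {0..} x \<partial>lborel)"
      by (rule nn_integral_cong) (auto simp: indicator_def)
    then show "(\<integral>\<^sup>+x. ennreal ((x ^ 1 * exp (- x)) * indicator {0::real..} x) \<partial>lborel) = ennreal (fact 1)"
      using nn_intergal_power_times_exp_Ici[of 1] by simp
  qed auto
  moreover have "(x ^ 1 * exp (- x)) * indicator {0..} x = max 0 x * exp (- x)" for x :: real
    by (auto simp: indicator_def)
  ultimately have "has_bochner_integral lborel (\<lambda>x::real. max 0 x * exp (- x)) 1"
    by (simp only: fact_1)
  then have "has_bochner_integral lborel (\<lambda>x::real. (2 * exp (- \<rho> / 2)) * (max 0 x * exp (- x))) ((2 * exp (- \<rho> / 2)) * 1)"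
    by (rule has_bochner_integral_mult_right)
  moreover have "(2 * exp (- \<rho> / 2)) * (max 0 x * exp (- x)) = max 0 ((\<rho> + 2 * x) - \<rho>) * exp (- (\<rho> + 2 * x) / 2)" for x
  proof -
    have "exp (- (\<rho> + 2 * x) / 2) = exp (- \<rho> / 2) * exp (- x)"
      by (simp add: exp_add[symmetric] field_simps)
    moreover have "max 0 ((\<rho> + 2 * x) - \<rho>) = 2 * max 0 x" by (simp add: max_def)
    ultimately show ?thesis by simp
  qed
  ultimately have "has_bochner_integral lborel (\<lambda>x::real. max 0 ((\<rho> + 2 * x) - \<rho>) * exp (- (\<rho> + 2 * x) / 2)) (2 * exp (- \<rho> / 2))"
    by simp
  then show ?thesis
    using lborel_has_bochner_integral_real_affine_iff[of 2 "\<lambda>R. max 0 (R - \<rho>) * exp (- R / 2)" "4 * exp (- \<rho> / 2)" \<rho>]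
    by simp
qed

text \<open>The Gaussian is a mixture of the kernels \<open>max 0 (R - |y|^2)\<close> with weights \<open>exp (- R / 2)\<close>.\<close>

lemma gauss_mean_of_bump_mean:
  fixes D :: "'a::euclidean_space \<Rightarrow> real"
  assumes [measurable]: "D \<in> borel_measurable borel"
    and int: "integrable lborel (\<lambda>y. D y * exp (- (norm y)\<^sup>2 / 2))"
    and nn: "\<And>R. R > 0 \<Longrightarrow> 0 \<le> (\<integral>y. D y * max 0 (R - (norm y)\<^sup>2) \<partial>lborel)"
  shows "0 \<le> (\<integral>y. D y * exp (- (norm y)\<^sup>2 / 2) \<partial>lborel)"
proof -
  define f where "f y R = D y * (max 0 (R - (norm y)\<^sup>2) * exp (- R / 2))" for y R
  have hb: "has_bochner_integral lborel (f y) (D y * (4 * exp (- (norm y)\<^sup>2 / 2)))" for y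
    unfolding f_def by (rule has_bochner_integral_mult_right[OF integral_max_0_exp])
  have hbn: "has_bochner_integral lborel (\<lambda>R. norm (f y R)) (\<bar>D y\<bar> * (4 * exp (- (norm y)\<^sup>2 / 2)))" for y
    using has_bochner_integral_mult_right[OF integral_max_0_exp, of "\<bar>D y\<bar>" "(norm y)\<^sup>2"]
    unfolding f_def by (simp add: abs_mult)
  have m[measurable]: "(\<lambda>(y, R). f y R) \<in> borel_measurable (lborel \<Otimes>\<^sub>M lborel)"
    unfolding f_def by measurable
  have pint: "integrable (lborel \<Otimes>\<^sub>M lborel) (\<lambda>(y, R). f y R)"
  proof (rule lborel_pair.Fubini_integrable[OF m])
    have "(\<lambda>y. \<integral>R. norm (f y R) \<partial>lborel) = (\<lambda>y. 4 * \<bar>D y * exp (- (norm y)\<^sup>2 / 2)\<bar>)"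
      using hbn by (auto simp: has_bochner_integral_iff abs_mult fun_eq_iff)
    then show "integrable lborel (\<lambda>y. \<integral>R. norm (case (y, R) of (y, R) \<Rightarrow> f y R) \<partial>lborel)"
      using int by simp
    show "AE y in lborel. integrable lborel (\<lambda>R. case (y, R) of (y, R) \<Rightarrow> f y R)"
      using hb by (simp add: has_bochner_integral_iff)
  qed
  have "4 * (\<integral>y. D y * exp (- (norm y)\<^sup>2 / 2) \<partial>lborel) = (\<integral>y. (\<integral>R. f y R \<partial>lborel) \<partial>lborel)"
    using hb by (simp add: has_bochner_integral_iff mult.left_commute[of _ 4])
  also have "\<dots> = (\<integral>R. (\<integral>y. f y R \<partial>lborel) \<partial>lborel)"
    by (rule lborel_pair.Fubini_integral[OF pint, symmetric])
  also have "\<dots> \<ge> 0"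
  proof (rule integral_nonneg_AE, rule AE_I2)
    fix R :: real
    have e: "(\<integral>y. f y R \<partial>lborel) = (\<integral>y. D y * max 0 (R - (norm y)\<^sup>2) \<partial>lborel) * exp (- R / 2)"
      unfolding f_def by (simp add: mult.assoc[symmetric])
    show "0 \<le> (\<integral>y. f y R \<partial>lborel)"
    proof (cases "R > 0")
      case True then show ?thesis unfolding e using nn by simp
    next
      case False
      then have "R - (norm y)\<^sup>2 \<le> 0" for y :: 'a using zero_le_power2[of "norm y"] by linarith
      then have "max 0 (R - (norm y)\<^sup>2) = 0" for y :: 'a by (rule max_absorb1)
      then show ?thesis unfolding e by simp
    qed
  qed
  finally show ?thesis by simp
qed

text \<open>After subtracting \<open>k \<xi>\<close> the claim is the nonnegativity of a Gaussian
  integral of \<open>D\<close>. Scaling by \<open>sqrt R\<close> turns the kernel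
  \<open>max 0 (R - |y|^2)\<close> into \<open>R\<close> times the bump, so each member of the
  mixture is a bump mean of radius \<open>e * sqrt R\<close>.\<close>

lemma subharmonic_gauss_mean:
  fixes k :: "'a::euclidean_space \<Rightarrow> real"
  assumes D1: "\<And>x. (k has_derivative (\<lambda>h. Dk x \<bullet> h)) (at x)" and D2: "\<And>x. (Dk has_derivative DDk x) (at x)"
    and nn: "\<And>x. 0 \<le> (\<Sum>i\<in>Basis. DDk x i \<bullet> i)" and e: "0 \<le> e"
    and int: "integrable stdn (\<lambda>g. k (\<xi> + e *\<^sub>R g))"
  shows "k \<xi> \<le> (\<integral>g. k (\<xi> + e *\<^sub>R g) \<partial>stdn)"
proof -
  interpret prob_space "stdn :: 'a measure" by (rule prob_space_stdn)
  have kc: "continuous_on UNIV k"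
    using D1 by (meson continuous_at_imp_continuous_on has_derivative_continuous)
  then have [measurable]: "k \<in> borel_measurable borel" by (rule borel_measurable_continuous_onI)
  define D where "D y = k (\<xi> + e *\<^sub>R y) - k \<xi>" for y
  have [measurable]: "D \<in> borel_measurable borel" unfolding D_def by measurable
  have Dint: "integrable stdn D" unfolding D_def using int by simp
  define c where "c = (2 * pi) powr (- real DIM('a) / 2)"
  have c: "c > 0" unfolding c_def by simp
  have sd: "stdn_density y * D y = c * (D y * exp (- (norm y)\<^sup>2 / 2))" for y :: 'a
    by (simp add: stdn_density_eq c_def)
  have i1: "integrable lborel (\<lambda>y. D y * exp (- (norm y)\<^sup>2 / 2))"
    using Dint c unfolding integrable_stdn[OF \<open>D \<in> _\<close>] sd by simp
  have "0 \<le> (\<integral>y. D y * exp (- (norm y)\<^sup>2 / 2) \<partial>lborel)"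
  proof (rule gauss_mean_of_bump_mean[OF _ i1])
    fix R :: real assume R: "R > 0"
    define s where "s = sqrt R"
    have s: "s > 0" "s\<^sup>2 = R" using R by (auto simp: s_def)
    have "(\<integral>y. D y * max 0 (R - (norm y)\<^sup>2) \<partial>lborel) = s ^ DIM('a) * (\<integral>y. D (0 + s *\<^sub>R y) * max 0 (R - (norm (0 + s *\<^sub>R y))\<^sup>2) \<partial>lborel)"
      using integral_lborel_affine[of "\<lambda>y. D y * max 0 (R - (norm y)\<^sup>2)" s 0] s by simp
    also have "(\<lambda>y. D (0 + s *\<^sub>R y) * max 0 (R - (norm (0 + s *\<^sub>R y))\<^sup>2)) = (\<lambda>y. R * (D (s *\<^sub>R y) * bump y))"
    proof
      fix y :: 'a
      have "R - (norm (s *\<^sub>R y))\<^sup>2 = R * (1 - (norm y)\<^sup>2)" using s by (simp add: power_mult_distrib algebra_simps)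
      then have "max 0 (R - (norm (s *\<^sub>R y))\<^sup>2) = R * bump y"
        using R by (simp add: max_def zero_le_mult_iff mult_le_0_iff not_le)
      then show "D (0 + s *\<^sub>R y) * max 0 (R - (norm (0 + s *\<^sub>R y))\<^sup>2) = R * (D (s *\<^sub>R y) * bump y)" by simp
    qed
    also have "(\<integral>y. R * (D (s *\<^sub>R y) * bump y) \<partial>lborel) = R * integral (cbox (- One) One) (\<lambda>y. D (s *\<^sub>R y) * bump y)"
    proof -
      have cD: "continuous_on (cbox (- One) One) (\<lambda>y. D (s *\<^sub>R y) * bump y)"
        unfolding D_def by (intro continuous_intros continuous_on_compose2[OF kc]) auto
      have out: "D (s *\<^sub>R y) * bump y = indicator (cbox (- One) One) y *\<^sub>R (D (s *\<^sub>R y) * bump y)" for y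
      proof (cases "y \<in> cbox (- One) One")
        case False
        then obtain i where i: "i \<in> Basis" "\<bar>y \<bullet> i\<bar> > 1" by (auto simp: mem_box)
        then have "1 \<le> norm y" using Basis_le_norm[OF i(1), of y] by simp
        then have "bump y = 0" by (simp add: power2_eq_square mult_ge1_I)
        then show ?thesis by simp
      qed simp
      have "(\<integral>y. D (s *\<^sub>R y) * bump y \<partial>lborel) = (LINT y:cbox (- One) One|lborel. D (s *\<^sub>R y) * bump y)"
        unfolding set_lebesgue_integral_def by (subst out) (rule refl)
      also have "\<dots> = integral (cbox (- One) One) (\<lambda>y. D (s *\<^sub>R y) * bump y)"
        by (rule set_borel_integral_eq_integral(2)[OF borel_integrable_compact[OF compact_cbox cD, folded set_integrable_def]])
      finally show ?thesis by simp
    qed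
    finally have eq: "(\<integral>y. D y * max 0 (R - (norm y)\<^sup>2) \<partial>lborel)
       = s ^ DIM('a) * (R * integral (cbox (- One) One) (\<lambda>y. D (s *\<^sub>R y) * bump y))" .
    have "integral (cbox (- One) One) (\<lambda>y. D (s *\<^sub>R y) * bump y) \<ge> 0"
    proof -
      have "integral (cbox (- One) One) (\<lambda>y. D (s *\<^sub>R y) * bump y)
         = integral (cbox (- One) One) (\<lambda>y. k (\<xi> + (e * s) *\<^sub>R y) * bump y) - integral (cbox (- One) One) (\<lambda>y::'a. k \<xi> * bump y)"
        unfolding D_def left_diff_distrib scaleR_scaleR
        by (intro integral_diff integrable_continuous continuous_intros continuous_on_compose2[OF kc]) auto
      then show ?thesis using subharmonic_bump_mean[OF D1 D2 nn, of "e * s" \<xi>] e s by simp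
    qed
    then show "0 \<le> (\<integral>y. D y * max 0 (R - (norm y)\<^sup>2) \<partial>lborel)"
      unfolding eq using R s by simp
  qed simp
  then have "0 \<le> (\<integral>g. D g \<partial>stdn)"
    unfolding integral_stdn[OF \<open>D \<in> _\<close>] sd using c by simp
  also have "(\<integral>g. D g \<partial>stdn) = (\<integral>g. k (\<xi> + e *\<^sub>R g) \<partial>stdn) - k \<xi>"
    unfolding D_def using int by (subst Bochner_Integration.integral_diff) (auto simp: prob_space[unfolded space_stdn])
  finally show ?thesis by simp
qed

subsection \<open>One-dimensional transport\<close>

lemma cumulative_integral:
  fixes G :: "real \<Rightarrow> real"
  assumes c: "continuous_on UNIV G" and pos: "\<And>x. G x > 0" and int: "integrable lborel G"
  defines "H \<equiv> \<lambda>z. \<integral>x. indicator {..z} x *\<^sub>R G x \<partial>lborel"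
  shows "(H has_real_derivative G z) (at z)" and "0 < H z" and "H z < (\<integral>x. G x \<partial>lborel)"
    and "\<And>p. 0 < p \<Longrightarrow> p < (\<integral>x. G x \<partial>lborel) \<Longrightarrow> \<exists>z. H z = p" and "strict_mono H"
proof -
  have si: "integrable lborel (\<lambda>x. indicator A x *\<^sub>R G x)" if "A \<in> sets borel" for A
    using int that by (intro integrable_mult_indicator) auto
  have diff: "H w = H a + integral {a..w} G" if "a \<le> w" for a w
  proof -
    have "H w = (\<integral>x. indicator {..a} x *\<^sub>R G x + indicator {a<..w} x *\<^sub>R G x \<partial>lborel)"
      unfolding H_def using that by (intro Bochner_Integration.integral_cong) (auto simp: indicator_def)
    also have "\<dots> = H a + (\<integral>x. indicator {a<..w} x *\<^sub>R G x \<partial>lborel)"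
      unfolding H_def by (intro Bochner_Integration.integral_add si) auto
    also have "(\<integral>x. indicator {a<..w} x *\<^sub>R G x \<partial>lborel) = (\<integral>x. indicator {a..w} x *\<^sub>R G x \<partial>lborel)"
    proof (intro integral_cong_AE)
      show "AE x in lborel. indicator {a<..w} x *\<^sub>R G x = indicator {a..w} x *\<^sub>R G x"
        using AE_lborel_singleton[of a] by eventually_elim (auto simp: indicator_def)
    qed (use int in auto)
    also have "\<dots> = integral {a..w} G"
      using set_borel_integral_eq_integral(2)[of "{a..w}" G] si[of "{a..w}"]
      by (simp add: set_integrable_def set_lebesgue_integral_def)
    finally show ?thesis .
  qed
  show der: "(H has_real_derivative G z) (at z)" for z
  proof -
    have "((\<lambda>w. H (z - 1) + integral {z - 1..w} G) has_real_derivative G z) (at z within {z - 1..z + 1})"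
      by (rule DERIV_add[OF DERIV_const integral_has_real_derivative, simplified])
        (auto intro: continuous_on_subset[OF c])
    then have "((\<lambda>w. H (z - 1) + integral {z - 1..w} G) has_real_derivative G z) (at z within {z - 1<..<z + 1})"
      by (rule has_field_derivative_subset) auto
    then have "((\<lambda>w. H (z - 1) + integral {z - 1..w} G) has_real_derivative G z) (at z)"
      by (subst (asm) at_within_open) auto
    moreover have "\<forall>\<^sub>F w in nhds z. H w = H (z - 1) + integral {z - 1..w} G"
      using eventually_nhds_in_open[of "{z - 1<..}" z] by (auto elim!: eventually_mono intro!: diff)
    ultimately show ?thesis by (subst DERIV_cong_ev[OF refl _ refl])
  qed
  show sm: "strict_mono H"
  proof (rule strict_monoI)
    fix u w :: real assume "u < w"
    then show "H u < H w" by (rule DERIV_pos_imp_increasing) (meson der pos)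
  qed
  have ge0: "0 \<le> H w" for w
    unfolding H_def by (rule integral_nonneg_AE, rule AE_I2) (simp add: pos less_imp_le)
  have leI: "H w \<le> (\<integral>x. G x \<partial>lborel)" for w
    unfolding H_def by (rule integral_mono[OF si int]) (auto simp: indicator_def pos less_imp_le)
  show "0 < H z" using ge0[of "z - 1"] strict_monoD[OF sm, of "z - 1" z] by simp
  show "H z < (\<integral>x. G x \<partial>lborel)" using leI[of "z + 1"] strict_monoD[OF sm, of z "z + 1"] by simp
  have top: "(H \<longlongrightarrow> (\<integral>x. G x \<partial>lborel)) at_top"
    unfolding H_def by (rule tendsto_integral_at_top[OF _ int]) simp
  have lim: "(\<lambda>n. \<integral>x. indicator {- real n..} x *\<^sub>R G x \<partial>lborel) \<longlonglongrightarrow> (\<integral>x. G x \<partial>lborel)"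
  proof (rule integral_dominated_convergence[where w="G"])
    show "AE x in lborel. (\<lambda>n. indicator {- real n..} x *\<^sub>R G x) \<longlonglongrightarrow> G x"
    proof (rule AE_I2, rule tendsto_eventually)
      fix x
      obtain N :: nat where "- x \<le> real N" using real_arch_simple by blast
      then show "\<forall>\<^sub>F n in sequentially. indicator {- real n..} x *\<^sub>R G x = G x"
        by (intro eventually_sequentiallyI[of N]) (auto simp: indicator_def)
    qed
  qed (use int pos in \<open>auto simp: indicator_def less_imp_le\<close>)
  \<comment> \<open>The limit of \<open>H\<close> at minus infinity is obtained from the
    complementary tails, whose integrals converge by domination.\<close>
  have Hc: "H y = (\<integral>x. G x \<partial>lborel) - (\<integral>x. indicator {y..} x *\<^sub>R G x \<partial>lborel)" for y
  proof -
    have "(\<integral>x. G x \<partial>lborel) = (\<integral>x. indicator {..y} x *\<^sub>R G x + indicator {y..} x *\<^sub>R G x \<partial>lborel)"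
    proof (intro integral_cong_AE)
      show "AE x in lborel. G x = indicator {..y} x *\<^sub>R G x + indicator {y..} x *\<^sub>R G x"
        using AE_lborel_singleton[of y] by eventually_elim (auto simp: indicator_def)
    qed (use int in auto)
    also have "\<dots> = H y + (\<integral>x. indicator {y..} x *\<^sub>R G x \<partial>lborel)"
      unfolding H_def by (intro Bochner_Integration.integral_add si) auto
    finally show ?thesis by simp
  qed
  have bot: "(\<lambda>n. H (- real n)) \<longlonglongrightarrow> 0"
    using tendsto_diff[OF tendsto_const lim, of "\<integral>x. G x \<partial>lborel"] by (simp add: Hc)
  have cH: "continuous_on UNIV H"
    using der by (meson DERIV_isCont continuous_at_imp_continuous_on)
  fix p assume p: "0 < p" "p < (\<integral>x. G x \<partial>lborel)"
  obtain u where u: "H u < p"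
    using order_tendstoD(2)[OF bot p(1)] by (auto simp: eventually_sequentially)
  obtain w where w: "p < H w"
    using order_tendstoD(1)[OF top p(2)] eventually_happens[of _ "at_top::real filter"] by auto
  have "u \<le> w" using u w strict_mono_less[OF sm, of u w] by simp
  then show "\<exists>z. H z = p"
    using IVT'[of H u p w] u w continuous_on_subset[OF cH] by (auto intro: less_imp_le)
qed

text \<open>\<open>T\<close> is the quantile function of \<open>F\<close> composed with the Gaussian
  distribution function, both scaled to the mass of \<open>F\<close>. What is kept of it is the
  one-dimensional Monge--Ampere equation.\<close>

lemma gaussian_transport:
  fixes F :: "real \<Rightarrow> real"
  assumes c: "continuous_on UNIV F" and pos: "\<And>x. F x > 0" and int: "integrable lborel F"
  obtains T where "\<And>x. (T has_real_derivative std_normal_density x * (\<integral>x. F x \<partial>lborel) / F (T x)) (at x)"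
proof -
  define I where "I = (\<integral>x. F x \<partial>lborel)"
  define H where "H z = (\<integral>x. indicator {..z} x *\<^sub>R F x \<partial>lborel)" for z
  define N where "N z = (\<integral>x. indicator {..z} x *\<^sub>R std_normal_density x \<partial>lborel)" for z
  note HH = cumulative_integral[OF c pos int, folded H_def I_def]
  have cn: "continuous_on UNIV std_normal_density"
    unfolding std_normal_density_def[abs_def] by (intro continuous_intros) auto
  have "(\<integral>x. std_normal_density x \<partial>lborel) = 1" by (rule integral_normal_density) simp
  note NN = cumulative_integral[OF cn _ integrable_normal_density, folded N_def, unfolded this]
  have Npos: "0 < N z" "N z < 1" for z using NN(2,3)[of z] by (auto simp: normal_density_pos)
  have dN: "(N has_real_derivative std_normal_density z) (at z)" for z
    using NN(1)[of z] by (auto simp: normal_density_pos)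
  have inj: "inj H" using HH(5) by (simp add: strict_mono_eq inj_def)
  \<comment> \<open>\<open>H\<close> takes values only between \<open>0\<close> and
    \<open>I\<close>, and \<open>g\<close> is arbitrary elsewhere. The arguments
    \<open>I * N x\<close> below always lie strictly between the two.\<close>
  define g where "g = inv H"
  have gH: "g (H z) = z" for z using inj by (simp add: g_def)
  have Hg: "H (g p) = p" if "0 < p" "p < I" for p
    using HH(4)[OF that] unfolding g_def by (metis f_inv_into_f rangeI)
  have Ipos: "I > 0" using HH(2,3) by (meson less_trans)
  have dg: "(g has_real_derivative inverse (F (g p))) (at p)" if p: "0 < p" "p < I" for p
  proof (rule DERIV_inverse_function[OF HH(1) _ p])
    show "F (g p) \<noteq> 0" using pos[of "g p"] by simp
    show "H (g y) = y" if "0 < y" "y < I" for y using Hg that .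
    have "isCont g (H (g p))"
      by (rule isCont_inverse_function[where d=1 and f=H and x="g p"]) (use gH DERIV_isCont[OF HH(1)] in auto)
    then show "isCont g p" using Hg[OF p] by simp
  qed
  show ?thesis
  proof (rule that)
    fix x
    have r: "0 < I * N x" "I * N x < I" using Ipos Npos[of x] by auto
    have "((\<lambda>x. g (I * N x)) has_real_derivative inverse (F (g (I * N x))) * (I * std_normal_density x)) (at x)"
      by (rule DERIV_chain2[OF dg[OF r] DERIV_cmult[OF dN]])
    then show "((\<lambda>x. g (I * N x)) has_real_derivative std_normal_density x * (\<integral>x. F x \<partial>lborel) / F (g (I * N x))) (at x)"
      by (simp add: I_def field_simps)
  qed
qed

lemma stdn_density_real: "stdn_density (x::real) = std_normal_density x"
  by (simp add: stdn_density_def)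

lemma stdn_real_moments:
  shows "integrable stdn (\<lambda>x::real. x)" "(\<integral>x. x \<partial>stdn) = (0::real)"
    and "integrable stdn (\<lambda>x::real. x\<^sup>2)" "(\<integral>x. x\<^sup>2 \<partial>stdn) = (1::real)"
proof -
  have 1: "has_bochner_integral lborel (\<lambda>x. std_normal_density x * x) 0"
    using std_normal_moment_odd[of 0] by simp
  have 2: "has_bochner_integral lborel (\<lambda>x. std_normal_density x * x\<^sup>2) 1"
    using std_normal_moment_even[of 1] by (simp add: fact_numeral)
  show "integrable stdn (\<lambda>x::real. x)" "(\<integral>x. x \<partial>stdn) = (0::real)"
    using 1 by (simp_all add: integrable_stdn integral_stdn stdn_density_real has_bochner_integral_iff)
  show "integrable stdn (\<lambda>x::real. x\<^sup>2)" "(\<integral>x. x\<^sup>2 \<partial>stdn) = (1::real)"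
    using 2 by (simp_all add: integrable_stdn integral_stdn stdn_density_real has_bochner_integral_iff)
qed

text \<open>On each interval the substitution is exact, and the image interval is part of the line.
  It is only an inequality in the limit because \<open>Y\<close> may fail to be onto.\<close>

lemma nn_integral_increasing_substitution:
  fixes v Y Y' :: "real \<Rightarrow> real"
  assumes [measurable]: "v \<in> borel_measurable borel"
    and d: "\<And>x. (Y has_real_derivative Y' x) (at x)" and c: "continuous_on UNIV Y'" and nn: "\<And>x. 0 \<le> Y' x"
  shows "(\<integral>\<^sup>+x. ennreal (v (Y x) * Y' x) \<partial>lborel) \<le> (\<integral>\<^sup>+x. ennreal (v x) \<partial>lborel)"
proof -
  have cY: "continuous_on UNIV Y"
    using d by (meson DERIV_isCont continuous_at_imp_continuous_on)
  have [measurable]: "Y \<in> borel_measurable borel" "Y' \<in> borel_measurable borel"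
    using cY c by (auto intro: borel_measurable_continuous_onI)
  have le: "(\<integral>\<^sup>+x. ennreal (v (Y x) * Y' x) * indicator {- real n..real n} x \<partial>lborel) \<le> (\<integral>\<^sup>+x. ennreal (v x) \<partial>lborel)" for n
  proof -
    have "(\<integral>\<^sup>+x. ennreal (v (Y x) * Y' x) * indicator {- real n..real n} x \<partial>lborel)
       = (\<integral>\<^sup>+x. ennreal (v (Y x) * Y' x * indicator {- real n..real n} x) \<partial>lborel)"
      by (intro nn_integral_cong) (auto simp: indicator_def)
    also have "\<dots> = (\<integral>\<^sup>+x. ennreal (v x * indicator {Y (- real n)..Y (real n)} x) \<partial>lborel)"
    proof (rule nn_integral_substitution[symmetric])
      show "set_borel_measurable borel {Y (- real n)..Y (real n)} v"
        unfolding set_borel_measurable_def by measurable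
      show "continuous_on {- real n..real n} Y'" by (rule continuous_on_subset[OF c]) simp
    qed (use d nn in auto)
    also have "\<dots> \<le> (\<integral>\<^sup>+x. ennreal (v x) \<partial>lborel)"
      by (intro nn_integral_mono) (auto simp: indicator_def)
    finally show ?thesis .
  qed
  have "(\<integral>\<^sup>+x. ennreal (v (Y x) * Y' x) \<partial>lborel) = (\<integral>\<^sup>+x. (SUP n. ennreal (v (Y x) * Y' x) * indicator {- real n..real n} x) \<partial>lborel)"
  proof (intro nn_integral_cong)
    fix x
    obtain n :: nat where n: "\<bar>x\<bar> \<le> real n" using real_arch_simple by blast
    show "ennreal (v (Y x) * Y' x) = (SUP n. ennreal (v (Y x) * Y' x) * indicator {- real n..real n} x)"
    proof (rule antisym)
      show "ennreal (v (Y x) * Y' x) \<le> (SUP n. ennreal (v (Y x) * Y' x) * indicator {- real n..real n} x)"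
        using n by (intro SUP_upper2[of n]) (auto simp: indicator_def)
    qed (auto intro!: SUP_least simp: indicator_def)
  qed
  also have "\<dots> = (SUP n. \<integral>\<^sup>+x. ennreal (v (Y x) * Y' x) * indicator {- real n..real n} x \<partial>lborel)"
    by (intro nn_integral_monotone_convergence_SUP) (auto simp: incseq_def le_fun_def indicator_def)
  also have "\<dots> \<le> (\<integral>\<^sup>+x. ennreal (v x) \<partial>lborel)" by (intro SUP_least le)
  finally show ?thesis .
qed

lemma lborel_integral_pos:
  fixes f :: "'a::euclidean_space \<Rightarrow> real"
  assumes "integrable lborel f" and "\<And>x. 0 < f x"
  shows "0 < (\<integral>x. f x \<partial>lborel)"
proof -
  have nn: "AE x in lborel. 0 \<le> f x" using assms(2) by (simp add: less_imp_le)
  have "(\<integral>x. f x \<partial>lborel) \<noteq> 0"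
  proof
    assume "(\<integral>x. f x \<partial>lborel) = 0"
    then have "AE x in lborel. f x = 0"
      using integral_nonneg_eq_0_iff_AE[OF assms(1) nn] by simp
    then have "AE x in (lborel :: 'a measure). False"
      by eventually_elim (use assms(2) less_irrefl in metis)
    then show False by (simp add: AE_iff_null null_sets_def)
  qed
  then show ?thesis using integral_nonneg_AE[OF nn] by simp
qed

text \<open>The substitution \<open>g = (s x - q) / c\<close> turns the inner integral into one over \<open>q\<close>, after which
  the argument of \<open>v\<close> is increasing in \<open>x\<close>.\<close>

lemma transport_density_mass:
  fixes v T T' :: "real \<Rightarrow> real"
  assumes [measurable]: "v \<in> borel_measurable borel" and vpos: "\<And>y. v y > 0"
    and vint: "integrable lborel v" and m: "(\<integral>y. v y \<partial>lborel) = m"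
    and dT: "\<And>x. (T has_real_derivative T' x) (at x)" and cT': "continuous_on UNIV T'" and T'pos: "\<And>x. T' x > 0"
    and t: "0 < t" "t < 1" and c: "c > 0" and cs: "c\<^sup>2 + s\<^sup>2 = 1" and L: "L = b * c + e * s" "L > 0"
  shows "(\<integral>\<^sup>+x. \<integral>\<^sup>+g. ennreal (v ((1 - t) * T x + b * x + e * g) * ((1 - t) * c * T' x + L)
            / (std_normal_density (c * x + s * g) * m)) \<partial>stdn \<partial>stdn) \<le> 1"
proof -
  let ?\<phi> = "std_normal_density"
  have [measurable]: "T \<in> borel_measurable borel" "T' \<in> borel_measurable borel"
    using cT' dT by (auto intro!: borel_measurable_continuous_onI continuous_at_imp_continuous_on DERIV_isCont)
  have mpos: "m > 0"
    using lborel_integral_pos[OF vint vpos] m by simp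
  define Y where "Y q x = (1 - t) * T x + b * x + e * ((s * x - q) / c)" for q x
  \<comment> \<open>\<open>b + e * s / c\<close> equals \<open>L / c\<close>, so the slope is the
    same for every \<open>q\<close>, and \<open>L > 0\<close> together with \<open>T' x > 0\<close>
    makes it positive.\<close>
  define Y' where "Y' x = (1 - t) * T' x + L / c" for x
  have dY: "(Y q has_real_derivative Y' x) (at x)" for q x
    unfolding Y_def Y'_def using c
    by (auto intro!: derivative_eq_intros dT simp: L(1) field_simps)
  have cY': "continuous_on UNIV Y'" unfolding Y'_def by (intro continuous_intros cT') (use c in auto)
  have Y'nn: "0 \<le> Y' x" for x using T'pos[of x] t c L(2) by (simp add: Y'_def less_imp_le)
  have [measurable]: "Y q \<in> borel_measurable borel" "Y' \<in> borel_measurable borel" for q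
    unfolding Y_def Y'_def by measurable
  have norm1: "(\<integral>\<^sup>+q. ennreal (?\<phi> q) \<partial>lborel) = 1"
    by (subst nn_integral_eq_integral) auto
  \<comment> \<open>\<open>(x, g) \<mapsto> (p, q)\<close> is orthogonal, so the product density
    factors in \<open>p\<close> and \<open>q\<close> as well. The factor in \<open>p\<close> then
    cancels the denominator of the integrand, leaving a Gaussian weight in \<open>q\<close>
    alone.\<close>
  have rot: "?\<phi> x * ?\<phi> g = ?\<phi> (c * x + s * g) * ?\<phi> (s * x - c * g)" for x g
  proof -
    have "(c * x + s * g)\<^sup>2 + (s * x - c * g)\<^sup>2 = (c\<^sup>2 + s\<^sup>2) * (x\<^sup>2 + g\<^sup>2)"
      by (simp add: power2_eq_square algebra_simps)
    then have "x\<^sup>2 + g\<^sup>2 = (c * x + s * g)\<^sup>2 + (s * x - c * g)\<^sup>2" by (simp add: cs)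
    then have "exp (- x\<^sup>2 / 2) * exp (- g\<^sup>2 / 2) = exp (- (c * x + s * g)\<^sup>2 / 2) * exp (- (s * x - c * g)\<^sup>2 / 2)"
      unfolding exp_add[symmetric] by (intro arg_cong[of _ _ exp]) argo
    then show ?thesis unfolding std_normal_density_def by simp
  qed
  have inner: "ennreal (?\<phi> x) * (\<integral>\<^sup>+g. ennreal (?\<phi> g) * ennreal (v ((1 - t) * T x + b * x + e * g) * ((1 - t) * c * T' x + L)
            / (?\<phi> (c * x + s * g) * m)) \<partial>lborel)
     = (\<integral>\<^sup>+q. ennreal (?\<phi> q / m) * ennreal (v (Y q x) * Y' x) \<partial>lborel)" for x
  proof -
    have "ennreal (?\<phi> x) * (\<integral>\<^sup>+g. ennreal (?\<phi> g) * ennreal (v ((1 - t) * T x + b * x + e * g) * ((1 - t) * c * T' x + L)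
            / (?\<phi> (c * x + s * g) * m)) \<partial>lborel)
       = (\<integral>\<^sup>+g. ennreal (?\<phi> (s * x - c * g) * (v ((1 - t) * T x + b * x + e * g) * ((1 - t) * c * T' x + L) / m)) \<partial>lborel)"
    proof (subst nn_integral_cmult[symmetric], simp, intro nn_integral_cong)
      fix g
      have nn: "0 \<le> v ((1 - t) * T x + b * x + e * g) * ((1 - t) * c * T' x + L) / (?\<phi> (c * x + s * g) * m)"
        using vpos T'pos[of x] t c L mpos by (intro divide_nonneg_nonneg mult_nonneg_nonneg add_nonneg_nonneg) (auto simp: less_imp_le)
      have "?\<phi> (c * x + s * g) \<noteq> 0" using normal_density_pos[of 1 0 "c * x + s * g"] by simp
      then have "?\<phi> x * ?\<phi> g * (v ((1 - t) * T x + b * x + e * g) * ((1 - t) * c * T' x + L) / (?\<phi> (c * x + s * g) * m))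
        = ?\<phi> (s * x - c * g) * (v ((1 - t) * T x + b * x + e * g) * ((1 - t) * c * T' x + L) / m)"
        unfolding rot[of x g] using mpos by (simp add: field_simps)
      then show "ennreal (?\<phi> x) * (ennreal (?\<phi> g) * ennreal (v ((1 - t) * T x + b * x + e * g) * ((1 - t) * c * T' x + L)
            / (?\<phi> (c * x + s * g) * m))) = ennreal (?\<phi> (s * x - c * g) * (v ((1 - t) * T x + b * x + e * g) * ((1 - t) * c * T' x + L) / m))"
        using nn by (simp add: ennreal_mult'[symmetric] ennreal_mult[symmetric] mult.assoc[symmetric])
    qed
    also have "\<dots> = ennreal \<bar>- 1 / c\<bar> * (\<integral>\<^sup>+q. ennreal (?\<phi> (s * x - c * (s * x / c + (- 1 / c) * q)) * (v ((1 - t) * T x + b * x + e * (s * x / c + (- 1 / c) * q)) * ((1 - t) * c * T' x + L) / m)) \<partial>lborel)"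
      by (rule nn_integral_real_affine) (use c in auto)
    also have "\<dots> = (\<integral>\<^sup>+q. ennreal (?\<phi> q / m) * ennreal (v (Y q x) * Y' x) \<partial>lborel)"
    proof (subst nn_integral_cmult[symmetric], simp, intro nn_integral_cong)
      fix q
      have 1: "s * x - c * (s * x / c + (- 1 / c) * q) = q" "s * x / c + (- 1 / c) * q = (s * x - q) / c"
        using c by (auto simp: field_simps)
      have 2: "((1 - t) * c * T' x + L) = c * Y' x" unfolding Y'_def using c by (simp add: field_simps)
      show "ennreal \<bar>- 1 / c\<bar> * ennreal (?\<phi> (s * x - c * (s * x / c + (- 1 / c) * q)) * (v ((1 - t) * T x + b * x + e * (s * x / c + (- 1 / c) * q)) * ((1 - t) * c * T' x + L) / m))
         = ennreal (?\<phi> q / m) * ennreal (v (Y q x) * Y' x)"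
        unfolding 1 2 Y_def[symmetric] using c mpos vpos[of "Y q x"] Y'nn[of x]
        by (subst (1 2) ennreal_mult[symmetric]) (auto simp: field_simps less_imp_le)
    qed
    finally show ?thesis .
  qed
  have "(\<integral>\<^sup>+x. \<integral>\<^sup>+g. ennreal (v ((1 - t) * T x + b * x + e * g) * ((1 - t) * c * T' x + L)
            / (std_normal_density (c * x + s * g) * m)) \<partial>stdn \<partial>stdn)
     = (\<integral>\<^sup>+x. \<integral>\<^sup>+q. ennreal (?\<phi> q / m) * ennreal (v (Y q x) * Y' x) \<partial>lborel \<partial>lborel)"
  proof -
    interpret N: prob_space "stdn :: real measure" by (rule prob_space_stdn)
    have "(\<lambda>x. \<integral>\<^sup>+g. ennreal (v ((1 - t) * T x + b * x + e * g) * ((1 - t) * c * T' x + L)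
            / (std_normal_density (c * x + s * g) * m)) \<partial>stdn) \<in> borel_measurable borel"
      by (rule N.borel_measurable_nn_integral) measurable
    then show ?thesis
      by (simp add: nn_integral_stdn stdn_density_real inner)
  qed
  also have "\<dots> = (\<integral>\<^sup>+q. \<integral>\<^sup>+x. ennreal (?\<phi> q / m) * ennreal (v (Y q x) * Y' x) \<partial>lborel \<partial>lborel)"
    unfolding Y_def by (rule lborel_pair.Fubini'[symmetric]) measurable
  also have "\<dots> = (\<integral>\<^sup>+q. ennreal (?\<phi> q / m) * (\<integral>\<^sup>+x. ennreal (v (Y q x) * Y' x) \<partial>lborel) \<partial>lborel)"
    by (intro nn_integral_cong nn_integral_cmult) measurable
  also have "\<dots> \<le> (\<integral>\<^sup>+q. ennreal (?\<phi> q / m) * ennreal m \<partial>lborel)"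
  proof (intro nn_integral_mono mult_left_mono)
    fix q
    have "(\<integral>\<^sup>+x. ennreal (v (Y q x) * Y' x) \<partial>lborel) \<le> (\<integral>\<^sup>+x. ennreal (v x) \<partial>lborel)"
      by (rule nn_integral_increasing_substitution[OF _ dY cY' Y'nn]) simp
    also have "\<dots> = ennreal m"
      unfolding m[symmetric] by (rule nn_integral_eq_integral[OF vint]) (simp add: vpos less_imp_le)
    finally show "(\<integral>\<^sup>+x. ennreal (v (Y q x) * Y' x) \<partial>lborel) \<le> ennreal m" .
  qed simp
  also have "\<dots> = (\<integral>\<^sup>+q. ennreal (?\<phi> q) \<partial>lborel)"
    using mpos by (intro nn_integral_cong) (simp add: ennreal_mult[symmetric])
  finally show ?thesis using norm1 by simp
qed

lemma pair_prob_fst_snd: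
  fixes f :: "'a \<Rightarrow> real" and g :: "'b \<Rightarrow> real"
  assumes M: "prob_space M" and N: "prob_space N"
  shows "integrable M f \<Longrightarrow> integrable (M \<Otimes>\<^sub>M N) (\<lambda>p. f (fst p))"
    and "integrable M f \<Longrightarrow> (\<integral>p. f (fst p) \<partial>(M \<Otimes>\<^sub>M N)) = (\<integral>x. f x \<partial>M)"
    and "integrable N g \<Longrightarrow> integrable (M \<Otimes>\<^sub>M N) (\<lambda>p. g (snd p))"
    and "integrable N g \<Longrightarrow> (\<integral>p. g (snd p) \<partial>(M \<Otimes>\<^sub>M N)) = (\<integral>x. g x \<partial>N)"
proof -
  interpret M: prob_space M by fact
  interpret N: prob_space N by fact
  interpret P: pair_sigma_finite M N ..
  interpret Q: pair_sigma_finite N M ..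
  show "integrable (M \<Otimes>\<^sub>M N) (\<lambda>p. f (fst p))" if "integrable M f"
    using that by (subst integrable_distr_eq[of fst _ M, symmetric]) (auto simp: N.distr_pair_fst)
  show "(\<integral>p. f (fst p) \<partial>(M \<Otimes>\<^sub>M N)) = (\<integral>x. f x \<partial>M)" if "integrable M f"
    using that by (subst integral_distr[of fst _ M, symmetric]) (auto simp: N.distr_pair_fst)
  assume g: "integrable N g"
  have 1: "integrable (N \<Otimes>\<^sub>M M) (\<lambda>p. g (fst p))"
    using g by (subst integrable_distr_eq[of fst _ N, symmetric]) (auto simp: M.distr_pair_fst)
  have 2: "(\<integral>p. g (fst p) \<partial>(N \<Otimes>\<^sub>M M)) = (\<integral>x. g x \<partial>N)"
    using g by (subst integral_distr[of fst _ N, symmetric]) (auto simp: M.distr_pair_fst)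
  show "integrable (M \<Otimes>\<^sub>M N) (\<lambda>p. g (snd p))"
    using Q.integrable_product_swap[OF 1] by (simp add: split_beta')
  show "(\<integral>p. g (snd p) \<partial>(M \<Otimes>\<^sub>M N)) = (\<integral>x. g x \<partial>N)"
    using Q.integral_product_swap[of "\<lambda>p. g (fst p)"] 1 2 by (simp add: split_beta')
qed

text \<open>Concavity of \<open>ln\<close> at the points \<open>u\<close> and \<open>L / t\<close>.
  In the Gaussian case these points coincide, so the estimate is sharp there.\<close>

lemma weighted_am_gm_ln:
  assumes "0 < t" "t < 1" "0 < u" "0 < (L::real)"
  shows "(1 - t) * ln u + t * ln (L / t) \<le> ln ((1 - t) * u + L)"
proof -
  have "(1 - t) * ln u + t * ln (L / t) \<le> ln ((1 - t) * u + t * (L / t))"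
    using concave_onD[OF ln_concave, of t u "L / t"] assms by simp
  then show ?thesis using assms by simp
qed

lemma ln_std_normal_density: "ln (std_normal_density x) = - ln (2 * pi) / 2 - x\<^sup>2 / 2"
  by (simp add: std_normal_density_def ln_mult ln_div ln_sqrt field_simps)

text \<open>One transport map serves all members \<open>v w\<close> of the family. The bound \<open>ln U \<le> U - 1\<close> stands in
  for Jensen's inequality and avoids integrability questions about \<open>ln F \<circ> T\<close>, which cancels.\<close>

lemma family_transport:
  fixes v :: "'w \<Rightarrow> real \<Rightarrow> real" and F :: "real \<Rightarrow> real"
  assumes M: "prob_space M"
    and vm: "(\<lambda>p. v (fst p) (snd p)) \<in> borel_measurable (M \<Otimes>\<^sub>M borel)"
    and vpos: "\<And>w y. 0 < v w y" and vint: "\<And>w. w \<in> space M \<Longrightarrow> integrable lborel (v w)"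
    and vln: "\<And>w y. w \<in> space M \<Longrightarrow> \<bar>ln (v w y)\<bar> \<le> B w + C * y\<^sup>2" and B: "integrable M B" and C: "C \<ge> 0"
    and mint: "integrable M (\<lambda>w. ln (\<integral>y. v w y \<partial>lborel))"
    and F: "continuous_on UNIV F" "\<And>x. F x > 0" "integrable lborel F"
    and t: "0 < t" "t < 1" and c: "c > 0" and cs: "c\<^sup>2 + s\<^sup>2 = 1" and L: "L = b * c + e * s" "L > 0"
    and hyp: "\<And>z x. (1 - t) * ln (F z) - q * x\<^sup>2 - \<kappa>
        \<le> (\<integral>p. ln (v (fst p) ((1 - t) * z + b * x + e * snd p)) \<partial>(M \<Otimes>\<^sub>M stdn))"
  shows "(1 - t) * ln (\<integral>x. F x \<partial>lborel) + ((1 - t) * ln c + t * ln (L / t) + t * (ln (2 * pi) + 1) / 2 - q - \<kappa>)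
     \<le> (\<integral>w. ln (\<integral>y. v w y \<partial>lborel) \<partial>M)"
proof -
  let ?\<phi> = "std_normal_density"
  interpret M: prob_space M by fact
  have vm' [measurable (raw)]: "(\<lambda>z. v (f z) (g z)) \<in> borel_measurable X"
    if "f \<in> measurable X M" "g \<in> borel_measurable X" for f g and X :: "'z measure"
    using measurable_compose[OF measurable_Pair[OF that] vm] by simp
  interpret N: prob_space "stdn :: real measure" by (rule prob_space_stdn)
  interpret P: pair_prob_space M "stdn :: real measure" ..
  define I where "I = (\<integral>x. F x \<partial>lborel)"
  have I: "I > 0" unfolding I_def by (rule lborel_integral_pos[OF F(3,2)])
  obtain T where dT0: "\<And>x. (T has_real_derivative ?\<phi> x * I / F (T x)) (at x)"
    using gaussian_transport[OF F] unfolding I_def by blast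
  define T' where "T' x = ?\<phi> x * I / F (T x)" for x
  have dT: "(T has_real_derivative T' x) (at x)" for x using dT0 unfolding T'_def .
  have cT: "continuous_on UNIV T" using dT by (meson DERIV_isCont continuous_at_imp_continuous_on)
  have Fne: "F x \<noteq> 0" for x using F(2)[of x] by simp
  have cT': "continuous_on UNIV T'"
    unfolding T'_def std_normal_density_def
    by (intro continuous_intros continuous_on_compose2[OF F(1) cT]) (auto simp: Fne)
  have T'pos: "T' x > 0" for x unfolding T'_def using F(2) I by (simp add: normal_density_pos)
  have [measurable]: "T \<in> borel_measurable borel" "T' \<in> borel_measurable borel"
    using cT cT' by (auto intro: borel_measurable_continuous_onI)
  define m where "m w = (\<integral>y. v w y \<partial>lborel)" for w
  have mpos: "m w > 0" if "w \<in> space M" for w unfolding m_def by (rule lborel_integral_pos[OF vint[OF that] vpos])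
  have [measurable]: "m \<in> borel_measurable M"
    unfolding m_def using vm by (intro lborel.borel_measurable_lebesgue_integral) (simp add: split_beta')
  \<comment> \<open>The density ratio between \<open>v\<close> along the interpolation, normalised
    by its mass and multiplied by the Jacobian, and the standard normal law of \<open>p\<close>. Its
    expectation is at most one, while \<open>ln U\<close> contains
    \<open>- (1 - t) * ln (F (T x))\<close> after the concavity estimate, which is what
    \<open>hyp\<close> compensates.\<close>
  define U where "U x p = v (fst p) ((1 - t) * T x + b * x + e * snd p) * ((1 - t) * c * T' x + L)
            / (?\<phi> (c * x + s * snd p) * m (fst p))" for x p

  have mU0: "(\<lambda>xp. U (fst xp) (snd xp)) \<in> borel_measurable (borel \<Otimes>\<^sub>M (M \<Otimes>\<^sub>M borel))"
    unfolding U_def by measurable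
  have se: "sets (stdn \<Otimes>\<^sub>M (M \<Otimes>\<^sub>M stdn)) = sets (borel \<Otimes>\<^sub>M (M \<Otimes>\<^sub>M (borel :: real measure)))"
    by (intro sets_pair_measure_cong) auto
  have se2: "sets (M \<Otimes>\<^sub>M stdn) = sets (M \<Otimes>\<^sub>M (borel :: real measure))"
    by (intro sets_pair_measure_cong) auto
  have mU: "(\<lambda>xp. U (fst xp) (snd xp)) \<in> borel_measurable (stdn \<Otimes>\<^sub>M (M \<Otimes>\<^sub>M stdn))"
    using mU0 by (subst measurable_cong_sets[OF se refl])
  have Upos: "U x p > 0" if "fst p \<in> space M" for x p
    unfolding U_def using that t c L(2)
    by (intro divide_pos_pos mult_pos_pos vpos add_pos_pos T'pos mpos normal_density_pos) auto
  interpret Q: pair_sigma_finite "stdn :: real measure" "M \<Otimes>\<^sub>M (stdn :: real measure)" ..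
  interpret R: pair_sigma_finite "stdn :: real measure" M ..
  \<comment> \<open>The family index is moved outermost, because
    \<open>transport_density_mass\<close> applies to one member \<open>v w\<close> at a
    time.\<close>
  have total: "(\<integral>\<^sup>+xp. ennreal (U (fst xp) (snd xp)) \<partial>(stdn \<Otimes>\<^sub>M (M \<Otimes>\<^sub>M stdn))) \<le> 1"
  proof -
    have "(\<integral>\<^sup>+xp. ennreal (U (fst xp) (snd xp)) \<partial>(stdn \<Otimes>\<^sub>M (M \<Otimes>\<^sub>M stdn)))
       = (\<integral>\<^sup>+x. \<integral>\<^sup>+p. ennreal (U x p) \<partial>(M \<Otimes>\<^sub>M stdn) \<partial>stdn)"
      using P.nn_integral_fst[of "\<lambda>xp. ennreal (U (fst xp) (snd xp))" "stdn :: real measure"] mU by simp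
    also have "\<dots> = (\<integral>\<^sup>+x. \<integral>\<^sup>+w. \<integral>\<^sup>+g. ennreal (U x (w, g)) \<partial>stdn \<partial>M \<partial>stdn)"
    proof (intro nn_integral_cong)
      fix x :: real
      have "(\<lambda>p. ennreal (U x p)) \<in> borel_measurable (M \<Otimes>\<^sub>M stdn)"
        using measurable_compose[OF measurable_Pair1' mU, of x] by simp
      then show "(\<integral>\<^sup>+p. ennreal (U x p) \<partial>(M \<Otimes>\<^sub>M stdn)) = (\<integral>\<^sup>+w. \<integral>\<^sup>+g. ennreal (U x (w, g)) \<partial>stdn \<partial>M)"
        by (rule N.nn_integral_fst[symmetric])
    qed
    also have "\<dots> = (\<integral>\<^sup>+w. \<integral>\<^sup>+x. \<integral>\<^sup>+g. ennreal (U x (w, g)) \<partial>stdn \<partial>stdn \<partial>M)"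
    proof (rule R.Fubini'[symmetric])
      have "(\<lambda>(z, g). ennreal (U (fst z) (snd z, g))) \<in> borel_measurable ((borel \<Otimes>\<^sub>M M) \<Otimes>\<^sub>M borel)"
        using measurable_compose[OF _ mU0, of "\<lambda>z. (fst (fst z), (snd (fst z), snd z))" "(borel \<Otimes>\<^sub>M M) \<Otimes>\<^sub>M borel"]
        by (simp add: split_beta')
      then have "(\<lambda>(z, g). ennreal (U (fst z) (snd z, g))) \<in> borel_measurable ((stdn \<Otimes>\<^sub>M M) \<Otimes>\<^sub>M stdn)"
        by (subst measurable_cong_sets[OF _ refl]) (auto intro!: sets_pair_measure_cong)
      from N.borel_measurable_nn_integral_fst[OF this]
      show "(\<lambda>(x, w). \<integral>\<^sup>+g. ennreal (U x (w, g)) \<partial>stdn) \<in> borel_measurable (stdn \<Otimes>\<^sub>M M)"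
        by (simp add: split_beta')
    qed
    also have "\<dots> \<le> (\<integral>\<^sup>+w. 1 \<partial>M)"
    proof (intro nn_integral_mono)
      fix w assume w: "w \<in> space M"
      have [measurable]: "v w \<in> borel_measurable borel"
        using measurable_compose[OF measurable_Pair1'[OF w] vm] by simp
      show "(\<integral>\<^sup>+x. \<integral>\<^sup>+g. ennreal (U x (w, g)) \<partial>stdn \<partial>stdn) \<le> 1"
        unfolding U_def fst_conv snd_conv
        by (rule transport_density_mass[OF _ vpos vint[OF w] m_def[symmetric] dT cT' T'pos t c cs L]) simp
    qed
    also have "\<dots> = 1" by (simp add: M.emeasure_space_1)
    finally show ?thesis .
  qed
  have Upos': "AE xp in stdn \<Otimes>\<^sub>M (M \<Otimes>\<^sub>M stdn). 0 \<le> U (fst xp) (snd xp)"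
    by (rule AE_I2) (auto simp: space_pair_measure intro!: less_imp_le[OF Upos])
  have Uint: "integrable (stdn \<Otimes>\<^sub>M (M \<Otimes>\<^sub>M stdn)) (\<lambda>xp. U (fst xp) (snd xp))"
    by (rule integrableI_nonneg[OF mU Upos']) (use total in \<open>auto simp: less_top[symmetric] top_unique intro: le_less_trans\<close>)
  have U1: "AE x in stdn. integrable (M \<Otimes>\<^sub>M stdn) (U x)"
    using Q.AE_integrable_fst'[OF Uint] by simp
  have U2: "integrable stdn (\<lambda>x. \<integral>p. U x p \<partial>(M \<Otimes>\<^sub>M stdn))"
    using Q.integrable_fst'[OF Uint] by simp
  have U3: "(\<integral>x. \<integral>p. U x p \<partial>(M \<Otimes>\<^sub>M stdn) \<partial>stdn) \<le> 1"
  proof -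
    have "(\<integral>x. \<integral>p. U x p \<partial>(M \<Otimes>\<^sub>M stdn) \<partial>stdn) = (\<integral>xp. U (fst xp) (snd xp) \<partial>(stdn \<Otimes>\<^sub>M (M \<Otimes>\<^sub>M stdn)))"
      using Q.integral_fst'[OF Uint] by simp
    moreover have "ennreal (\<integral>xp. U (fst xp) (snd xp) \<partial>(stdn \<Otimes>\<^sub>M (M \<Otimes>\<^sub>M stdn))) \<le> 1"
      using total nn_integral_eq_integral[OF Uint Upos'] by simp
    ultimately show ?thesis by (simp add: ennreal_le_1)
  qed
  note sm = stdn_real_moments
  note PF = pair_prob_fst_snd[OF M N.prob_space_axioms]
  have vi: "integrable (M \<Otimes>\<^sub>M stdn) (\<lambda>p. ln (v (fst p) (A + e * snd p)))" for A
  proof (rule Bochner_Integration.integrable_bound)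
    show "integrable (M \<Otimes>\<^sub>M stdn) (\<lambda>p. (B (fst p) + C * (2 * A\<^sup>2)) + (C * (2 * e\<^sup>2)) * (snd p)\<^sup>2)"
      by (intro Bochner_Integration.integrable_add PF(1)[OF B] integrable_mult_right PF(3)[OF sm(3)] P.integrable_const)
    have "(\<lambda>p. ln (v (fst p) (A + e * snd p))) \<in> borel_measurable (M \<Otimes>\<^sub>M borel)"
      using measurable_compose[OF _ vm, of "\<lambda>p. (fst p, A + e * snd p)" "M \<Otimes>\<^sub>M borel"] by simp
    then show "(\<lambda>p. ln (v (fst p) (A + e * snd p))) \<in> borel_measurable (M \<Otimes>\<^sub>M stdn)"
      by (subst measurable_cong_sets[OF se2 refl])
    show "AE p in M \<Otimes>\<^sub>M stdn. norm (ln (v (fst p) (A + e * snd p))) \<le> norm ((B (fst p) + C * (2 * A\<^sup>2)) + (C * (2 * e\<^sup>2)) * (snd p)\<^sup>2)"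
    proof (rule AE_I2)
      fix p assume "p \<in> space (M \<Otimes>\<^sub>M (stdn :: real measure))"
      then have w: "fst p \<in> space M" by (auto simp: space_pair_measure)
      have "(A + e * snd p)\<^sup>2 \<le> 2 * A\<^sup>2 + 2 * (e * snd p)\<^sup>2"
        using zero_le_power2[of "A - e * snd p"] by (simp add: power2_eq_square algebra_simps)
      from mult_left_mono[OF this C]
      have "C * (A + e * snd p)\<^sup>2 \<le> C * (2 * A\<^sup>2) + (C * (2 * e\<^sup>2)) * (snd p)\<^sup>2"
        by (simp add: power_mult_distrib algebra_simps)
      then show "norm (ln (v (fst p) (A + e * snd p))) \<le> norm ((B (fst p) + C * (2 * A\<^sup>2)) + (C * (2 * e\<^sup>2)) * (snd p)\<^sup>2)"
        using vln[OF w, of "A + e * snd p"] by (simp add: add.assoc)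
    qed
  qed
  define Em where "Em = (\<integral>w. ln (m w) \<partial>M)"
  have mint': "integrable M (\<lambda>w. ln (m w))" using mint by (simp add: m_def)
  \<comment> \<open>\<open>k0\<close> and \<open>k1\<close> are the constant and the coefficient of
    \<open>x^2\<close> that remain once \<open>ln (F (T x))\<close> has cancelled and the linear
    term of \<open>G\<close> has averaged to zero.\<close>
  define k0 where "k0 = (1 - t) * ln I + (1 - t) * ln c + t * ln (L / t) + t * ln (2 * pi) / 2 - \<kappa> + s\<^sup>2 / 2 - Em"
  define k1 where "k1 = c\<^sup>2 / 2 - (1 - t) / 2 - q"
  have key: "k0 + k1 * x\<^sup>2 \<le> (\<integral>p. U x p \<partial>(M \<Otimes>\<^sub>M stdn)) - 1" if Ux: "integrable (M \<Otimes>\<^sub>M stdn) (U x)" for x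
  proof -
    define A where "A = (1 - t) * T x + b * x"
    define K where "K = (1 - t) * (ln c + ln (?\<phi> x) + ln I - ln (F (T x))) + t * ln (L / t)"
    define V where "V p = ln (v (fst p) (A + e * snd p))" for p
    \<comment> \<open>Minus the logarithm of the normal density at \<open>c * x + s * g\<close>,
      expanded in \<open>g\<close> so that the moments of \<open>g\<close> can be inserted.\<close>
    define G where "G g = ln (2 * pi) / 2 + c\<^sup>2 * x\<^sup>2 / 2 + c * s * x * g + s\<^sup>2 / 2 * g\<^sup>2" for g
    have Gi: "integrable stdn G" "(\<integral>g. G g \<partial>stdn) = ln (2 * pi) / 2 + c\<^sup>2 * x\<^sup>2 / 2 + s\<^sup>2 / 2"
    proof -
      have i: "integrable stdn (\<lambda>g::real. ln (2 * pi) / 2 + c\<^sup>2 * x\<^sup>2 / 2)" "integrable stdn (\<lambda>g. c * s * x * g)" "integrable stdn (\<lambda>g. s\<^sup>2 / 2 * g\<^sup>2)"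
        using sm by auto
      show "integrable stdn G" unfolding G_def by (intro Bochner_Integration.integrable_add i(2,3) N.integrable_const)
      show "(\<integral>g. G g \<partial>stdn) = ln (2 * pi) / 2 + c\<^sup>2 * x\<^sup>2 / 2 + s\<^sup>2 / 2"
        unfolding G_def using i sm
        by (simp add: Bochner_Integration.integral_add N.prob_space[unfolded space_stdn])
    qed
    have "V p + (K + G (snd p) - ln (m (fst p))) \<le> U x p - 1" if p: "p \<in> space (M \<Otimes>\<^sub>M stdn)" for p
    proof -
      have w: "fst p \<in> space M" using p by (auto simp: space_pair_measure)
      let ?P = "c * x + s * snd p"
      have lT: "ln (c * T' x) = ln c + ln (?\<phi> x) + ln I - ln (F (T x))"
        unfolding T'_def using c I F(2)[of "T x"] normal_density_pos[of 1 0 x]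
        by (simp add: ln_mult_pos ln_div)
      have lP: "ln (?\<phi> ?P) = - G (snd p)"
        unfolding ln_std_normal_density G_def by (simp add: power2_eq_square algebra_simps add_divide_distrib)
      have pos: "0 < v (fst p) (A + e * snd p)" "0 < (1 - t) * (c * T' x) + L" "0 < ?\<phi> ?P" "0 < m (fst p)" "0 < c * T' x"
        using vpos t c L(2) T'pos[of x] mpos[OF w] by (auto intro!: add_pos_pos mult_pos_pos normal_density_pos)
      have "U x p = v (fst p) (A + e * snd p) * ((1 - t) * (c * T' x) + L) / (?\<phi> ?P * m (fst p))"
        by (simp add: U_def A_def mult.assoc)
      then have "ln (U x p) = V p + ln ((1 - t) * (c * T' x) + L) + G (snd p) - ln (m (fst p))"
        using pos lP by (simp add: ln_div ln_mult_pos V_def)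
      moreover have "K \<le> ln ((1 - t) * (c * T' x) + L)"
        unfolding K_def lT[symmetric] by (rule weighted_am_gm_ln[OF t pos(5) L(2)])
      moreover have "ln (U x p) \<le> U x p - 1" by (rule ln_le_minus_one[OF Upos[OF w]])
      ultimately show ?thesis by linarith
    qed
    moreover have iV: "integrable (M \<Otimes>\<^sub>M stdn) V" unfolding V_def by (rule vi)
    moreover have iR: "integrable (M \<Otimes>\<^sub>M stdn) (\<lambda>p. K + G (snd p) - ln (m (fst p)))"
      using PF(1)[OF mint'] PF(3)[OF Gi(1)] by auto
    ultimately have "(\<integral>p. V p + (K + G (snd p) - ln (m (fst p))) \<partial>(M \<Otimes>\<^sub>M stdn)) \<le> (\<integral>p. U x p - 1 \<partial>(M \<Otimes>\<^sub>M stdn))"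
      using Ux by (intro integral_mono) auto
    also have "(\<integral>p. U x p - 1 \<partial>(M \<Otimes>\<^sub>M stdn)) = (\<integral>p. U x p \<partial>(M \<Otimes>\<^sub>M stdn)) - 1"
      using Ux by (simp add: P.prob_space)
    also have "(\<integral>p. V p + (K + G (snd p) - ln (m (fst p))) \<partial>(M \<Otimes>\<^sub>M stdn))
       = (\<integral>p. V p \<partial>(M \<Otimes>\<^sub>M stdn)) + (\<integral>p. K + G (snd p) - ln (m (fst p)) \<partial>(M \<Otimes>\<^sub>M stdn))"
      by (rule Bochner_Integration.integral_add[OF iV iR])
    also have "(\<integral>p. K + G (snd p) - ln (m (fst p)) \<partial>(M \<Otimes>\<^sub>M stdn)) = K + (ln (2 * pi) / 2 + c\<^sup>2 * x\<^sup>2 / 2 + s\<^sup>2 / 2) - Em"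
      using PF(1,2)[OF mint'] PF(3,4)[OF Gi(1)] Gi(2) by (simp add: P.prob_space Em_def)
    finally have "(\<integral>p. V p \<partial>(M \<Otimes>\<^sub>M stdn)) + (K + (ln (2 * pi) / 2 + c\<^sup>2 * x\<^sup>2 / 2 + s\<^sup>2 / 2) - Em) \<le> (\<integral>p. U x p \<partial>(M \<Otimes>\<^sub>M stdn)) - 1" .
    moreover have "(1 - t) * ln (F (T x)) - q * x\<^sup>2 - \<kappa> \<le> (\<integral>p. V p \<partial>(M \<Otimes>\<^sub>M stdn))"
      unfolding V_def A_def using hyp[of "T x" x] by (simp add: add.assoc)
    moreover have "k0 + k1 * x\<^sup>2 = ((1 - t) * ln (F (T x)) - q * x\<^sup>2 - \<kappa>) + (K + (ln (2 * pi) / 2 + c\<^sup>2 * x\<^sup>2 / 2 + s\<^sup>2 / 2) - Em)"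
      unfolding k0_def k1_def K_def ln_std_normal_density by (simp add: field_simps)
    ultimately show ?thesis by linarith
  qed
  \<comment> \<open>Integrating over \<open>x\<close> replaces \<open>x^2\<close> by one, and the
    right-hand side becomes the expectation of \<open>U\<close> minus one, which is at most
    zero.\<close>
  have "(\<integral>x. k0 + k1 * x\<^sup>2 \<partial>stdn) \<le> (\<integral>x. (\<integral>p. U x p \<partial>(M \<Otimes>\<^sub>M stdn)) - 1 \<partial>stdn)"
  proof (rule integral_mono_AE)
    show "AE x in stdn. k0 + k1 * x\<^sup>2 \<le> (\<integral>p. U x p \<partial>(M \<Otimes>\<^sub>M stdn)) - 1"
      using U1 by eventually_elim (rule key)
  qed (use sm U2 in \<open>auto intro!: Bochner_Integration.integrable_add Bochner_Integration.integrable_diff N.integrable_const\<close>)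
  also have "\<dots> = (\<integral>x. (\<integral>p. U x p \<partial>(M \<Otimes>\<^sub>M stdn)) \<partial>stdn) - 1"
    using U2 by (simp add: N.prob_space[unfolded space_stdn])
  also have "\<dots> \<le> 0" using U3 by simp
  also have "(\<integral>x. k0 + k1 * x\<^sup>2 \<partial>stdn) = k0 + k1"
    using sm by (simp add: N.prob_space[unfolded space_stdn])
  finally have "k0 + k1 \<le> 0" .
  moreover have "k0 + k1 = (1 - t) * ln I + ((1 - t) * ln c + t * ln (L / t) + t * (ln (2 * pi) + 1) / 2 - q - \<kappa>) - Em"
  proof -
    have "c\<^sup>2 / 2 = 1 / 2 - s\<^sup>2 / 2" using cs by (simp add: field_simps)
    then show ?thesis unfolding k0_def k1_def by (simp add: field_simps)
  qed
  ultimately show ?thesis unfolding I_def Em_def m_def by linarith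
qed

subsection \<open>Induction over the coordinates\<close>

lemma gaussian_exp_integrable:
  assumes "c > 0"
  shows "integrable lborel (\<lambda>r::real. exp (- c * r\<^sup>2))"
proof -
  define \<sigma> where "\<sigma> = 1 / sqrt (2 * c)"
  have "\<sigma> > 0" "\<sigma>\<^sup>2 = 1 / (2 * c)" using assms by (auto simp: \<sigma>_def power_divide)
  then have e: "exp (- c * r\<^sup>2) = sqrt (2 * pi * \<sigma>\<^sup>2) * normal_density 0 \<sigma> r" for r
    using assms by (simp add: normal_density_def)
  have "integrable lborel (normal_density 0 \<sigma>)" by (rule integrable_normal_density) fact
  then show ?thesis unfolding e by (rule integrable_mult_right)
qed

text \<open>\<open>J\<close> is the set of coordinates that have not been integrated out yet.\<close>

definition gauss_bounded :: "'a::euclidean_space set \<Rightarrow> ('a \<Rightarrow> real) \<Rightarrow> bool" where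
  "gauss_bounded J h \<longleftrightarrow> continuous_on UNIV h \<and>
     (\<exists>C c. C > 0 \<and> c > 0 \<and> (\<forall>y. exp (- C * (1 + (norm y)\<^sup>2)) \<le> h y \<and> h y \<le> exp (C - c * (\<Sum>j\<in>J. (y \<bullet> j)\<^sup>2))))"

lemma gauss_bounded_pos: "gauss_bounded J h \<Longrightarrow> 0 < h y"
  unfolding gauss_bounded_def by (meson exp_gt_zero less_le_trans)

lemma gauss_bounded_continuous: "gauss_bounded J h \<Longrightarrow> continuous_on UNIV h"
  unfolding gauss_bounded_def by blast

lemma gauss_bounded_ln:
  assumes "gauss_bounded J h"
  obtains C where "C > 0" "\<And>y. \<bar>ln (h y)\<bar> \<le> C * (1 + (norm y)\<^sup>2)"
proof -
  obtain C c where C: "C > 0" "c > 0" and b: "\<And>y. exp (- C * (1 + (norm y)\<^sup>2)) \<le> h y"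
      "\<And>y. h y \<le> exp (C - c * (\<Sum>j\<in>J. (y \<bullet> j)\<^sup>2))"
    using assms unfolding gauss_bounded_def by blast
  show ?thesis
  proof (rule that[OF C(1)])
    fix y
    have p: "h y > 0" by (rule gauss_bounded_pos[OF assms])
    have "- C * (1 + (norm y)\<^sup>2) \<le> ln (h y)" using ln_mono[OF b(1)[of y] exp_gt_zero] p by simp
    moreover have "ln (h y) \<le> C - c * (\<Sum>j\<in>J. (y \<bullet> j)\<^sup>2)" using ln_mono[OF b(2)[of y] p] by simp
    moreover have "0 \<le> c * (\<Sum>j\<in>J. (y \<bullet> j)\<^sup>2)" using C by (intro mult_nonneg_nonneg sum_nonneg) auto
    moreover have "0 \<le> C * (norm y)\<^sup>2" using C by simp
    ultimately show "\<bar>ln (h y)\<bar> \<le> C * (1 + (norm y)\<^sup>2)" by (simp add: algebra_simps abs_le_iff)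
  qed
qed

lemma norm_add_square_le: "(norm (x + y))\<^sup>2 \<le> 2 * (norm x)\<^sup>2 + 2 * (norm y)\<^sup>2" for x y :: "'a::real_inner"
proof -
  have "0 \<le> (norm (x - y))\<^sup>2" by simp
  then show ?thesis unfolding power2_norm_eq_inner
    by (simp add: inner_add_left inner_add_right inner_diff_left inner_diff_right inner_commute)
qed

lemma norm_upd: "i \<in> Basis \<Longrightarrow> (norm (upd i r y))\<^sup>2 = (norm y)\<^sup>2 - (y \<bullet> i)\<^sup>2 + r\<^sup>2"
  unfolding upd_def power2_norm_eq_inner
  by (simp add: inner_add_left inner_add_right inner_commute power2_eq_square algebra_simps)

text \<open>Still a function on the whole space, constant in coordinate \<open>i\<close>. The same
  points \<open>z\<close>, \<open>x\<close> and the same noise can then be used before and after a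
  coordinate is integrated out.\<close>

definition marginal :: "'a::euclidean_space \<Rightarrow> ('a \<Rightarrow> real) \<Rightarrow> 'a \<Rightarrow> real" where
  "marginal i h y = (\<integral>r. h (upd i r y) \<partial>lborel)"

text \<open>The upper bound splits off a factor \<open>exp (- c * r^2)\<close>, which gives
  integrability in \<open>r\<close> and a dominating function for continuity. The lower bound
  survives because replacing one coordinate by \<open>r\<close> raises the squared norm by at most
  \<open>r^2\<close>.\<close>

lemma gauss_bounded_marginal:
  assumes h: "gauss_bounded J h" and J: "J \<subseteq> Basis" and i: "i \<in> J"
  shows "integrable lborel (\<lambda>r. h (upd i r y))" and "gauss_bounded (J - {i}) (marginal i h)"
proof -
  obtain C c where C: "C > 0" "c > 0" and b: "\<And>y. exp (- C * (1 + (norm y)\<^sup>2)) \<le> h y"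
      "\<And>y. h y \<le> exp (C - c * (\<Sum>j\<in>J. (y \<bullet> j)\<^sup>2))" and hc: "continuous_on UNIV h"
    using h unfolding gauss_bounded_def by blast
  have iB: "i \<in> Basis" and fJ: "finite J" using i J finite_subset[OF J finite_Basis] by auto
  have hp: "0 < h y" for y by (rule gauss_bounded_pos[OF h])
  define S where "S y = (\<Sum>j\<in>J - {i}. (y \<bullet> j)\<^sup>2)" for y
  have up: "h (upd i r y) \<le> exp (C - c * S y) * exp (- c * r\<^sup>2)" for r y
  proof -
    have "(\<Sum>j\<in>J. (upd i r y \<bullet> j)\<^sup>2) = r\<^sup>2 + (\<Sum>j\<in>J - {i}. (upd i r y \<bullet> j)\<^sup>2)"
      by (subst sum.remove[OF fJ i]) (simp add: upd_inner iB)
    also have "(\<Sum>j\<in>J - {i}. (upd i r y \<bullet> j)\<^sup>2) = S y"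
      unfolding S_def using J by (intro sum.cong) (auto simp: upd_inner iB)
    finally show ?thesis using b(2)[of "upd i r y"] by (simp add: exp_add[symmetric] algebra_simps)
  qed
  have lo: "exp (- C * (1 + (norm y)\<^sup>2)) * exp (- C * r\<^sup>2) \<le> h (upd i r y)" for r y
  proof -
    have "(norm (upd i r y))\<^sup>2 \<le> (norm y)\<^sup>2 + r\<^sup>2" unfolding norm_upd[OF iB] by simp
    then have "C * (norm (upd i r y))\<^sup>2 \<le> C * ((norm y)\<^sup>2 + r\<^sup>2)" using C by simp
    then have "- C * (1 + (norm y)\<^sup>2) + - C * r\<^sup>2 \<le> - C * (1 + (norm (upd i r y))\<^sup>2)" by (simp add: algebra_simps)
    then show ?thesis using b(1)[of "upd i r y"] unfolding exp_add[symmetric] by (meson exp_le_cancel_iff order_trans)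
  qed
  have hm: "(\<lambda>r. h (upd i r y)) \<in> borel_measurable lborel" for y
    using borel_measurable_continuous_onI[OF continuous_on_compose2[OF hc, of UNIV "\<lambda>r. upd i r y"]]
    by (simp add: continuous_intros)
  have I: "integrable lborel (\<lambda>r. h (upd i r y))" for y
    by (rule Bochner_Integration.integrable_bound[OF integrable_mult_right[OF gaussian_exp_integrable[OF C(2)], of "exp (C - c * S y)"] hm])
      (use up hp in \<open>auto simp: less_imp_le\<close>)
  then show "integrable lborel (\<lambda>r. h (upd i r y))" .
  define G where "G a = (\<integral>(r::real). exp (- a * r\<^sup>2) \<partial>lborel)" for a
  have G: "G a > 0" if "a > 0" for a unfolding G_def by (rule lborel_integral_pos[OF gaussian_exp_integrable[OF that]]) simp
  have up': "marginal i h y \<le> exp (C - c * S y) * G c" for y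
  proof -
    have "marginal i h y \<le> (\<integral>r. exp (C - c * S y) * exp (- c * r\<^sup>2) \<partial>lborel)"
      unfolding marginal_def
      by (rule integral_mono[OF I integrable_mult_right[OF gaussian_exp_integrable[OF C(2)]] up])
    then show ?thesis unfolding G_def by simp
  qed
  have lo': "exp (- C * (1 + (norm y)\<^sup>2)) * G C \<le> marginal i h y" for y
  proof -
    have "(\<integral>r. exp (- C * (1 + (norm y)\<^sup>2)) * exp (- C * r\<^sup>2) \<partial>lborel) \<le> marginal i h y"
      unfolding marginal_def
      by (rule integral_mono[OF integrable_mult_right[OF gaussian_exp_integrable[OF C(1)]] I lo])
    then show ?thesis unfolding G_def by simp
  qed
  have cont: "continuous_on UNIV (marginal i h)"
  proof (rule continuous_at_imp_continuous_on, rule ballI)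
    fix y :: 'a
    show "isCont (marginal i h) y"
    proof (rule continuous_at_sequentiallyI)
      fix u assume u: "u \<longlonglongrightarrow> y"
      show "(\<lambda>n. marginal i h (u n)) \<longlonglongrightarrow> marginal i h y"
        unfolding marginal_def
      proof (rule integral_dominated_convergence[where w="\<lambda>r. exp C * exp (- c * r\<^sup>2)"])
        show "integrable lborel (\<lambda>r. exp C * exp (- c * r\<^sup>2))"
          by (rule integrable_mult_right[OF gaussian_exp_integrable[OF C(2)]])
        show "AE r in lborel. (\<lambda>n. h (upd i r (u n))) \<longlonglongrightarrow> h (upd i r y)"
        proof (rule AE_I2)
          fix r
          have "continuous_on UNIV (\<lambda>y. h (upd i r y))"
            by (intro continuous_on_compose2[OF hc] continuous_intros) auto
          then show "(\<lambda>n. h (upd i r (u n))) \<longlonglongrightarrow> h (upd i r y)"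
            by (rule continuous_on_tendsto_compose[OF _ u]) auto
        qed
        show "AE r in lborel. norm (h (upd i r (u n))) \<le> exp C * exp (- c * r\<^sup>2)" for n
        proof (rule AE_I2)
          fix r
          have "0 \<le> S (u n)" unfolding S_def by (simp add: sum_nonneg)
          then have "exp (C - c * S (u n)) \<le> exp C" using C by simp
          then show "norm (h (upd i r (u n))) \<le> exp C * exp (- c * r\<^sup>2)"
            using up[of r "u n"] hp[of "upd i r (u n)"]
            by (auto intro: order_trans mult_right_mono)
        qed
      qed (use hm in auto)
    qed
  qed
  \<comment> \<open>Absorbs the Gaussian integrals \<open>G c\<close> and \<open>G C\<close>, whose
    logarithms may have either sign.\<close>
  define C' where "C' = C + \<bar>ln (G c)\<bar> + \<bar>ln (G C)\<bar>"
  show "gauss_bounded (J - {i}) (marginal i h)"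
    unfolding gauss_bounded_def
  proof (intro conjI cont exI allI)
    show "C' > 0" "c > 0" using C by (auto simp: C'_def)
    fix y
    have "exp (C - c * S y) * G c = exp (C - c * S y + ln (G c))" using G[OF C(2)] by (simp add: exp_add)
    also have "\<dots> \<le> exp (C' - c * S y)" by (simp add: C'_def)
    finally show "marginal i h y \<le> exp (C' - c * (\<Sum>j\<in>J - {i}. (y \<bullet> j)\<^sup>2))"
      using up'[of y] by (simp add: S_def)
    define X E where "X = 1 + (norm y)\<^sup>2" and "E = \<bar>ln (G c)\<bar> + \<bar>ln (G C)\<bar>"
    have "E * 1 \<le> E * X" unfolding X_def E_def by (intro mult_left_mono) auto
    moreover have "- ln (G C) \<le> E" unfolding E_def by linarith
    moreover have "C' * X = C * X + E * X" by (simp add: C'_def E_def algebra_simps)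
    ultimately have "- C' * X \<le> - C * X + ln (G C)" by simp
    then have "- C' * (1 + (norm y)\<^sup>2) \<le> - C * (1 + (norm y)\<^sup>2) + ln (G C)" unfolding X_def .
    then have "exp (- C' * (1 + (norm y)\<^sup>2)) \<le> exp (- C * (1 + (norm y)\<^sup>2) + ln (G C))" by simp
    also have "\<dots> = exp (- C * (1 + (norm y)\<^sup>2)) * G C" using G[OF C(1)] by (simp only: exp_add exp_ln)
    finally show "exp (- C' * (1 + (norm y)\<^sup>2)) \<le> marginal i h y" using lo'[of y] by linarith
  qed
qed

section \<open>Integration over several coordinates\<close>

interpretation lborel_PiM: product_sigma_finite "\<lambda>_::'a::euclidean_space. lborel :: real measure" ..

text \<open>\<open>upd\<close> in all coordinates of \<open>I\<close> at once. Integrating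
  \<open>h (put I f y)\<close> over \<open>f\<close> is the iterated marginal, and for
  \<open>I = Basis\<close> the dependence on \<open>y\<close> disappears.\<close>

definition put :: "'a::euclidean_space set \<Rightarrow> ('a \<Rightarrow> real) \<Rightarrow> 'a \<Rightarrow> 'a" where
  "put I f y = y + (\<Sum>b\<in>I. (f b - y \<bullet> b) *\<^sub>R b)"

lemma put_measurable [measurable]: "finite I \<Longrightarrow> (\<lambda>f. put I f y) \<in> borel_measurable (Pi\<^sub>M I (\<lambda>_. lborel))"
  unfolding put_def by measurable

lemma put_insert:
  assumes "finite I" "i \<notin> I" "insert i I \<subseteq> Basis"
  shows "put (insert i I) (f(i := r)) y = put I f (upd i r y)"
proof -
  have "(\<Sum>b\<in>I. ((f(i := r)) b - y \<bullet> b) *\<^sub>R b) = (\<Sum>b\<in>I. (f b - upd i r y \<bullet> b) *\<^sub>R b)"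
    using assms by (intro sum.cong) (auto simp: upd_inner)
  then show ?thesis using assms by (simp add: put_def upd_def algebra_simps)
qed

lemma nn_integral_put_insert:
  assumes I: "finite I" "i \<notin> I" "insert i I \<subseteq> Basis" and [measurable]: "h \<in> borel_measurable borel"
  shows "(\<integral>\<^sup>+f. h (put (insert i I) f y) \<partial>(Pi\<^sub>M (insert i I) (\<lambda>_. lborel)))
     = (\<integral>\<^sup>+r. \<integral>\<^sup>+f. h (put I f (upd i r y)) \<partial>(Pi\<^sub>M I (\<lambda>_. lborel)) \<partial>lborel)"
  using I by (subst lborel_PiM.product_nn_integral_insert_rev) (auto simp: put_insert)

lemma nn_integral_put_insert':
  assumes I: "finite I" "i \<notin> I" "insert i I \<subseteq> Basis" and [measurable]: "h \<in> borel_measurable borel"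
  shows "(\<integral>\<^sup>+f. h (put (insert i I) f y) \<partial>(Pi\<^sub>M (insert i I) (\<lambda>_. lborel)))
     = (\<integral>\<^sup>+f. \<integral>\<^sup>+r. h (put I f (upd i r y)) \<partial>lborel \<partial>(Pi\<^sub>M I (\<lambda>_. lborel)))"
  using I by (subst lborel_PiM.product_nn_integral_insert) (auto simp: put_insert)

lemma put_Basis: "put Basis f y = (\<Sum>b\<in>Basis. f b *\<^sub>R b)"
  unfolding put_def by (simp add: scaleR_diff_left sum_subtractf euclidean_representation)

lemma nn_integral_put_Basis:
  fixes h :: "'a::euclidean_space \<Rightarrow> ennreal"
  assumes [measurable]: "h \<in> borel_measurable borel"
  shows "(\<integral>\<^sup>+f. h (put Basis f y) \<partial>(Pi\<^sub>M Basis (\<lambda>_. lborel))) = (\<integral>\<^sup>+x. h x \<partial>lborel)"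
  unfolding put_Basis by (subst lborel_eq) (simp add: nn_integral_distr)

section \<open>Resampling one coordinate of a Gaussian vector\<close>

lemma nn_integral_stdn_resample:
  fixes h :: "'a::euclidean_space \<Rightarrow> ennreal"
  assumes i: "i \<in> Basis" and [measurable]: "h \<in> borel_measurable borel"
  shows "(\<integral>\<^sup>+g. \<integral>\<^sup>+r. h (upd i r g) \<partial>stdn \<partial>stdn) = (\<integral>\<^sup>+g. h g \<partial>stdn)"
proof -
  define I where "I = Basis - {i}"
  have I: "finite I" "i \<notin> I" "insert i I = Basis" using i by (auto simp: I_def)
  define P where "P y = (\<Prod>b\<in>I. ennreal (std_normal_density (y \<bullet> b)))" for y
  have [measurable]: "P \<in> borel_measurable borel" unfolding P_def by measurable
  have dens: "ennreal (stdn_density (upd i s y)) = ennreal (std_normal_density s) * P y" for s y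
  proof -
    have "ennreal (stdn_density (upd i s y)) = (\<Prod>b\<in>Basis. ennreal (std_normal_density (upd i s y \<bullet> b)))"
      by (simp add: stdn_density_def prod_ennreal)
    also have "\<dots> = ennreal (std_normal_density s) * (\<Prod>b\<in>I. ennreal (std_normal_density (upd i s y \<bullet> b)))"
      unfolding I_def by (subst prod.remove[OF finite_Basis i]) (simp add: upd_inner i)
    also have "(\<Prod>b\<in>I. ennreal (std_normal_density (upd i s y \<bullet> b))) = P y"
      unfolding P_def I_def by (intro prod.cong) (auto simp: upd_inner i)
    finally show ?thesis .
  qed
  have norm1: "(\<integral>\<^sup>+s. ennreal (std_normal_density s) \<partial>lborel) = 1"
    by (subst nn_integral_eq_integral) auto
  have upd_m[measurable]: "(\<lambda>r. upd i r y) \<in> borel_measurable borel" for y :: 'a unfolding upd_def by measurable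
  \<comment> \<open>Tonelli with coordinate \<open>i\<close> innermost. When \<open>k\<close> is
    itself a mean over that coordinate, it does not depend on \<open>s\<close>, and the inner
    density integrates to one.\<close>
  have main: "(\<integral>\<^sup>+g. k g \<partial>stdn) = (\<integral>\<^sup>+f. P (put I f 0) * (\<integral>\<^sup>+s. ennreal (std_normal_density s) * k (upd i s (put I f 0)) \<partial>lborel) \<partial>(Pi\<^sub>M I (\<lambda>_. lborel)))"
    if [measurable]: "k \<in> borel_measurable borel" for k
  proof -
    have "(\<integral>\<^sup>+g. k g \<partial>stdn) = (\<integral>\<^sup>+f. (\<lambda>y. ennreal (stdn_density y) * k y) (put (insert i I) f 0) \<partial>(Pi\<^sub>M (insert i I) (\<lambda>_. lborel)))"
      unfolding I(3) by (subst nn_integral_put_Basis) (auto simp: nn_integral_stdn)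
    also have "\<dots> = (\<integral>\<^sup>+f. \<integral>\<^sup>+s. ennreal (stdn_density (put I f (upd i s 0))) * k (put I f (upd i s 0)) \<partial>lborel \<partial>(Pi\<^sub>M I (\<lambda>_. lborel)))"
      using I by (subst nn_integral_put_insert') auto
    also have "\<dots> = (\<integral>\<^sup>+f. P (put I f 0) * (\<integral>\<^sup>+s. ennreal (std_normal_density s) * k (upd i s (put I f 0)) \<partial>lborel) \<partial>(Pi\<^sub>M I (\<lambda>_. lborel)))"
    proof (intro nn_integral_cong)
      fix f :: "'a \<Rightarrow> real"
      have pu: "put I f (upd i s 0) = upd i s (put I f 0)" for s
      proof -
        have "put I f 0 \<bullet> i = 0" unfolding put_def using I(1,2) i
          by (auto simp: inner_sum_left I_def inner_Basis intro!: sum.neutral)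
        moreover have "(\<Sum>b\<in>I. (f b - upd i s 0 \<bullet> b) *\<^sub>R b) = (\<Sum>b\<in>I. f b *\<^sub>R b)"
          using i by (intro sum.cong) (auto simp: I_def upd_inner)
        ultimately show ?thesis by (simp add: put_def upd_def)
      qed
      have "(\<integral>\<^sup>+s. ennreal (stdn_density (put I f (upd i s 0))) * k (put I f (upd i s 0)) \<partial>lborel)
          = (\<integral>\<^sup>+s. P (put I f 0) * (ennreal (std_normal_density s) * k (upd i s (put I f 0))) \<partial>lborel)"
        unfolding pu dens by (simp add: mult_ac)
      then show "(\<integral>\<^sup>+s. ennreal (stdn_density (put I f (upd i s 0))) * k (put I f (upd i s 0)) \<partial>lborel)
        = P (put I f 0) * (\<integral>\<^sup>+s. ennreal (std_normal_density s) * k (upd i s (put I f 0)) \<partial>lborel)"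
        by (simp add: nn_integral_cmult)
    qed
    finally show ?thesis .
  qed
  interpret N: prob_space "stdn :: real measure" by (rule prob_space_stdn)
  have "(\<lambda>p. h (upd i (snd p) (fst p))) \<in> borel_measurable (borel \<Otimes>\<^sub>M borel)"
    unfolding upd_def by measurable
  then have "(\<lambda>(g, r). h (upd i r g)) \<in> borel_measurable (borel \<Otimes>\<^sub>M stdn)"
    by (subst measurable_cong_sets[OF _ refl]) (auto intro!: sets_pair_measure_cong simp: split_beta')
  from N.borel_measurable_nn_integral_fst[OF this]
  have m: "(\<lambda>g. \<integral>\<^sup>+r. h (upd i r g) \<partial>stdn) \<in> borel_measurable borel" by simp
  have "(\<integral>\<^sup>+g. \<integral>\<^sup>+r. h (upd i r g) \<partial>stdn \<partial>stdn)
     = (\<integral>\<^sup>+f. P (put I f 0) * (\<integral>\<^sup>+s. ennreal (std_normal_density s) * (\<integral>\<^sup>+r. h (upd i r (upd i s (put I f 0))) \<partial>stdn) \<partial>lborel) \<partial>(Pi\<^sub>M I (\<lambda>_. lborel)))"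
    by (rule main[OF m])
  also have "\<dots> = (\<integral>\<^sup>+f. P (put I f 0) * (\<integral>\<^sup>+r. h (upd i r (put I f 0)) \<partial>stdn) \<partial>(Pi\<^sub>M I (\<lambda>_. lborel)))"
    by (simp add: upd_upd[OF i] nn_integral_multc norm1)
  also have "\<dots> = (\<integral>\<^sup>+f. P (put I f 0) * (\<integral>\<^sup>+s. ennreal (std_normal_density s) * h (upd i s (put I f 0)) \<partial>lborel) \<partial>(Pi\<^sub>M I (\<lambda>_. lborel)))"
    by (simp add: nn_integral_stdn stdn_density_real)
  also have "\<dots> = (\<integral>\<^sup>+g. h g \<partial>stdn)" by (rule main[symmetric]) simp
  finally show ?thesis .
qed

lemma stdn_resample:
  assumes i: "i \<in> Basis"
  shows "distr (stdn \<Otimes>\<^sub>M stdn) stdn (\<lambda>p. upd i (snd p) (fst p)) = (stdn :: 'a::euclidean_space measure)"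
proof (rule measure_eqI)
  interpret N: prob_space "stdn :: real measure" by (rule prob_space_stdn)
  have se: "sets ((stdn :: 'a measure) \<Otimes>\<^sub>M (stdn :: real measure)) = sets (borel \<Otimes>\<^sub>M borel)"
    by (intro sets_pair_measure_cong) auto
  have "(\<lambda>p. upd i (snd p) (fst p)) \<in> measurable (borel \<Otimes>\<^sub>M borel) borel" unfolding upd_def by measurable
  then have m: "(\<lambda>p. upd i (snd p) (fst p)) \<in> measurable ((stdn :: 'a measure) \<Otimes>\<^sub>M (stdn :: real measure)) stdn"
    by (subst measurable_cong_sets[OF se sets_stdn])
  fix A assume "A \<in> sets (distr (stdn \<Otimes>\<^sub>M stdn) (stdn :: 'a measure) (\<lambda>p. upd i (snd p) (fst p)))"
  then have A[measurable]: "A \<in> sets borel" by simp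
  have Am: "indicator A \<in> borel_measurable (stdn :: 'a measure)" by simp
  have "emeasure (distr (stdn \<Otimes>\<^sub>M stdn) (stdn :: 'a measure) (\<lambda>p. upd i (snd p) (fst p))) A
     = (\<integral>\<^sup>+p. indicator A (upd i (snd p) (fst p)) \<partial>(stdn \<Otimes>\<^sub>M stdn))"
    using nn_integral_distr[OF m, of "indicator A"] by simp
  also have "\<dots> = (\<integral>\<^sup>+g. \<integral>\<^sup>+r. indicator A (upd i r g) \<partial>stdn \<partial>stdn)"
    using N.nn_integral_fst[OF measurable_compose[OF m Am]] by simp
  also have "\<dots> = emeasure stdn A"
    using nn_integral_stdn_resample[OF i, of "indicator A"] by simp
  finally show "emeasure (distr (stdn \<Otimes>\<^sub>M stdn) (stdn :: 'a measure) (\<lambda>p. upd i (snd p) (fst p))) A = emeasure stdn A" .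
qed simp

text \<open>Splits the noise in space into two independent parts: an old vector, which will index a
  family of functions on a line, and a fresh real, which is the noise on that line.\<close>

lemma integral_stdn_resample:
  fixes h :: "'a::euclidean_space \<Rightarrow> real"
  assumes i: "i \<in> Basis" and [measurable]: "h \<in> borel_measurable borel"
  shows "(\<integral>p. h (upd i (snd p) (fst p)) \<partial>(stdn \<Otimes>\<^sub>M stdn)) = (\<integral>g. h g \<partial>stdn)"
proof -
  have se: "sets ((stdn :: 'a measure) \<Otimes>\<^sub>M (stdn :: real measure)) = sets (borel \<Otimes>\<^sub>M borel)"
    by (intro sets_pair_measure_cong) auto
  have "(\<lambda>p. upd i (snd p) (fst p)) \<in> measurable (borel \<Otimes>\<^sub>M borel) borel" unfolding upd_def by measurable
  then have m: "(\<lambda>p. upd i (snd p) (fst p)) \<in> measurable ((stdn :: 'a measure) \<Otimes>\<^sub>M (stdn :: real measure)) stdn"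
    by (subst measurable_cong_sets[OF se sets_stdn])
  show ?thesis by (subst (2) stdn_resample[OF i, symmetric]) (simp add: integral_distr[OF m])
qed

lemma integrable_stdn_norm2: "integrable stdn (\<lambda>g::'a::euclidean_space. (norm g)\<^sup>2)"
proof -
  have "integrable stdn (\<lambda>g::'a. (g \<bullet> i)\<^sup>2)" if i: "i \<in> Basis" for i
  proof (rule integrableI_nonneg)
    interpret prob_space "stdn :: 'a measure" by (rule prob_space_stdn)
    have "(\<integral>\<^sup>+(g::'a). ennreal ((g \<bullet> i)\<^sup>2) \<partial>stdn) = (\<integral>\<^sup>+(g::'a). \<integral>\<^sup>+r. ennreal ((upd i r g \<bullet> i)\<^sup>2) \<partial>stdn \<partial>stdn)"
      by (rule nn_integral_stdn_resample[OF i, symmetric]) simp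
    also have "\<dots> = (\<integral>\<^sup>+(r::real). ennreal (r\<^sup>2) \<partial>stdn)"
      using i emeasure_space_1 by (simp add: upd_inner)
    also have "\<dots> < \<infinity>"
      using stdn_real_moments(3) by (subst nn_integral_eq_integral) auto
    finally show "(\<integral>\<^sup>+(g::'a). ennreal ((g \<bullet> i)\<^sup>2) \<partial>stdn) < \<infinity>" .
  qed auto
  then have "integrable stdn (\<lambda>g::'a. \<Sum>i\<in>Basis. (g \<bullet> i)\<^sup>2)" by (rule Bochner_Integration.integrable_sum)
  moreover have "(norm g)\<^sup>2 = (\<Sum>i\<in>Basis. (g \<bullet> i)\<^sup>2)" for g :: 'a
    by (rule norm_square_eq_sum_Basis)
  ultimately show ?thesis by simp
qed

lemma integrable_stdn_ln_gauss_bounded: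
  fixes V :: "'a::euclidean_space \<Rightarrow> real"
  assumes V: "gauss_bounded J V"
  shows "integrable stdn (\<lambda>g. ln (V (A + e *\<^sub>R g)))"
proof -
  interpret prob_space "stdn :: 'a measure" by (rule prob_space_stdn)
  obtain C where C: "C > 0" "\<And>y. \<bar>ln (V y)\<bar> \<le> C * (1 + (norm y)\<^sup>2)" by (rule gauss_bounded_ln[OF V]) blast
  have [measurable]: "V \<in> borel_measurable borel"
    using gauss_bounded_continuous[OF V] by (rule borel_measurable_continuous_onI)
  show ?thesis
  proof (rule Bochner_Integration.integrable_bound)
    show "integrable stdn (\<lambda>g::'a. C * (1 + 2 * (norm A)\<^sup>2) + (C * 2 * e\<^sup>2) * (norm g)\<^sup>2)"
      by (intro Bochner_Integration.integrable_add integrable_const integrable_mult_right integrable_stdn_norm2)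
    show "AE g in stdn. norm (ln (V (A + e *\<^sub>R g))) \<le> norm (C * (1 + 2 * (norm A)\<^sup>2) + (C * 2 * e\<^sup>2) * (norm g)\<^sup>2)"
    proof (rule AE_I2)
      fix g :: 'a
      have "\<bar>ln (V (A + e *\<^sub>R g))\<bar> \<le> C * (1 + (norm (A + e *\<^sub>R g))\<^sup>2)" by (rule C(2))
      also have "\<dots> \<le> C * (1 + (2 * (norm A)\<^sup>2 + 2 * (norm (e *\<^sub>R g))\<^sup>2))"
        using norm_add_square_le[of A "e *\<^sub>R g"] C(1) by simp
      also have "\<dots> = C * (1 + 2 * (norm A)\<^sup>2) + (C * 2 * e\<^sup>2) * (norm g)\<^sup>2"
        by (simp add: power_mult_distrib algebra_simps)
      finally show "norm (ln (V (A + e *\<^sub>R g))) \<le> norm (C * (1 + 2 * (norm A)\<^sup>2) + (C * 2 * e\<^sup>2) * (norm g)\<^sup>2)"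
        by simp
    qed
  qed simp
qed

text \<open>One application of \<open>family_transport\<close> along direction \<open>i\<close>. The
  other coordinates of \<open>z\<close> and \<open>x\<close> are frozen, the family consists of the
  restrictions of \<open>V\<close> to parallel lines displaced by the noise, and resampling provides
  the one-dimensional noise. The conclusion has the shape of the hypothesis with \<open>i\<close>
  removed, so the step can be iterated.\<close>

lemma transport_step:
  fixes V F :: "'a::euclidean_space \<Rightarrow> real"
  assumes V: "gauss_bounded J V" and F: "gauss_bounded J F" and J: "J \<subseteq> Basis" and i: "i \<in> J"
    and t: "0 < t" "t < 1" and c: "c > 0" and cs: "c\<^sup>2 + s\<^sup>2 = 1" and L: "L = b * c + e * s" "L > 0"
    and hyp: "\<And>z x. (1 - t) * ln (F z) - (\<Sum>j\<in>J. q * (x \<bullet> j)\<^sup>2 + \<kappa>) + k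
        \<le> (\<integral>g. ln (V ((1 - t) *\<^sub>R z + b *\<^sub>R x + e *\<^sub>R g)) \<partial>stdn)"
  shows "(1 - t) * ln (marginal i F z) - (\<Sum>j\<in>J - {i}. q * (x \<bullet> j)\<^sup>2 + \<kappa>)
      + (k + ((1 - t) * ln c + t * ln (L / t) + t * (ln (2 * pi) + 1) / 2 - q - \<kappa>))
     \<le> (\<integral>g. ln (marginal i V ((1 - t) *\<^sub>R z + b *\<^sub>R x + e *\<^sub>R g)) \<partial>stdn)"
proof -
  have iB: "i \<in> Basis" and fJ: "finite J" using i J finite_subset[OF J finite_Basis] by auto
  obtain C where C: "C > 0" "\<And>y. \<bar>ln (V y)\<bar> \<le> C * (1 + (norm y)\<^sup>2)" by (rule gauss_bounded_ln[OF V]) blast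
  have [measurable]: "V \<in> borel_measurable borel"
    using gauss_bounded_continuous[OF V] by (rule borel_measurable_continuous_onI)
  interpret N: prob_space "stdn :: 'a measure" by (rule prob_space_stdn)
  define A where "A = (1 - t) *\<^sub>R z + b *\<^sub>R x"
  define v where "v g r = V (upd i r (A + e *\<^sub>R g))" for g r
  define F1 where "F1 r = F (upd i r z)" for r
  define \<kappa>1 where "\<kappa>1 = (\<Sum>j\<in>J - {i}. q * (x \<bullet> j)\<^sup>2 + \<kappa>) + \<kappa> - k"
  have "(1 - t) * ln (\<integral>r. F1 r \<partial>lborel) + ((1 - t) * ln c + t * ln (L / t) + t * (ln (2 * pi) + 1) / 2 - q - \<kappa>1)
     \<le> (\<integral>g. ln (\<integral>r. v g r \<partial>lborel) \<partial>stdn)"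
  proof (rule family_transport[OF prob_space_stdn, where C=C and B="\<lambda>g. C * (1 + 2 * (norm A)\<^sup>2) + (C * 2 * e\<^sup>2) * (norm g)\<^sup>2" and b=b and e=e and s=s])
    have se: "sets ((stdn :: 'a measure) \<Otimes>\<^sub>M (borel :: real measure)) = sets (borel \<Otimes>\<^sub>M borel)"
      by (intro sets_pair_measure_cong) auto
    have "(\<lambda>p. v (fst p) (snd p)) \<in> borel_measurable (borel \<Otimes>\<^sub>M borel)"
      unfolding v_def upd_def by measurable
    then show "(\<lambda>p. v (fst p) (snd p)) \<in> borel_measurable (stdn \<Otimes>\<^sub>M borel)"
      by (subst measurable_cong_sets[OF se refl])
    show "0 < v w y" for w y unfolding v_def by (rule gauss_bounded_pos[OF V])
    show "integrable lborel (v w)" for w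
      unfolding v_def by (rule gauss_bounded_marginal(1)[OF V J i])
    show "\<bar>ln (v g r)\<bar> \<le> C * (1 + 2 * (norm A)\<^sup>2) + (C * 2 * e\<^sup>2) * (norm g)\<^sup>2 + C * r\<^sup>2" for g r
    proof -
      have "\<bar>ln (v g r)\<bar> \<le> C * (1 + (norm (upd i r (A + e *\<^sub>R g)))\<^sup>2)" unfolding v_def by (rule C(2))
      also have "\<dots> \<le> C * (1 + (2 * (norm A)\<^sup>2 + 2 * (norm (e *\<^sub>R g))\<^sup>2 + r\<^sup>2))"
      proof -
        have "(norm (upd i r (A + e *\<^sub>R g)))\<^sup>2 \<le> (norm (A + e *\<^sub>R g))\<^sup>2 + r\<^sup>2" unfolding norm_upd[OF iB] by simp
        also have "\<dots> \<le> 2 * (norm A)\<^sup>2 + 2 * (norm (e *\<^sub>R g))\<^sup>2 + r\<^sup>2" using norm_add_square_le[of A "e *\<^sub>R g"] by simp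
        finally show ?thesis using C(1) by simp
      qed
      also have "\<dots> = C * (1 + 2 * (norm A)\<^sup>2) + (C * 2 * e\<^sup>2) * (norm g)\<^sup>2 + C * r\<^sup>2"
        by (simp add: power_mult_distrib algebra_simps)
      finally show ?thesis .
    qed
    show "integrable stdn (\<lambda>g::'a. C * (1 + 2 * (norm A)\<^sup>2) + (C * 2 * e\<^sup>2) * (norm g)\<^sup>2)"
      by (intro Bochner_Integration.integrable_add N.integrable_const integrable_mult_right integrable_stdn_norm2)
    show "integrable stdn (\<lambda>g. ln (\<integral>r. v g r \<partial>lborel))"
      using integrable_stdn_ln_gauss_bounded[OF gauss_bounded_marginal(2)[OF V J i]]
      unfolding v_def marginal_def .
    show "continuous_on UNIV F1" unfolding F1_def
      by (intro continuous_on_compose2[OF gauss_bounded_continuous[OF F]] continuous_intros) auto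
    show "F1 r > 0" for r unfolding F1_def by (rule gauss_bounded_pos[OF F])
    show "integrable lborel F1" unfolding F1_def by (rule gauss_bounded_marginal(1)[OF F J i])
    show "(1 - t) * ln (F1 z1) - q * x1\<^sup>2 - \<kappa>1
        \<le> (\<integral>p. ln (v (fst p) ((1 - t) * z1 + b * x1 + e * snd p)) \<partial>(stdn \<Otimes>\<^sub>M stdn))" for z1 x1
    proof -
      have "(\<Sum>j\<in>J. q * (upd i x1 x \<bullet> j)\<^sup>2 + \<kappa>) = (q * x1\<^sup>2 + \<kappa>) + (\<Sum>j\<in>J - {i}. q * (upd i x1 x \<bullet> j)\<^sup>2 + \<kappa>)"
        by (subst sum.remove[OF fJ i]) (simp add: upd_inner iB)
      also have "(\<Sum>j\<in>J - {i}. q * (upd i x1 x \<bullet> j)\<^sup>2 + \<kappa>) = (\<Sum>j\<in>J - {i}. q * (x \<bullet> j)\<^sup>2 + \<kappa>)"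
        using J by (intro sum.cong) (auto simp: upd_inner iB)
      finally have "(1 - t) * ln (F1 z1) - q * x1\<^sup>2 - \<kappa>1 = (1 - t) * ln (F (upd i z1 z)) - (\<Sum>j\<in>J. q * (upd i x1 x \<bullet> j)\<^sup>2 + \<kappa>) + k"
        by (simp add: F1_def \<kappa>1_def)
      also have "\<dots> \<le> (\<integral>g. ln (V ((1 - t) *\<^sub>R upd i z1 z + b *\<^sub>R upd i x1 x + e *\<^sub>R g)) \<partial>stdn)" by (rule hyp)
      also have "\<dots> = (\<integral>p. ln (V ((1 - t) *\<^sub>R upd i z1 z + b *\<^sub>R upd i x1 x + e *\<^sub>R upd i (snd p) (fst p))) \<partial>(stdn \<Otimes>\<^sub>M stdn))"
        by (subst integral_stdn_resample[OF iB]) auto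
      also have "(\<lambda>p. ln (V ((1 - t) *\<^sub>R upd i z1 z + b *\<^sub>R upd i x1 x + e *\<^sub>R upd i (snd p) (fst p))))
          = (\<lambda>p. ln (v (fst p) ((1 - t) * z1 + b * x1 + e * snd p)))"
        by (simp add: v_def A_def upd_scale[OF iB, of "1 - t"] upd_affine[OF iB])
      finally show ?thesis .
    qed
  qed (use t c cs L C(1) in auto)
  then show ?thesis unfolding v_def F1_def marginal_def[symmetric] A_def \<kappa>1_def by simp
qed

text \<open>Induction over the set \<open>I\<close> of coordinates already integrated out, each
  adding the same constant \<open>K\<close>. The marginals are tied to \<open>v\<close> and
  \<open>F\<close> by extended integrals, so that interchanging coordinates raises no integrability
  conditions.\<close>

lemma gauss_bounded_transport:
  fixes v F :: "'a::euclidean_space \<Rightarrow> real" and \<kappa> :: real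
  assumes v: "gauss_bounded Basis v" and F: "gauss_bounded Basis F"
    and t: "0 < t" "t < 1" and c: "c > 0" and cs: "c\<^sup>2 + s\<^sup>2 = 1" and L: "L = b * c + e * s" "L > 0"
    and hyp: "\<And>z x. (1 - t) * ln (F z) - q * (norm x)\<^sup>2 - DIM('a) * \<kappa>
        \<le> (\<integral>g. ln (v ((1 - t) *\<^sub>R z + b *\<^sub>R x + e *\<^sub>R g)) \<partial>stdn)"
  shows "\<exists>mF mv. 0 < mF \<and> 0 < mv \<and> (\<integral>\<^sup>+x. ennreal (F x) \<partial>lborel) = ennreal mF \<and> (\<integral>\<^sup>+x. ennreal (v x) \<partial>lborel) = ennreal mv
     \<and> (1 - t) * ln mF + DIM('a) * ((1 - t) * ln c + t * ln (L / t) + t * (ln (2 * pi) + 1) / 2 - q - \<kappa>) \<le> ln mv"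
proof -
  define K where "K = (1 - t) * ln c + t * ln (L / t) + t * (ln (2 * pi) + 1) / 2 - q - \<kappa>"
  have [measurable]: "v \<in> borel_measurable borel" "F \<in> borel_measurable borel"
    using gauss_bounded_continuous[OF v] gauss_bounded_continuous[OF F] by (auto intro: borel_measurable_continuous_onI)
  have "finite I \<Longrightarrow> I \<subseteq> Basis \<Longrightarrow> \<exists>V G. gauss_bounded (Basis - I) V \<and> gauss_bounded (Basis - I) G
     \<and> (\<forall>y. ennreal (V y) = (\<integral>\<^sup>+f. ennreal (v (put I f y)) \<partial>(Pi\<^sub>M I (\<lambda>_. lborel))))
     \<and> (\<forall>y. ennreal (G y) = (\<integral>\<^sup>+f. ennreal (F (put I f y)) \<partial>(Pi\<^sub>M I (\<lambda>_. lborel))))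
     \<and> (\<forall>z x. (1 - t) * ln (G z) - (\<Sum>j\<in>Basis - I. q * (x \<bullet> j)\<^sup>2 + \<kappa>) + real (card I) * K
        \<le> (\<integral>g. ln (V ((1 - t) *\<^sub>R z + b *\<^sub>R x + e *\<^sub>R g)) \<partial>stdn))" for I :: "'a set"
  proof (induction I rule: finite_induct)
    case empty
    have n2: "(\<Sum>j\<in>Basis. q * (x \<bullet> j)\<^sup>2 + \<kappa>) = q * (norm x)\<^sup>2 + DIM('a) * \<kappa>" for x :: 'a
    proof -
      have "(norm x)\<^sup>2 = (\<Sum>i\<in>Basis. (x \<bullet> i)\<^sup>2)"
        by (rule norm_square_eq_sum_Basis)
      then show ?thesis by (simp add: sum.distrib sum_distrib_left)
    qed
    show ?case
      using v F hyp by (intro exI[of _ v] exI[of _ F]) (auto simp: n2 put_def PiM_empty nn_integral_count_space_finite diff_diff_eq)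
  next
    case (insert i I)
    then obtain V G where V: "gauss_bounded (Basis - I) V" and G: "gauss_bounded (Basis - I) G"
      and Vi: "\<And>y. ennreal (V y) = (\<integral>\<^sup>+f. ennreal (v (put I f y)) \<partial>(Pi\<^sub>M I (\<lambda>_. lborel)))"
      and Gi: "\<And>y. ennreal (G y) = (\<integral>\<^sup>+f. ennreal (F (put I f y)) \<partial>(Pi\<^sub>M I (\<lambda>_. lborel)))"
      and H: "\<And>z x. (1 - t) * ln (G z) - (\<Sum>j\<in>Basis - I. q * (x \<bullet> j)\<^sup>2 + \<kappa>) + real (card I) * K
        \<le> (\<integral>g. ln (V ((1 - t) *\<^sub>R z + b *\<^sub>R x + e *\<^sub>R g)) \<partial>stdn)" by auto
    have i: "i \<in> Basis - I" using insert by auto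
    have J: "Basis - insert i I = (Basis - I) - {i}" by auto
    have marg: "ennreal (marginal i W y) = (\<integral>\<^sup>+f. ennreal (w (put (insert i I) f y)) \<partial>(Pi\<^sub>M (insert i I) (\<lambda>_. lborel)))"
      if W: "gauss_bounded (Basis - I) W" and Wi: "\<And>y. ennreal (W y) = (\<integral>\<^sup>+f. ennreal (w (put I f y)) \<partial>(Pi\<^sub>M I (\<lambda>_. lborel)))"
        and [measurable]: "w \<in> borel_measurable borel" for W w y
    proof -
      have "ennreal (marginal i W y) = (\<integral>\<^sup>+r. ennreal (W (upd i r y)) \<partial>lborel)"
        unfolding marginal_def
        by (rule nn_integral_eq_integral[symmetric, OF gauss_bounded_marginal(1)[OF W _ i]])
          (auto simp: less_imp_le[OF gauss_bounded_pos[OF W]])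
      also have "\<dots> = (\<integral>\<^sup>+f. ennreal (w (put (insert i I) f y)) \<partial>(Pi\<^sub>M (insert i I) (\<lambda>_. lborel)))"
        unfolding Wi using insert by (subst nn_integral_put_insert) auto
      finally show ?thesis .
    qed
    have ci: "real (card (insert i I)) * K = real (card I) * K + K" using insert by (simp add: algebra_simps)
    show ?case
    proof (intro exI conjI allI)
      show "gauss_bounded (Basis - insert i I) (marginal i V)" unfolding J by (rule gauss_bounded_marginal(2)[OF V _ i]) auto
      show "gauss_bounded (Basis - insert i I) (marginal i G)" unfolding J by (rule gauss_bounded_marginal(2)[OF G _ i]) auto
      show "ennreal (marginal i V y) = (\<integral>\<^sup>+f. ennreal (v (put (insert i I) f y)) \<partial>(Pi\<^sub>M (insert i I) (\<lambda>_. lborel)))" for y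
        by (rule marg[OF V Vi]) simp
      show "ennreal (marginal i G y) = (\<integral>\<^sup>+f. ennreal (F (put (insert i I) f y)) \<partial>(Pi\<^sub>M (insert i I) (\<lambda>_. lborel)))" for y
        by (rule marg[OF G Gi]) simp
      show "(1 - t) * ln (marginal i G z) - (\<Sum>j\<in>Basis - insert i I. q * (x \<bullet> j)\<^sup>2 + \<kappa>) + real (card (insert i I)) * K
        \<le> (\<integral>g. ln (marginal i V ((1 - t) *\<^sub>R z + b *\<^sub>R x + e *\<^sub>R g)) \<partial>stdn)" for z x
        unfolding J ci by (subst (2) K_def, rule transport_step[OF V G _ i t c cs L H]) auto
    qed
  qed
  note * = this[OF finite_Basis subset_refl]
  have pv: "(\<integral>\<^sup>+f. ennreal (v (put Basis f y)) \<partial>(Pi\<^sub>M Basis (\<lambda>_. lborel))) = (\<integral>\<^sup>+x. ennreal (v x) \<partial>lborel)"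
    and pF: "(\<integral>\<^sup>+f. ennreal (F (put Basis f y)) \<partial>(Pi\<^sub>M Basis (\<lambda>_. lborel))) = (\<integral>\<^sup>+x. ennreal (F x) \<partial>lborel)" for y
    using nn_integral_put_Basis[of "\<lambda>x. ennreal (v x)"] nn_integral_put_Basis[of "\<lambda>x. ennreal (F x)"] by auto
  from *[unfolded Diff_cancel sum.empty pv pF] obtain V G :: "'a \<Rightarrow> real" where V: "gauss_bounded {} V" and G: "gauss_bounded {} G"
    and Vi: "\<forall>y. ennreal (V y) = (\<integral>\<^sup>+x. ennreal (v x) \<partial>lborel)" and Gi: "\<forall>y. ennreal (G y) = (\<integral>\<^sup>+x. ennreal (F x) \<partial>lborel)"
    and H: "\<forall>z x. (1 - t) * ln (G z) - 0 + DIM('a) * K \<le> (\<integral>g. ln (V ((1 - t) *\<^sub>R z + b *\<^sub>R x + e *\<^sub>R g)) \<partial>stdn)"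
    by (elim exE conjE) (rule that, assumption+)
  \<comment> \<open>With no coordinate left, \<open>V\<close> is the constant total mass, so the
    noise drops out of the mean and \<open>z = x = 0\<close> is as good as any choice.\<close>
  have Vc: "V y = V 0" for y
    using Vi[rule_format, of y] Vi[rule_format, of 0] gauss_bounded_pos[OF V] by (metis ennreal_inj less_imp_le)
  interpret N: prob_space "stdn :: 'a measure" by (rule prob_space_stdn)
  have "(\<integral>g. ln (V ((1 - t) *\<^sub>R 0 + b *\<^sub>R 0 + e *\<^sub>R g)) \<partial>stdn) = ln (V 0)"
    by (subst Vc) (simp add: N.prob_space[unfolded space_stdn])
  then have "(1 - t) * ln (G 0) + DIM('a) * K \<le> ln (V 0)" using H[rule_format, of 0 0] by simp
  then show ?thesis
    unfolding K_def Vi[rule_format, of 0, symmetric] Gi[rule_format, of 0, symmetric]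
    using gauss_bounded_pos[OF V] gauss_bounded_pos[OF G] by blast
qed

subsection \<open>The Hopf--Lax inequality\<close>

lemma stdn_moments:
  fixes \<xi> :: "'a::euclidean_space"
  shows "integrable stdn (\<lambda>g. (norm (\<xi> + e *\<^sub>R g))\<^sup>2)"
    and "(\<integral>g. (norm (\<xi> + e *\<^sub>R g))\<^sup>2 \<partial>stdn) = (norm \<xi>)\<^sup>2 + e\<^sup>2 * DIM('a)"
proof -
  interpret N: prob_space "stdn :: 'a measure" by (rule prob_space_stdn)
  note P = pair_prob_fst_snd(3,4)[OF prob_space_stdn[where ?'a='a] prob_space_stdn[where ?'a=real]]
  have p1: "integrable stdn (\<lambda>g::'a. g \<bullet> i)" for i
  proof (rule Bochner_Integration.integrable_bound)
    show "integrable stdn (\<lambda>g::'a. (norm i)\<^sup>2 + (norm g)\<^sup>2)"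
      by (intro Bochner_Integration.integrable_add N.integrable_const integrable_stdn_norm2)
    have "\<bar>g \<bullet> i\<bar> \<le> (norm i)\<^sup>2 + (norm g)\<^sup>2" for g :: 'a
    proof -
      have "\<bar>g \<bullet> i\<bar> \<le> norm g * norm i" by (rule Cauchy_Schwarz_ineq2)
      also have "\<dots> \<le> (norm i)\<^sup>2 + (norm g)\<^sup>2"
        using sum_squares_bound[of "norm g" "norm i"] mult_nonneg_nonneg[OF norm_ge_zero[of g] norm_ge_zero[of i]] by linarith
      finally show ?thesis .
    qed
    then show "AE g in stdn. norm (g \<bullet> i) \<le> norm ((norm i)\<^sup>2 + (norm g)\<^sup>2)" by (intro AE_I2) simp
  qed simp
  have m1: "(\<integral>(g::'a). g \<bullet> i \<partial>stdn) = 0" if i: "i \<in> Basis" for i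
  proof -
    have "(\<integral>(g::'a). g \<bullet> i \<partial>stdn) = (\<integral>(p::'a \<times> real). upd i (snd p) (fst p) \<bullet> i \<partial>(stdn \<Otimes>\<^sub>M stdn))"
      by (rule integral_stdn_resample[OF i, symmetric]) simp
    also have "\<dots> = 0" using i P(2)[OF stdn_real_moments(1)] by (simp add: upd_inner stdn_real_moments)
    finally show ?thesis .
  qed
  have m2: "(\<integral>(g::'a). (g \<bullet> i)\<^sup>2 \<partial>stdn) = 1" if i: "i \<in> Basis" for i
  proof -
    have "(\<integral>(g::'a). (g \<bullet> i)\<^sup>2 \<partial>stdn) = (\<integral>(p::'a \<times> real). (upd i (snd p) (fst p) \<bullet> i)\<^sup>2 \<partial>(stdn \<Otimes>\<^sub>M stdn))"
      by (rule integral_stdn_resample[OF i, symmetric]) simp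
    also have "\<dots> = 1" using i P(2)[OF stdn_real_moments(3)] by (simp add: upd_inner stdn_real_moments)
    finally show ?thesis .
  qed
  \<comment> \<open>The integral of a function that is not integrable is \<open>0\<close> by
    convention, but \<open>m2\<close> gives \<open>1\<close>.\<close>
  have p2: "integrable stdn (\<lambda>g::'a. (g \<bullet> i)\<^sup>2)" if i: "i \<in> Basis" for i
    by (rule ccontr) (use m2[OF i] in \<open>simp add: not_integrable_integral_eq\<close>)
  have ex: "(norm (\<xi> + e *\<^sub>R g))\<^sup>2 = (\<Sum>i\<in>Basis. (\<xi> \<bullet> i)\<^sup>2 + (2 * e * (\<xi> \<bullet> i)) * (g \<bullet> i) + e\<^sup>2 * (g \<bullet> i)\<^sup>2)" for g
    unfolding norm_square_eq_sum_Basis by (intro sum.cong refl) (simp add: inner_add_left power2_eq_square algebra_simps)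
  have it: "integrable stdn (\<lambda>g. (\<xi> \<bullet> i)\<^sup>2 + (2 * e * (\<xi> \<bullet> i)) * (g \<bullet> i) + e\<^sup>2 * (g \<bullet> i)\<^sup>2)" if "i \<in> Basis" for i
    using that by (intro Bochner_Integration.integrable_add N.integrable_const integrable_mult_right p1 p2)
  have val: "(\<integral>g. (\<xi> \<bullet> i)\<^sup>2 + (2 * e * (\<xi> \<bullet> i)) * (g \<bullet> i) + e\<^sup>2 * (g \<bullet> i)\<^sup>2 \<partial>stdn) = (\<xi> \<bullet> i)\<^sup>2 + e\<^sup>2" if i: "i \<in> Basis" for i
  proof -
    have "(\<integral>g. ((\<xi> \<bullet> i)\<^sup>2 + (2 * e * (\<xi> \<bullet> i)) * (g \<bullet> i)) + e\<^sup>2 * (g \<bullet> i)\<^sup>2 \<partial>stdn)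
      = (\<integral>g. (\<xi> \<bullet> i)\<^sup>2 + (2 * e * (\<xi> \<bullet> i)) * (g \<bullet> i) \<partial>stdn) + (\<integral>g. e\<^sup>2 * (g \<bullet> i)\<^sup>2 \<partial>stdn)"
      by (rule Bochner_Integration.integral_add) (use p1 p2[OF i] in \<open>auto intro!: Bochner_Integration.integrable_add N.integrable_const\<close>)
    also have "(\<integral>g. (\<xi> \<bullet> i)\<^sup>2 + (2 * e * (\<xi> \<bullet> i)) * (g \<bullet> i) \<partial>stdn) = (\<integral>(g::'a). (\<xi> \<bullet> i)\<^sup>2 \<partial>stdn) + (\<integral>g. (2 * e * (\<xi> \<bullet> i)) * (g \<bullet> i) \<partial>stdn)"
      by (rule Bochner_Integration.integral_add) (use p1 in \<open>auto intro!: N.integrable_const\<close>)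
    finally show ?thesis using m1[OF i] m2[OF i] by (simp add: N.prob_space[unfolded space_stdn])
  qed
  show "integrable stdn (\<lambda>g. (norm (\<xi> + e *\<^sub>R g))\<^sup>2)"
    unfolding ex by (intro Bochner_Integration.integrable_sum it)
  show "(\<integral>g. (norm (\<xi> + e *\<^sub>R g))\<^sup>2 \<partial>stdn) = (norm \<xi>)\<^sup>2 + e\<^sup>2 * DIM('a)"
    unfolding ex by (subst Bochner_Integration.integral_sum[OF it]) (simp_all add: val sum.distrib norm_square_eq_sum_Basis)
qed

lemma gauss_boundedI:
  fixes h :: "'a::euclidean_space \<Rightarrow> real"
  assumes "continuous_on UNIV h" "\<And>y. 0 < h y" "c > 0"
    and lo: "\<And>y. - C * (1 + (norm y)\<^sup>2) \<le> ln (h y)" and up: "\<And>y. ln (h y) \<le> C' - c * (norm y)\<^sup>2"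
  shows "gauss_bounded Basis h"
  unfolding gauss_bounded_def
proof (intro conjI assms(1) exI allI)
  define K where "K = \<bar>C\<bar> + \<bar>C'\<bar> + 1"
  show "K > 0" "c > 0" using assms(3) by (auto simp: K_def)
  fix y :: 'a
  have "C * (1 + (norm y)\<^sup>2) \<le> K * (1 + (norm y)\<^sup>2)" by (rule mult_right_mono) (auto simp: K_def)
  then have "- K * (1 + (norm y)\<^sup>2) \<le> ln (h y)" using lo[of y] by simp
  then show "exp (- K * (1 + (norm y)\<^sup>2)) \<le> h y"
    using assms(2)[of y] by (metis exp_le_cancel_iff exp_ln)
  have "ln (h y) \<le> K - c * (\<Sum>j\<in>Basis. (y \<bullet> j)\<^sup>2)" using up[of y] unfolding norm_square_eq_sum_Basis[symmetric] K_def by linarith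
  then show "h y \<le> exp (K - c * (\<Sum>j\<in>Basis. (y \<bullet> j)\<^sup>2))"
    using assms(2)[of y] by (metis exp_le_cancel_iff exp_ln)
qed

lemma ln_stdn_density: "ln (stdn_density (y::'a::euclidean_space)) = - (DIM('a) * ln (2 * pi)) / 2 - (norm y)\<^sup>2 / 2"
  unfolding stdn_density_eq by (subst ln_mult_pos) (auto simp: ln_powr)

text \<open>The lower bounds come from \<open>norm y \<le> norm x + d\<close> with
  \<open>d = norm (x - y)\<close> and a completed square in \<open>d\<close>. For continuity,
  \<open>|x|^2 / (2 * \<tau>) - Q f\<close> is a supremum of affine functions, hence a finite convex
  function on the whole space.\<close>

lemma hopf_lax_bounds:
  fixes f :: "real^'n \<Rightarrow> real"
  assumes f: "\<And>x. f x \<ge> - C * (1 + norm x)" and C: "C > 0" and \<tau>: "\<tau> > 0"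
  shows "f y + 1 / (2 * \<tau>) * (norm (x - y))\<^sup>2 \<ge> - C * (1 + norm x) - C\<^sup>2 * \<tau> / 2"
    and "hopf_lax \<tau> f x \<le> f y + 1 / (2 * \<tau>) * (norm (x - y))\<^sup>2"
    and "hopf_lax \<tau> f x \<ge> - C * (1 + norm x) - C\<^sup>2 * \<tau> / 2"
    and "continuous_on UNIV (hopf_lax \<tau> f)"
proof -
  show lo: "f y + 1 / (2 * \<tau>) * (norm (x - y))\<^sup>2 \<ge> - C * (1 + norm x) - C\<^sup>2 * \<tau> / 2" for x y
  proof -
    define d where "d = norm (x - y)"
    have "norm y \<le> norm x + d" unfolding d_def by (metis norm_minus_commute norm_triangle_sub add.commute)
    then have "C * norm y \<le> C * (norm x + d)" using C by simp
    moreover have "f y \<ge> - C - C * norm y" using f[of y] by (simp add: algebra_simps)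
    moreover have "C * d \<le> C\<^sup>2 * \<tau> / 2 + 1 / (2 * \<tau>) * d\<^sup>2"
    proof -
      have "0 \<le> (d - C * \<tau>)\<^sup>2 / (2 * \<tau>)" using \<tau> by simp
      also have "\<dots> = C\<^sup>2 * \<tau> / 2 + 1 / (2 * \<tau>) * d\<^sup>2 - C * d" using \<tau> by (simp add: power2_eq_square field_simps)
      finally show ?thesis by simp
    qed
    ultimately show ?thesis unfolding d_def by (simp add: algebra_simps)
  qed
  have bdd: "bdd_below (range (\<lambda>y. f y + 1 / (2 * \<tau>) * (norm (x - y))\<^sup>2))" for x
    by (rule bdd_belowI2, rule lo)
  show le: "hopf_lax \<tau> f x \<le> f y + 1 / (2 * \<tau>) * (norm (x - y))\<^sup>2" for x y
    unfolding hopf_lax_def by (rule cINF_lower[OF bdd]) simp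
  show "hopf_lax \<tau> f x \<ge> - C * (1 + norm x) - C\<^sup>2 * \<tau> / 2"
    unfolding hopf_lax_def by (rule cINF_greatest, simp, rule lo)
  define \<phi> where "\<phi> x = 1 / (2 * \<tau>) * (norm x)\<^sup>2 - hopf_lax \<tau> f x" for x
  \<comment> \<open>Affine in \<open>x\<close>: expanding the square shows that the quadratic part
    in \<open>x\<close> is common to all competitors \<open>y\<close>.\<close>
  define A where "A y x = (1 / \<tau>) * (x \<bullet> y) - 1 / (2 * \<tau>) * (norm y)\<^sup>2 - f y" for x y
  have exp: "f y + 1 / (2 * \<tau>) * (norm (x - y))\<^sup>2 = 1 / (2 * \<tau>) * (norm x)\<^sup>2 - A y x" for x y
    unfolding A_def power2_norm_eq_inner using \<tau>
    by (simp add: inner_diff_left inner_diff_right inner_commute field_simps)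
  have A\<phi>: "A y x \<le> \<phi> x" for x y using le[of x y] unfolding \<phi>_def exp by simp
  have "convex_on UNIV \<phi>"
  proof (rule convex_onI)
    fix u :: real and x w :: "real^'n" assume u: "0 < u" "u < 1"
    let ?m = "(1 - u) *\<^sub>R x + u *\<^sub>R w"
    have "1 / (2 * \<tau>) * (norm ?m)\<^sup>2 - ((1 - u) * \<phi> x + u * \<phi> w) \<le> hopf_lax \<tau> f ?m"
      unfolding hopf_lax_def
    proof (rule cINF_greatest)
      fix y
      have "A y ?m = (1 - u) * A y x + u * A y w"
      proof -
        have "?m \<bullet> y = (1 - u) * (x \<bullet> y) + u * (w \<bullet> y)" by (simp only: inner_add_left inner_scaleR_left)
        then show ?thesis unfolding A_def using \<tau> by (simp add: field_simps)
      qed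
      also have "\<dots> \<le> (1 - u) * \<phi> x + u * \<phi> w"
        using A\<phi> u by (intro add_mono mult_left_mono) auto
      finally show "1 / (2 * \<tau>) * (norm ?m)\<^sup>2 - ((1 - u) * \<phi> x + u * \<phi> w) \<le> f y + 1 / (2 * \<tau>) * (norm (?m - y))\<^sup>2"
        unfolding exp by simp
    qed simp
    then show "\<phi> ?m \<le> (1 - u) * \<phi> x + u * \<phi> w" unfolding \<phi>_def[of ?m] by simp
  qed simp
  then have "continuous_on UNIV \<phi>" by (rule convex_on_continuous[OF open_UNIV])
  then have "continuous_on UNIV (\<lambda>x. 1 / (2 * \<tau>) * (norm x)\<^sup>2 - \<phi> x)" by (intro continuous_intros)
  then show "continuous_on UNIV (hopf_lax \<tau> f)" by (simp add: \<phi>_def)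
qed

lemma DIM_vec: "DIM(real^'n) = CARD('n)" by simp

text \<open>The mean inequality and the Gaussian bounds are hypotheses here, so that the two halves
  of the theorem, which obtain them differently, share this argument.\<close>

lemma hopf_lax_core:
  fixes f :: "real^'n \<Rightarrow> real" and a \<tau> \<sigma> :: real
  assumes a: "a > 0" and \<tau>: "\<tau> > 0" and \<sigma>: "\<sigma> > 1"
    and C: "C > 0" and f: "\<And>x. f x \<ge> - C * (1 + norm x)"
    and v: "\<And>x. v x = exp (a * f x) * stdn_density x" and vb: "gauss_bounded Basis v"
    and mean: "\<And>\<xi> e. 0 < e \<Longrightarrow> e\<^sup>2 < \<sigma> \<Longrightarrow> ln (v \<xi>) + (norm \<xi>)\<^sup>2 / (2 * \<sigma>)
        \<le> (\<integral>g. ln (v (\<xi> + e *\<^sub>R g)) + (norm (\<xi> + e *\<^sub>R g))\<^sup>2 / (2 * \<sigma>) \<partial>stdn)"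
    and t: "t = \<tau> / (a + \<tau>)"
  shows "\<exists>mF mv. 0 < mF \<and> 0 < mv
     \<and> (\<integral>\<^sup>+x. ennreal (exp ((a + \<tau>) * hopf_lax \<tau> f x) * stdn_density x) \<partial>lborel) = ennreal mF
     \<and> (\<integral>\<^sup>+x. ennreal (v x) \<partial>lborel) = ennreal mv
     \<and> (1 - t) * ln mF + CARD('n) * ((1 - t) * ln ((1 - t) * \<sigma> / (\<sigma> - t)) + t * ln \<sigma>) / 2 \<le> ln mv"
proof -
  let ?n = "real CARD('n)"
  have t01: "0 < t" "t < 1" using a \<tau> by (auto simp: t field_simps)
  have t1: "1 - t = a / (a + \<tau>)" using a \<tau> by (simp add: t field_simps)
  have at: "(1 - t) * (a + \<tau>) = a" using a \<tau> by (simp add: t1)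
  have at2: "a / \<tau> = (1 - t) / t" using a \<tau> unfolding t1 by (simp add: t)
  have \<sigma>t: "\<sigma> - t > 0" using \<sigma> t01 by simp
  \<comment> \<open>All parameters are dictated by \<open>v = gauss \<sigma>\<close>. There
    \<open>f\<close> is quadratic, the infimum in the Hopf--Lax formula at \<open>z\<close> is
    attained at \<open>cc * z\<close>, and \<open>T\<close> is linear with slope
    \<open>rs / c\<close>. Equality requires that \<open>(1 - t) * T x + b * x\<close> be this
    minimiser for \<open>z = T x\<close> and that adding \<open>e * g\<close> give \<open>rs\<close>
    times \<open>p = c * x + s * g\<close>, a variable with density
    \<open>gauss \<sigma>\<close>.\<close>
  define cc where "cc = (1 - t) * \<sigma> / (\<sigma> - t)"
  define ss where "ss = t * (\<sigma> - 1) / (\<sigma> - t)"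
  have ccp: "cc > 0" and ssp: "ss > 0" unfolding cc_def ss_def using t01 \<sigma> \<sigma>t by auto
  have ccss: "cc + ss = 1" unfolding cc_def ss_def using \<sigma>t by (simp add: add_divide_distrib[symmetric] algebra_simps)
  define c where "c = sqrt cc"
  define s where "s = sqrt ss"
  define rs where "rs = sqrt \<sigma>"
  have c: "c > 0" "c\<^sup>2 = cc" and s: "s > 0" "s\<^sup>2 = ss" and rs: "rs > 0" "rs\<^sup>2 = \<sigma>"
    using ccp ssp \<sigma> by (auto simp: c_def s_def rs_def)
  define b where "b = t * c / rs"
  define e where "e = rs * s"
  have bq: "b\<^sup>2 = t\<^sup>2 * cc / \<sigma>" using rs c by (simp add: b_def power_mult_distrib power_divide)
  have eq: "e\<^sup>2 = \<sigma> * ss" using rs s by (simp add: e_def power_mult_distrib)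
  have e: "0 < e" "e\<^sup>2 < \<sigma>" using rs s ccp ccss \<sigma> unfolding eq by (auto simp: e_def)
  \<comment> \<open>The one identity between the parameters. It gives both \<open>L = t * rs\<close>
    and, further down, \<open>q = (t - ss) / 2\<close>.\<close>
  have tcs: "t * cc / \<sigma> + ss = t"
    unfolding cc_def ss_def using \<sigma>t \<sigma> by (simp add: divide_simps) (simp add: algebra_simps)
  have L: "b * c + e * s = t * rs"
  proof -
    have "b * c + e * s = (t * cc / \<sigma> + ss) * rs"
      using rs by (simp add: b_def e_def c(2)[symmetric] s(2)[symmetric] rs(2)[symmetric] power2_eq_square field_simps)
    then show ?thesis using tcs by simp
  qed
  define q where "q = b\<^sup>2 / (2 * t)"
  \<comment> \<open>Per coordinate, \<open>ss / 2\<close> equals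
    \<open>e^2 / (2 * \<sigma>)\<close>, the cost of adding the noise to
    \<open>|\<xi>|^2 / (2 * \<sigma>)\<close>. The other term collects the normalising factors of
    the two Gaussian densities, which enter with weights \<open>1\<close> and
    \<open>1 - t\<close>.\<close>
  define \<kappa> where "\<kappa> = ss / 2 + t / 2 * ln (2 * pi)"
  define F where "F x = exp ((a + \<tau>) * hopf_lax \<tau> f x) * stdn_density x" for x
  note HL = hopf_lax_bounds[OF f C \<tau>]
  have Fpos: "F x > 0" for x unfolding F_def using stdn_density_pos[of x] by simp
  have lnF: "ln (F x) = (a + \<tau>) * hopf_lax \<tau> f x - ?n * ln (2 * pi) / 2 - (norm x)\<^sup>2 / 2" for x
    unfolding F_def using stdn_density_pos[of x] by (simp add: ln_mult_pos ln_stdn_density)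
  have lnv: "ln (v x) = a * f x - ?n * ln (2 * pi) / 2 - (norm x)\<^sup>2 / 2" for x
    unfolding v using stdn_density_pos[of x] by (simp add: ln_mult_pos ln_stdn_density)
  \<comment> \<open>Since \<open>a = (1 - t) * (a + \<tau>)\<close>, multiplying the Hopf--Lax bound
    by \<open>a\<close> matches the powers in \<open>F\<close> and \<open>v\<close>. The two
    Gaussian densities complete its cost to a square centred at \<open>(1 - t) z\<close>.\<close>
  have pw: "(1 - t) * ln (F z) - (norm (\<xi> - (1 - t) *\<^sub>R z))\<^sup>2 / (2 * t) - t * ?n * ln (2 * pi) / 2 \<le> ln (v \<xi>)" for z \<xi>
  proof -
    have "(1 - t) * ln (F z) = a * hopf_lax \<tau> f z - (1 - t) * (?n * ln (2 * pi) / 2) - (1 - t) * ((norm z)\<^sup>2 / 2)"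
      unfolding lnF by (simp add: right_diff_distrib at mult.assoc[symmetric])
    also have "a * hopf_lax \<tau> f z \<le> a * f \<xi> + (1 - t) / (2 * t) * (norm (z - \<xi>))\<^sup>2"
    proof -
      have "a * hopf_lax \<tau> f z \<le> a * (f \<xi> + 1 / (2 * \<tau>) * (norm (z - \<xi>))\<^sup>2)"
        using HL(2)[of z \<xi>] a by simp
      also have "\<dots> = a * f \<xi> + (a / \<tau>) / 2 * (norm (z - \<xi>))\<^sup>2" by (simp add: algebra_simps)
      finally show ?thesis unfolding at2 by simp
    qed
    finally have 1: "(1 - t) * ln (F z) \<le> a * f \<xi> + (1 - t) / (2 * t) * (norm (z - \<xi>))\<^sup>2 - (1 - t) * (?n * ln (2 * pi) / 2) - (1 - t) * ((norm z)\<^sup>2 / 2)"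
      by simp
    have 2: "(1 - t) / (2 * t) * (norm (z - \<xi>))\<^sup>2 - (1 - t) * ((norm z)\<^sup>2 / 2) = (norm (\<xi> - (1 - t) *\<^sub>R z))\<^sup>2 / (2 * t) - (norm \<xi>)\<^sup>2 / 2"
    proof -
      have e1: "(norm (z - \<xi>))\<^sup>2 = z \<bullet> z - 2 * (\<xi> \<bullet> z) + \<xi> \<bullet> \<xi>"
        unfolding power2_norm_eq_inner by (simp add: inner_diff_left inner_diff_right inner_commute)
      have e2: "(norm (\<xi> - (1 - t) *\<^sub>R z))\<^sup>2 = \<xi> \<bullet> \<xi> - 2 * ((1 - t) * (\<xi> \<bullet> z)) + (1 - t) * ((1 - t) * (z \<bullet> z))"
        unfolding power2_norm_eq_inner
        by (simp only: inner_diff_left inner_diff_right inner_scaleR_left inner_scaleR_right inner_commute[of z \<xi>])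
          (simp add: algebra_simps)
      have e3: "(norm z)\<^sup>2 = z \<bullet> z" "(norm \<xi>)\<^sup>2 = \<xi> \<bullet> \<xi>" by (simp_all add: power2_norm_eq_inner)
      show ?thesis unfolding e1 e2 e3 using t01 by (simp add: field_simps)
    qed
    have 3: "(1 - t) * (?n * ln (2 * pi) / 2) = ?n * ln (2 * pi) / 2 - t * ?n * ln (2 * pi) / 2"
      by (simp add: left_diff_distrib)
    from 1 2 3 show ?thesis unfolding lnv by linarith
  qed
  have Fc: "continuous_on UNIV F" unfolding F_def stdn_density_eq
    by (intro continuous_intros HL(4)) auto
  obtain Kv cv where Kv: "cv > 0" "\<And>y. v y \<le> exp (Kv - cv * (\<Sum>j\<in>Basis. (y \<bullet> j)\<^sup>2))"
    using vb unfolding gauss_bounded_def by blast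
  have Fb: "gauss_bounded Basis F"
  proof (rule gauss_boundedI[OF Fc Fpos])
    show "cv * (1 - t) > 0" using Kv t01 by simp
    \<comment> \<open>The choice \<open>\<xi> = (1 - t) z\<close> makes the cost in
      \<open>pw\<close> vanish, so \<open>F\<close> inherits Gaussian decay from
      \<open>v\<close>.\<close>
    show "ln (F z) \<le> (Kv + t * ?n * ln (2 * pi) / 2) / (1 - t) - cv * (1 - t) * (norm z)\<^sup>2" for z
    proof -
      have "(1 - t) * ln (F z) \<le> ln (v ((1 - t) *\<^sub>R z)) + t * ?n * ln (2 * pi) / 2" using pw[of z "(1 - t) *\<^sub>R z"] by simp
      also have "ln (v ((1 - t) *\<^sub>R z)) \<le> Kv - cv * (norm ((1 - t) *\<^sub>R z))\<^sup>2"
        using ln_mono[OF Kv(2)[of "(1 - t) *\<^sub>R z"] gauss_bounded_pos[OF vb]] unfolding norm_square_eq_sum_Basis by simp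
      finally have "(1 - t) * ln (F z) \<le> (Kv + t * ?n * ln (2 * pi) / 2) - cv * (1 - t)\<^sup>2 * (norm z)\<^sup>2"
        by (simp add: power_mult_distrib)
      also have "\<dots> = (1 - t) * ((Kv + t * ?n * ln (2 * pi) / 2) / (1 - t) - cv * (1 - t) * (norm z)\<^sup>2)"
        using t01 by (simp add: power2_eq_square field_simps)
      finally show ?thesis using t01 by simp
    qed
    define K where "K = (a + \<tau>) * (2 * C + C\<^sup>2 * \<tau> / 2) + ?n * ln (2 * pi) / 2 + 1 / 2"
    show "- K * (1 + (norm z)\<^sup>2) \<le> ln (F z)" for z
    proof -
      have l2: "ln (2 * pi) > 0" using pi_gt3 by simp
      have "hopf_lax \<tau> f z \<ge> - C * (1 + norm z) - C\<^sup>2 * \<tau> / 2" by (rule HL(3))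
      moreover have "C * norm z \<le> C * (1 + (norm z)\<^sup>2)" using norm_le_one_add_square[of z] C by simp
      moreover have "C\<^sup>2 * \<tau> / 2 * 1 \<le> C\<^sup>2 * \<tau> / 2 * (1 + (norm z)\<^sup>2)" using \<tau> by (intro mult_left_mono) auto
      moreover have "C * 1 \<le> C * (1 + (norm z)\<^sup>2)" using C by (intro mult_left_mono) auto
      moreover have "(2 * C + C\<^sup>2 * \<tau> / 2) * (1 + (norm z)\<^sup>2) = C * (1 + (norm z)\<^sup>2) + C * (1 + (norm z)\<^sup>2) + C\<^sup>2 * \<tau> / 2 * (1 + (norm z)\<^sup>2)"
        by (simp only: distrib_right mult_2)
      moreover have "- C * (1 + norm z) = - (C * 1) - C * norm z" by (simp add: algebra_simps)
      ultimately have "- ((2 * C + C\<^sup>2 * \<tau> / 2) * (1 + (norm z)\<^sup>2)) \<le> hopf_lax \<tau> f z" by linarith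
      from mult_left_mono[OF this, of "a + \<tau>"] a \<tau>
      have "- ((a + \<tau>) * (2 * C + C\<^sup>2 * \<tau> / 2) * (1 + (norm z)\<^sup>2)) \<le> (a + \<tau>) * hopf_lax \<tau> f z" by (simp add: mult.assoc)
      moreover have "?n * ln (2 * pi) / 2 * 1 \<le> ?n * ln (2 * pi) / 2 * (1 + (norm z)\<^sup>2)" using l2 by (intro mult_left_mono) auto
      moreover have "(norm z)\<^sup>2 / 2 \<le> 1 / 2 * (1 + (norm z)\<^sup>2)" by simp
      moreover have "K * (1 + (norm z)\<^sup>2) = (a + \<tau>) * (2 * C + C\<^sup>2 * \<tau> / 2) * (1 + (norm z)\<^sup>2) + ?n * ln (2 * pi) / 2 * (1 + (norm z)\<^sup>2) + 1 / 2 * (1 + (norm z)\<^sup>2)"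
        unfolding K_def by (simp only: distrib_right)
      ultimately show ?thesis unfolding lnF mult_minus_left by linarith
    qed
  qed
  have lnvi: "integrable stdn (\<lambda>g. ln (v (\<xi> + e *\<^sub>R g)))" for \<xi>
    by (rule integrable_stdn_ln_gauss_bounded[OF vb])
  have hyp: "(1 - t) * ln (F z) - q * (norm x)\<^sup>2 - DIM(real^'n) * \<kappa>
      \<le> (\<integral>g. ln (v ((1 - t) *\<^sub>R z + b *\<^sub>R x + e *\<^sub>R g)) \<partial>stdn)" for z x
  proof -
    define \<xi> where "\<xi> = (1 - t) *\<^sub>R z + b *\<^sub>R x"
    have "ln (v \<xi>) + (norm \<xi>)\<^sup>2 / (2 * \<sigma>) \<le> (\<integral>g. ln (v (\<xi> + e *\<^sub>R g)) + (norm (\<xi> + e *\<^sub>R g))\<^sup>2 / (2 * \<sigma>) \<partial>stdn)"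
      by (rule mean[OF e])
    also have "\<dots> = (\<integral>g. ln (v (\<xi> + e *\<^sub>R g)) \<partial>stdn) + ((norm \<xi>)\<^sup>2 + e\<^sup>2 * ?n) / (2 * \<sigma>)"
      by (subst Bochner_Integration.integral_add[OF lnvi]) (use stdn_moments[of \<xi> e] in auto)
    also have "((norm \<xi>)\<^sup>2 + e\<^sup>2 * ?n) / (2 * \<sigma>) = (norm \<xi>)\<^sup>2 / (2 * \<sigma>) + ss * ?n / 2"
      unfolding eq using \<sigma> by (simp add: field_simps)
    finally have 1: "ln (v \<xi>) - ss * ?n / 2 \<le> (\<integral>g. ln (v (\<xi> + e *\<^sub>R g)) \<partial>stdn)"
      by linarith
    have "(norm (\<xi> - (1 - t) *\<^sub>R z))\<^sup>2 / (2 * t) = q * (norm x)\<^sup>2" by (simp add: \<xi>_def q_def power_mult_distrib)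
    with pw[of z \<xi>] have "(1 - t) * ln (F z) - q * (norm x)\<^sup>2 - t * ?n * ln (2 * pi) / 2 \<le> ln (v \<xi>)" by simp
    with 1 show ?thesis unfolding \<xi>_def \<kappa>_def by (simp add: algebra_simps)
  qed
  have cs: "c\<^sup>2 + s\<^sup>2 = 1" using c s ccss by simp
  have Lp: "t * rs > 0" using t01 rs by simp
  from gauss_bounded_transport[OF vb Fb t01 c(1) cs L[symmetric] Lp hyp]
  obtain mF mv where m: "0 < mF" "0 < mv" "(\<integral>\<^sup>+x. ennreal (F x) \<partial>lborel) = ennreal mF" "(\<integral>\<^sup>+x. ennreal (v x) \<partial>lborel) = ennreal mv"
    "(1 - t) * ln mF + DIM(real^'n) * ((1 - t) * ln c + t * ln (t * rs / t) + t * (ln (2 * pi) + 1) / 2 - q - \<kappa>) \<le> ln mv"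
    by blast
  \<comment> \<open>The terms with \<open>ln (2 * pi)\<close> cancel, and
    \<open>t / 2 - q - ss / 2\<close> is zero by \<open>tcs\<close>.\<close>
  have "(1 - t) * ln c + t * ln (t * rs / t) + t * (ln (2 * pi) + 1) / 2 - q - \<kappa> = ((1 - t) * ln cc + t * ln \<sigma>) / 2"
  proof -
    have 1: "ln c = ln cc / 2" using ccp by (simp add: c_def ln_sqrt)
    have 2: "ln (t * rs / t) = ln \<sigma> / 2" using t01 \<sigma> by (simp add: rs_def ln_sqrt)
    have "q = t * cc / \<sigma> / 2" using t01 unfolding q_def bq by (simp add: power2_eq_square)
    then have "q = (t - ss) / 2" using tcs by simp
    then show ?thesis unfolding 1 2 \<kappa>_def by (simp add: field_simps)
  qed
  note K0 = this
  have "(1 - t) * ln mF + CARD('n) * ((1 - t) * ln cc + t * ln \<sigma>) / 2 \<le> ln mv"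
    using m(5) unfolding K0 DIM_vec by linarith
  then show ?thesis using m(1-4) unfolding F_def cc_def by blast
qed

section \<open>Gaussian norms and the extremal Gaussian\<close>

lemma gauss_eq_stdn_density: "gauss 1 x = stdn_density x"
  by (simp add: gauss_def stdn_density_eq)

lemma gauss_measure_eq_stdn: "gauss_measure = stdn"
  by (simp add: gauss_measure_def stdn_def gauss_eq_stdn_density)

lemma gauss_pos: "\<alpha> > 0 \<Longrightarrow> gauss \<alpha> x > 0"
  by (simp add: gauss_def)

lemma nn_integral_exp_gauss_measure:
  fixes h :: "real^'n \<Rightarrow> real"
  assumes "continuous_on UNIV h"
  shows "(\<integral>\<^sup>+x. ennreal (\<bar>exp (h x)\<bar> powr r) \<partial>gauss_measure) = (\<integral>\<^sup>+x. ennreal (exp (r * h x) * stdn_density x) \<partial>lborel)"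
proof -
  have [measurable]: "h \<in> borel_measurable borel" using assms by (rule borel_measurable_continuous_onI)
  have "(\<integral>\<^sup>+x. ennreal (\<bar>exp (h x)\<bar> powr r) \<partial>gauss_measure) = (\<integral>\<^sup>+x. ennreal (stdn_density x) * ennreal (\<bar>exp (h x)\<bar> powr r) \<partial>lborel)"
    unfolding gauss_measure_eq_stdn by (subst nn_integral_stdn) auto
  also have "\<dots> = (\<integral>\<^sup>+x. ennreal (exp (r * h x) * stdn_density x) \<partial>lborel)"
  proof (intro nn_integral_cong)
    fix x :: "real^'n"
    have "0 \<le> stdn_density x" by (rule less_imp_le[OF stdn_density_pos])
    then show "ennreal (stdn_density x) * ennreal (\<bar>exp (h x)\<bar> powr r) = ennreal (exp (r * h x) * stdn_density x)"
      by (simp add: powr_def ennreal_mult[symmetric] mult.commute)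
  qed
  finally show ?thesis .
qed

lemma gauss_norm_le:
  assumes "(\<integral>\<^sup>+x. ennreal (\<bar>g x\<bar> powr r) \<partial>gauss_measure) \<le> ennreal m" "0 \<le> m" "r > 0"
  shows "gauss_norm r g \<le> ennreal (m powr (1 / r))"
proof -
  let ?I = "\<integral>\<^sup>+x. ennreal (\<bar>g x\<bar> powr r) \<partial>gauss_measure"
  have "?I \<noteq> \<infinity>" using assms(1) by (auto simp: top_unique)
  moreover have "enn2real ?I \<le> m" using assms(1,2) by (metis enn2real_ennreal enn2real_mono ennreal_less_top)
  ultimately show ?thesis unfolding gauss_norm_def using assms(3)
    by (simp add: Let_def powr_mono2 ennreal_leI)
qed

lemma gauss_norm_ge:
  assumes "ennreal m \<le> (\<integral>\<^sup>+x. ennreal (\<bar>g x\<bar> powr r) \<partial>gauss_measure)" "0 \<le> m" "r > 0"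
  shows "ennreal (m powr (1 / r)) \<le> gauss_norm r g"
proof (cases "(\<integral>\<^sup>+x. ennreal (\<bar>g x\<bar> powr r) \<partial>gauss_measure) = \<infinity>")
  case True
  then show ?thesis by (simp add: gauss_norm_def)
next
  case False
  let ?I = "\<integral>\<^sup>+x. ennreal (\<bar>g x\<bar> powr r) \<partial>gauss_measure"
  have "m \<le> enn2real ?I" using assms(1,2) False
    by (metis enn2real_ennreal enn2real_mono infinity_ennreal_def less_top)
  then show ?thesis unfolding gauss_norm_def using assms(2,3) False
    by (simp add: Let_def powr_mono2 ennreal_leI)
qed

lemma ln_gauss: "\<alpha> > 0 \<Longrightarrow> ln (gauss \<alpha> (y::real^'n)) = - (CARD('n) * ln (2 * pi * \<alpha>)) / 2 - (norm y)\<^sup>2 / (2 * \<alpha>)"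
  unfolding gauss_def by (subst ln_mult_pos) (auto simp: ln_powr)

text \<open>The dimension-free constant attained by \<open>v = gauss \<sigma>\<close>; the optimal rotation has
  \<open>c^2 = (1 - t) * \<sigma> / (\<sigma> - t)\<close>.\<close>

definition gain :: "real \<Rightarrow> real \<Rightarrow> real" where
  "gain t \<sigma> = ((1 - t) * ln ((1 - t) * \<sigma> / (\<sigma> - t)) + t * ln \<sigma>) / 2"

text \<open>A lower bound suffices, because this norm stands on the larger side of the theorem. The
  potential is quadratic with coefficient \<open>k / 2\<close>; completing the square bounds its
  Hopf--Lax transform below by a quadratic with coefficient \<open>k / (1 + k * \<tau>) / 2\<close>,
  and the remaining integral is Gaussian.\<close>

lemma gaussian_extremizer_norm:
  assumes a: "a > 0" and \<tau>: "\<tau> > 0" and \<sigma>: "\<sigma> > 1" and t: "t = \<tau> / (a + \<tau>)"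
  shows "ennreal (exp (- (CARD('n) * gain t \<sigma>) / a))
     \<le> gauss_norm (a + \<tau>) (\<lambda>x. exp (hopf_lax \<tau> (\<lambda>y :: real^'n. 1 / a * ln (gauss \<sigma> y / gauss 1 y)) x))"
proof -
  let ?n = "real CARD('n)"
  have t01: "0 < t" "t < 1" using a \<tau> by (auto simp: t field_simps)
  have t1: "1 - t = a / (a + \<tau>)" using a \<tau> by (simp add: t field_simps)
  have \<sigma>t: "\<sigma> - t > 0" using \<sigma> t01 by simp
  define f where "f y = 1 / a * ln (gauss \<sigma> y / gauss 1 y)" for y :: "real^'n"
  define k where "k = (1 - 1 / \<sigma>) / a"
  have k: "k > 0" using a \<sigma> by (simp add: k_def)
  have feq: "f y = - (?n * ln \<sigma>) / (2 * a) + k / 2 * (norm y)\<^sup>2" for y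
  proof -
    have "ln (gauss \<sigma> y / gauss 1 y) = ln (gauss \<sigma> y) - ln (gauss 1 y)"
      using gauss_pos[of \<sigma> y] gauss_pos[of 1 y] \<sigma> by (simp add: ln_div)
    also have "\<dots> = - (?n * ln \<sigma>) / 2 + (1 - 1 / \<sigma>) / 2 * (norm y)\<^sup>2"
      using \<sigma> by (simp add: ln_gauss ln_mult_pos field_simps)
    finally have e: "ln (gauss \<sigma> y / gauss 1 y) = - (?n * ln \<sigma>) / 2 + (1 - 1 / \<sigma>) / 2 * (norm y)\<^sup>2" .
    show ?thesis unfolding f_def k_def e using a \<sigma> by (simp add: field_simps)
  qed
  have kt: "1 + k * \<tau> > 0" using k \<tau> by (simp add: add_pos_pos)
  have hl: "- (?n * ln \<sigma>) / (2 * a) + k / (1 + k * \<tau>) / 2 * (norm x)\<^sup>2 \<le> hopf_lax \<tau> f x" for x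
    unfolding hopf_lax_def
  proof (rule cINF_greatest)
    fix y
    have "k / 2 * (norm y)\<^sup>2 + 1 / (2 * \<tau>) * (norm (x - y))\<^sup>2 - k / (1 + k * \<tau>) / 2 * (norm x)\<^sup>2
       = (norm ((1 + k * \<tau>) *\<^sub>R y - x))\<^sup>2 / (2 * \<tau> * (1 + k * \<tau>))"
    proof -
      define K where "K = 1 + k * \<tau>"
      have K: "K > 0" "k = (K - 1) / \<tau>" using kt \<tau> by (auto simp: K_def)
      have e1: "(norm (x - y))\<^sup>2 = x \<bullet> x - 2 * (x \<bullet> y) + y \<bullet> y"
        unfolding power2_norm_eq_inner by (simp add: inner_diff_left inner_diff_right inner_commute)
      have e2: "(norm (K *\<^sub>R y - x))\<^sup>2 = K * (K * (y \<bullet> y)) - 2 * (K * (x \<bullet> y)) + x \<bullet> x"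
        unfolding power2_norm_eq_inner
        by (simp add: inner_diff_left inner_diff_right inner_commute)
      have e3: "(norm x)\<^sup>2 = x \<bullet> x" "(norm y)\<^sup>2 = y \<bullet> y" by (simp_all add: power2_norm_eq_inner)
      show ?thesis unfolding K_def[symmetric] unfolding e1 e2 e3 unfolding K(2) using K(1) \<tau>
        by (simp add: field_simps)
    qed
    moreover have "\<dots> \<ge> 0" using \<tau> kt by simp
    ultimately show "- (?n * ln \<sigma>) / (2 * a) + k / (1 + k * \<tau>) / 2 * (norm x)\<^sup>2 \<le> f y + 1 / (2 * \<tau>) * (norm (x - y))\<^sup>2"
      unfolding feq by linarith
  qed simp
  \<comment> \<open>The inverse variance of that remaining Gaussian, as \<open>wk\<close> shows. Its
    positivity makes the integral finite and equal to \<open>E\<close> divided by the appropriate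
    power of \<open>sqrt w\<close>.\<close>
  define w where "w = (1 - t) / (\<sigma> - t)"
  have w: "w > 0" using t01 \<sigma>t by (simp add: w_def)
  have wk: "1 - (a + \<tau>) * (k / (1 + k * \<tau>)) = w"
  proof -
    have at: "a * \<sigma> > 0" using a \<sigma> by simp
    define D where "D = a * \<sigma> + (\<sigma> - 1) * \<tau>"
    have D: "D > 0" using at \<sigma> \<tau> by (simp add: D_def add_pos_pos)
    have k': "k = (\<sigma> - 1) / (a * \<sigma>)" unfolding k_def using a \<sigma> by (simp add: field_simps)
    have "1 + k * \<tau> = D / (a * \<sigma>)" unfolding k' D_def using at a \<sigma> by (simp add: add_divide_distrib)
    then have kD: "k / (1 + k * \<tau>) = (\<sigma> - 1) / D" unfolding k' using at a \<sigma> by simp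
    have "1 - (a + \<tau>) * (k / (1 + k * \<tau>)) = (D - (a + \<tau>) * (\<sigma> - 1)) / D"
      unfolding kD using D by (simp only: diff_divide_distrib[of D] divide_self[OF less_imp_neq[OF D, symmetric]] times_divide_eq_right)
    also have "D - (a + \<tau>) * (\<sigma> - 1) = a" by (simp add: D_def algebra_simps)
    finally have "1 - (a + \<tau>) * (k / (1 + k * \<tau>)) = a / D" .
    also have "\<dots> = w"
    proof -
      have "\<sigma> - t = D / (a + \<tau>)" unfolding D_def using a \<tau> by (simp add: t field_simps)
      then show ?thesis unfolding w_def t1 using a \<tau> D by simp
    qed
    finally show ?thesis .
  qed
  define r where "r = sqrt w"
  have r: "r > 0" "r\<^sup>2 = w" using w by (auto simp: r_def)
  define E where "E = exp (- (?n * ln \<sigma>) * (a + \<tau>) / (2 * a))"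
  have "(\<integral>\<^sup>+(x::real^'n). ennreal (stdn_density x) \<partial>lborel) = 1"
    using prob_space.emeasure_space_1[OF prob_space_stdn[where ?'a="real^'n"]]
    by (simp add: stdn_def emeasure_density)
  then have i1: "ennreal (r ^ CARD('n)) * (\<integral>\<^sup>+(x::real^'n). ennreal (stdn_density (r *\<^sub>R x)) \<partial>lborel) = 1"
    using nn_integral_lborel_affine[of "\<lambda>x::real^'n. ennreal (stdn_density x)" r 0] r by simp
  have i2: "(\<integral>\<^sup>+(x::real^'n). ennreal (stdn_density (r *\<^sub>R x)) \<partial>lborel) = ennreal (1 / r ^ CARD('n))"
  proof -
    have "ennreal (1 / r ^ CARD('n)) * (ennreal (r ^ CARD('n)) * (\<integral>\<^sup>+(x::real^'n). ennreal (stdn_density (r *\<^sub>R x)) \<partial>lborel)) = ennreal (1 / r ^ CARD('n))"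
      unfolding i1 by simp
    then show ?thesis using r by (simp add: mult.assoc[symmetric] ennreal_mult[symmetric])
  qed
  have "ennreal (E / r ^ CARD('n)) = ennreal E * ennreal (1 / r ^ CARD('n))"
    using r by (subst ennreal_mult[symmetric]) (auto simp: E_def)
  also have "\<dots> = (\<integral>\<^sup>+(x::real^'n). ennreal E * ennreal (stdn_density (r *\<^sub>R x)) \<partial>lborel)"
    unfolding i2[symmetric] by (rule nn_integral_cmult[symmetric]) simp
  also have "\<dots> = (\<integral>\<^sup>+(x::real^'n). ennreal (exp ((a + \<tau>) * (- (?n * ln \<sigma>) / (2 * a) + k / (1 + k * \<tau>) / 2 * (norm x)\<^sup>2)) * stdn_density x) \<partial>lborel)"
  proof (intro nn_integral_cong)
    fix x :: "real^'n"
    have "exp ((a + \<tau>) * (- (?n * ln \<sigma>) / (2 * a) + k / (1 + k * \<tau>) / 2 * (norm x)\<^sup>2)) * exp (- (norm x)\<^sup>2 / 2)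
      = E * exp (- (norm (r *\<^sub>R x))\<^sup>2 / 2)"
    proof -
      have "(norm (r *\<^sub>R x))\<^sup>2 = w * (norm x)\<^sup>2" using r by (simp add: power_mult_distrib)
      also have "\<dots> = (norm x)\<^sup>2 - (a + \<tau>) * (k / (1 + k * \<tau>)) * (norm x)\<^sup>2"
        unfolding wk[symmetric] by (simp add: left_diff_distrib)
      finally have nr: "(norm (r *\<^sub>R x))\<^sup>2 = (norm x)\<^sup>2 - (a + \<tau>) * (k / (1 + k * \<tau>)) * (norm x)\<^sup>2" .
      define P k' where "P = - (?n * ln \<sigma>) / (2 * a)" and "k' = k / (1 + k * \<tau>)"
      have EP: "E = exp (P * (a + \<tau>))" unfolding E_def P_def by simp
      have "(a + \<tau>) * (P + k' / 2 * (norm x)\<^sup>2) + - (norm x)\<^sup>2 / 2 = P * (a + \<tau>) + - ((norm x)\<^sup>2 - (a + \<tau>) * k' * (norm x)\<^sup>2) / 2"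
        by (simp add: field_simps)
      then show ?thesis unfolding EP nr P_def[symmetric] k'_def[symmetric] exp_add[symmetric] by simp
    qed
    then have "E * stdn_density (r *\<^sub>R x) = exp ((a + \<tau>) * (- (?n * ln \<sigma>) / (2 * a) + k / (1 + k * \<tau>) / 2 * (norm x)\<^sup>2)) * stdn_density x"
      unfolding stdn_density_eq mult.left_commute[of E] mult.left_commute[of "exp ((a + \<tau>) * _)"] by simp
    moreover have "0 \<le> E" "0 \<le> stdn_density (r *\<^sub>R x)" using stdn_density_pos[of "r *\<^sub>R x"] by (auto simp: E_def)
    ultimately show "ennreal E * ennreal (stdn_density (r *\<^sub>R x)) = ennreal (exp ((a + \<tau>) * (- (?n * ln \<sigma>) / (2 * a) + k / (1 + k * \<tau>) / 2 * (norm x)\<^sup>2)) * stdn_density x)"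
      by (simp add: ennreal_mult[symmetric])
  qed
  also have "\<dots> = (\<integral>\<^sup>+(x::real^'n). ennreal (\<bar>exp (- (?n * ln \<sigma>) / (2 * a) + k / (1 + k * \<tau>) / 2 * (norm x)\<^sup>2)\<bar> powr (a + \<tau>)) \<partial>gauss_measure)"
    by (rule nn_integral_exp_gauss_measure[symmetric]) (intro continuous_intros)
  also have "\<dots> \<le> (\<integral>\<^sup>+(x::real^'n). ennreal (\<bar>exp (hopf_lax \<tau> f x)\<bar> powr (a + \<tau>)) \<partial>gauss_measure)"
    using hl a \<tau> by (intro nn_integral_mono ennreal_leI powr_mono2) auto
  finally have "ennreal ((E / r ^ CARD('n)) powr (1 / (a + \<tau>))) \<le> gauss_norm (a + \<tau>) (\<lambda>x. exp (hopf_lax \<tau> f x))"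
    by (rule gauss_norm_ge) (use r a \<tau> in \<open>auto simp: E_def\<close>)
  moreover have "(E / r ^ CARD('n)) powr (1 / (a + \<tau>)) = exp (- (?n * gain t \<sigma>) / a)"
  proof -
    have "ln (E / r ^ CARD('n)) = ln E - ln (r ^ CARD('n))" using r by (simp add: E_def ln_div)
    also have "\<dots> = - (?n * ln \<sigma>) * (a + \<tau>) / (2 * a) - ?n * (ln w / 2)"
      using r w by (simp add: E_def ln_realpow r_def ln_sqrt)
    finally have l: "ln (E / r ^ CARD('n)) = - (?n * ln \<sigma>) * (a + \<tau>) / (2 * a) - ?n * (ln w / 2)" .
    have lw: "ln ((1 - t) * \<sigma> / (\<sigma> - t)) = ln w + ln \<sigma>"
    proof -
      have "(1 - t) * \<sigma> / (\<sigma> - t) = w * \<sigma>" by (simp add: w_def)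
      then show ?thesis using w \<sigma> by (simp add: ln_mult_pos)
    qed
    have g: "gain t \<sigma> = (a / (a + \<tau>) * ln w + ln \<sigma>) / 2"
      unfolding gain_def lw t1[symmetric] by (simp add: algebra_simps)
    have "1 / (a + \<tau>) * ln (E / r ^ CARD('n)) = - (?n * gain t \<sigma>) / a"
      unfolding l g using a \<tau> by (simp add: divide_simps) (simp add: algebra_simps)
    then show ?thesis using r by (simp add: powr_def E_def)
  qed
  ultimately show ?thesis unfolding f_def by simp
qed

text \<open>Takes the root of order \<open>a + \<tau>\<close> of a mass bound. As
  \<open>(1 - t) * (a + \<tau>) = a\<close>, the mass \<open>m\<close> appears with exponent
  \<open>1 / a\<close>, which is the norm of \<open>exp f\<close>, and the rest is the bound for the
  extremizer.\<close>

lemma gauss_norm_combine: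
  fixes f :: "real^'n \<Rightarrow> real"
  assumes a: "a > 0" and \<tau>: "\<tau> > 0" and \<sigma>: "\<sigma> > 1" and t: "t = \<tau> / (a + \<tau>)"
    and fc: "continuous_on UNIV f" and hc: "continuous_on UNIV (hopf_lax \<tau> f)" and m: "m > 0"
    and mv: "(\<integral>\<^sup>+x. ennreal (exp (a * f x) * stdn_density x) \<partial>lborel) = ennreal m"
    and mF: "(\<integral>\<^sup>+x. ennreal (exp ((a + \<tau>) * hopf_lax \<tau> f x) * stdn_density x) \<partial>lborel)
       \<le> ennreal (exp ((ln m - CARD('n) * gain t \<sigma>) / (1 - t)))"
  shows "gauss_norm (a + \<tau>) (\<lambda>x. exp (hopf_lax \<tau> f x))
     \<le> gauss_norm (a + \<tau>) (\<lambda>x. exp (hopf_lax \<tau> (\<lambda>y :: real^'n. 1 / a * ln (gauss \<sigma> y / gauss 1 y)) x))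
       * gauss_norm a (\<lambda>x. exp (f x))"
proof -
  let ?n = "real CARD('n)"
  have t1: "1 - t = a / (a + \<tau>)" using a \<tau> by (simp add: t field_simps)
  have "gauss_norm (a + \<tau>) (\<lambda>x. exp (hopf_lax \<tau> f x)) \<le> ennreal (exp ((ln m - ?n * gain t \<sigma>) / (1 - t)) powr (1 / (a + \<tau>)))"
    using mF unfolding nn_integral_exp_gauss_measure[OF hc, symmetric]
    by (rule gauss_norm_le) (use a \<tau> in auto)
  also have "exp ((ln m - ?n * gain t \<sigma>) / (1 - t)) powr (1 / (a + \<tau>)) = exp (- (?n * gain t \<sigma>) / a) * m powr (1 / a)"
    unfolding powr_def t1 using a \<tau> m by (simp add: exp_add[symmetric] diff_divide_distrib)
  also have "ennreal \<dots> = ennreal (exp (- (?n * gain t \<sigma>) / a)) * ennreal (m powr (1 / a))"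
    by (rule ennreal_mult) auto
  also have "\<dots> \<le> gauss_norm (a + \<tau>) (\<lambda>x. exp (hopf_lax \<tau> (\<lambda>y :: real^'n. 1 / a * ln (gauss \<sigma> y / gauss 1 y)) x))
       * gauss_norm a (\<lambda>x. exp (f x))"
    by (intro mult_mono gaussian_extremizer_norm[OF a \<tau> \<sigma> t] gauss_norm_ge)
      (use m a mv nn_integral_exp_gauss_measure[OF fc] in auto)
  finally show ?thesis .
qed

text \<open>The core estimate solved for the mass of \<open>F\<close>. The right-hand side increases
  with \<open>m\<close>, which is what allows a passage to the limit through truncations of smaller
  mass.\<close>

lemma hopf_lax_core_bound:
  fixes f :: "real^'n \<Rightarrow> real" and a \<tau> \<sigma> :: real
  assumes a: "a > 0" and \<tau>: "\<tau> > 0" and \<sigma>: "\<sigma> > 1"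
    and C: "C > 0" and f: "\<And>x. f x \<ge> - C * (1 + norm x)"
    and v: "\<And>x. v x = exp (a * f x) * stdn_density x" and vb: "gauss_bounded Basis v"
    and mean: "\<And>\<xi> e. 0 < e \<Longrightarrow> e\<^sup>2 < \<sigma> \<Longrightarrow> ln (v \<xi>) + (norm \<xi>)\<^sup>2 / (2 * \<sigma>)
        \<le> (\<integral>g. ln (v (\<xi> + e *\<^sub>R g)) + (norm (\<xi> + e *\<^sub>R g))\<^sup>2 / (2 * \<sigma>) \<partial>stdn)"
    and t: "t = \<tau> / (a + \<tau>)"
  obtains m where "m > 0" "(\<integral>\<^sup>+x. ennreal (v x) \<partial>lborel) = ennreal m"
    "(\<integral>\<^sup>+x. ennreal (exp ((a + \<tau>) * hopf_lax \<tau> f x) * stdn_density x) \<partial>lborel)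
       \<le> ennreal (exp ((ln m - CARD('n) * gain t \<sigma>) / (1 - t)))"
proof -
  have t1: "1 - t > 0" using a \<tau> by (simp add: t field_simps)
  obtain mF mv where m: "0 < mF" "0 < mv"
     "(\<integral>\<^sup>+x. ennreal (exp ((a + \<tau>) * hopf_lax \<tau> f x) * stdn_density x) \<partial>lborel) = ennreal mF"
     "(\<integral>\<^sup>+x. ennreal (v x) \<partial>lborel) = ennreal mv"
     "(1 - t) * ln mF + CARD('n) * ((1 - t) * ln ((1 - t) * \<sigma> / (\<sigma> - t)) + t * ln \<sigma>) / 2 \<le> ln mv"
    using hopf_lax_core[OF a \<tau> \<sigma> C f v vb mean t] by blast
  have "(1 - t) * ln mF \<le> ln mv - CARD('n) * gain t \<sigma>" using m(5) unfolding gain_def by simp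
  then have "ln mF \<le> (ln mv - CARD('n) * gain t \<sigma>) / (1 - t)" using t1 by (simp add: field_simps)
  then have "mF \<le> exp ((ln mv - CARD('n) * gain t \<sigma>) / (1 - t))" using m(1) by (metis exp_le_cancel_iff exp_ln)
  then show ?thesis using that[OF m(2,4)] unfolding m(3) by (simp add: ennreal_leI)
qed

section \<open>From the Laplacian bound to Gaussian bounds and the mean inequality\<close>

lemma grad_has_derivative:
  fixes f :: "real^'n \<Rightarrow> real"
  assumes "f differentiable (at x)"
  shows "(f has_derivative (\<lambda>h. grad f x \<bullet> h)) (at x)"
proof -
  obtain f' where f': "(f has_derivative f') (at x)" using assms by (auto simp: differentiable_def)
  have lin: "linear f'" using f' has_derivative_linear by blast
  define D where "D = (\<Sum>b\<in>Basis. f' b *\<^sub>R b)"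
  have "f' = (\<lambda>h. h \<bullet> D)"
  proof
    fix h
    have "f' h = f' (\<Sum>b\<in>Basis. (h \<bullet> b) *\<^sub>R b)" by (simp add: euclidean_representation)
    also have "\<dots> = (\<Sum>b\<in>Basis. (h \<bullet> b) * f' b)" by (simp add: linear_sum[OF lin] linear_cmul[OF lin])
    also have "\<dots> = h \<bullet> D" by (simp add: D_def inner_sum_right mult.commute)
    finally show "f' h = h \<bullet> D" .
  qed
  then have g: "GDERIV f x :> D" using f' unfolding gderiv_def by simp
  have "E = D" if "GDERIV f x :> E" for E
  proof -
    have "(\<lambda>h. h \<bullet> E) = (\<lambda>h. h \<bullet> D)"
      using that g unfolding gderiv_def by (rule has_derivative_unique)
    then show ?thesis by (metis inner_commute vector_eq_ldot)
  qed
  then have "grad f x = D" unfolding grad_def using g by (intro the_equality)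
  then show ?thesis using g unfolding gderiv_def by (simp add: inner_commute)
qed

lemma laplacian_eq_sum_Basis:
  fixes f :: "real^'n \<Rightarrow> real"
  shows "laplacian f x = (\<Sum>b\<in>Basis. frechet_derivative (grad f) (at x) b \<bullet> b)"
proof -
  have B: "(Basis :: (real^'n) set) = range (\<lambda>i. axis i 1)" by (auto simp: Basis_vec_def)
  have i: "inj (\<lambda>i::'n. axis i (1::real))" by (auto simp: inj_def axis_eq_axis)
  have "(\<Sum>b\<in>Basis. frechet_derivative (grad f) (at x) b \<bullet> b)
     = (\<Sum>i\<in>UNIV. frechet_derivative (grad f) (at x) (axis i 1) \<bullet> axis i 1)"
    unfolding B sum.reindex[OF i] o_def ..
  then show ?thesis by (simp add: laplacian_def trace_def jacobian_def matrix_def inner_axis)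
qed

text \<open>Joint convexity of \<open>|p|^2 / A\<close>; the difference of the two sides is a single
  square.\<close>

lemma norm_add_square_weighted:
  fixes p q :: "'a::real_inner"
  assumes "A > 0" "B > 0"
  shows "(norm (p + q))\<^sup>2 / (A + B) \<le> (norm p)\<^sup>2 / A + (norm q)\<^sup>2 / B"
proof -
  have "0 \<le> (norm (B *\<^sub>R p - A *\<^sub>R q))\<^sup>2 / (A * B * (A + B))" using assms by simp
  also have "(norm (B *\<^sub>R p - A *\<^sub>R q))\<^sup>2 = B * (B * (p \<bullet> p)) - 2 * (A * (B * (p \<bullet> q))) + A * (A * (q \<bullet> q))"
    unfolding power2_norm_eq_inner by (simp add: inner_diff_left inner_diff_right inner_commute)
  also have "\<dots> / (A * B * (A + B)) = (p \<bullet> p) / A + (q \<bullet> q) / B - (p \<bullet> p + 2 * (p \<bullet> q) + q \<bullet> q) / (A + B)"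
    using assms by (simp add: divide_simps) (simp add: algebra_simps)
  also have "p \<bullet> p + 2 * (p \<bullet> q) + q \<bullet> q = (norm (p + q))\<^sup>2"
    unfolding power2_norm_eq_inner by (simp add: inner_add_left inner_add_right inner_commute)
  finally show ?thesis by (simp add: power2_norm_eq_inner)
qed

text \<open>A Gaussian of variance \<open>e^2\<close> about \<open>\<xi>\<close> is dominated by a
  multiple of the centred one of variance \<open>\<sigma>\<close>. The price
  \<open>exp (|\<xi>|^2 / (2 * (\<sigma> - e^2)))\<close> comes from
  \<open>norm_add_square_weighted\<close> applied to \<open>y = (y - \<xi>) + \<xi>\<close>.\<close>

lemma gauss_mean_exp_bound:
  fixes k :: "'a::euclidean_space \<Rightarrow> real"
  assumes kc: "continuous_on UNIV k" and \<sigma>: "\<sigma> > 0"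
    and S: "(\<integral>\<^sup>+y. ennreal (exp (2 * k y - (norm y)\<^sup>2 / (2 * \<sigma>))) \<partial>lborel) = ennreal S" "S \<ge> 0"
    and e: "0 < e" "e\<^sup>2 < \<sigma>"
  shows "(\<integral>\<^sup>+g. ennreal (exp (2 * k (\<xi> + e *\<^sub>R g))) \<partial>stdn)
     \<le> ennreal ((2 * pi) powr (- real DIM('a) / 2) / e ^ DIM('a) * S * exp ((norm \<xi>)\<^sup>2 / (2 * (\<sigma> - e\<^sup>2))))"
proof -
  have [measurable]: "k \<in> borel_measurable borel" using kc by (rule borel_measurable_continuous_onI)
  define c where "c = (2 * pi) powr (- real DIM('a) / 2)"
  have c: "c \<ge> 0" by (simp add: c_def)
  define E where "E = exp ((norm \<xi>)\<^sup>2 / (2 * (\<sigma> - e\<^sup>2)))"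
  have E: "E \<ge> 0" by (simp add: E_def)
  define h where "h y = exp (2 * k y) * exp (- (norm (y - \<xi>))\<^sup>2 / (2 * e\<^sup>2))" for y
  have hm[measurable]: "h \<in> borel_measurable borel" unfolding h_def by measurable
  have "(\<integral>\<^sup>+g. ennreal (exp (2 * k (\<xi> + e *\<^sub>R g))) \<partial>stdn) = (\<integral>\<^sup>+g. ennreal c * ennreal (h (\<xi> + e *\<^sub>R g)) \<partial>lborel)"
  proof (subst nn_integral_stdn, measurable, intro nn_integral_cong)
    fix g :: 'a
    have "- (norm (\<xi> + e *\<^sub>R g - \<xi>))\<^sup>2 / (2 * e\<^sup>2) = - (norm g)\<^sup>2 / 2" using e by (simp add: power_mult_distrib)
    then have "stdn_density g * exp (2 * k (\<xi> + e *\<^sub>R g)) = c * h (\<xi> + e *\<^sub>R g)"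
      unfolding stdn_density_eq h_def c_def by simp
    moreover have "0 \<le> stdn_density g" "0 \<le> h (\<xi> + e *\<^sub>R g)"
      using stdn_density_pos[of g] by (auto simp: h_def)
    ultimately show "ennreal (stdn_density g) * ennreal (exp (2 * k (\<xi> + e *\<^sub>R g))) = ennreal c * ennreal (h (\<xi> + e *\<^sub>R g))"
      using c by (simp add: ennreal_mult[symmetric])
  qed
  also have "\<dots> = ennreal c * (\<integral>\<^sup>+g. ennreal (h (\<xi> + e *\<^sub>R g)) \<partial>lborel)"
    by (rule nn_integral_cmult) measurable
  also have "(\<integral>\<^sup>+g. ennreal (h (\<xi> + e *\<^sub>R g)) \<partial>lborel) = ennreal (1 / e ^ DIM('a)) * (\<integral>\<^sup>+y. ennreal (h y) \<partial>lborel)"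
    using nn_integral_lborel_affine[of "\<lambda>y. ennreal (h y)" e \<xi>] e
    by (simp add: mult.assoc[symmetric] ennreal_mult[symmetric])
  also have "(\<integral>\<^sup>+y. ennreal (h y) \<partial>lborel) \<le> (\<integral>\<^sup>+y. ennreal E * ennreal (exp (2 * k y - (norm y)\<^sup>2 / (2 * \<sigma>))) \<partial>lborel)"
  proof (intro nn_integral_mono)
    fix y
    have "(norm y)\<^sup>2 / \<sigma> \<le> (norm (y - \<xi>))\<^sup>2 / e\<^sup>2 + (norm \<xi>)\<^sup>2 / (\<sigma> - e\<^sup>2)"
      using norm_add_square_weighted[of "e\<^sup>2" "\<sigma> - e\<^sup>2" "y - \<xi>" \<xi>] e by simp
    then have "(norm y)\<^sup>2 / \<sigma> / 2 \<le> ((norm (y - \<xi>))\<^sup>2 / e\<^sup>2 + (norm \<xi>)\<^sup>2 / (\<sigma> - e\<^sup>2)) / 2" by simp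
    then have "2 * k y + - (norm (y - \<xi>))\<^sup>2 / (2 * e\<^sup>2) \<le> (norm \<xi>)\<^sup>2 / (2 * (\<sigma> - e\<^sup>2)) + (2 * k y - (norm y)\<^sup>2 / (2 * \<sigma>))"
      by (simp add: add_divide_distrib mult.commute)
    then have "h y \<le> E * exp (2 * k y - (norm y)\<^sup>2 / (2 * \<sigma>))"
      unfolding h_def E_def exp_add[symmetric] by simp
    then show "ennreal (h y) \<le> ennreal E * ennreal (exp (2 * k y - (norm y)\<^sup>2 / (2 * \<sigma>)))"
      using E by (simp add: ennreal_mult[symmetric] ennreal_leI)
  qed
  also have "\<dots> = ennreal E * ennreal S" unfolding S(1)[symmetric] by (rule nn_integral_cmult) measurable
  finally have "(\<integral>\<^sup>+g. ennreal (exp (2 * k (\<xi> + e *\<^sub>R g))) \<partial>stdn) \<le> ennreal c * (ennreal (1 / e ^ DIM('a)) * (ennreal E * ennreal S))"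
    by (simp add: mult_left_mono)
  also have "\<dots> = ennreal (c / e ^ DIM('a) * S * E)"
    using c E S(2) e by (simp add: ennreal_mult[symmetric] mult_ac)
  finally show ?thesis unfolding c_def E_def .
qed

text \<open>Up to a constant, \<open>k\<close> is \<open>ln (v / gauss \<sigma>)\<close>; the
  Laplacian bound makes it subharmonic, and the integrability hypothesis bounds Gaussian means of
  \<open>exp (2 * k)\<close>. Jensen's inequality and the mean value inequality turn the latter into
  a pointwise upper bound for \<open>k\<close>, hence into Gaussian decay of
  \<open>v\<close>.\<close>

lemma hopf_lax_contraction:
  fixes f :: "real^'n \<Rightarrow> real" and a \<tau> \<sigma> :: real
  assumes a: "a > 0" and \<tau>: "\<tau> > 0" and \<sigma>: "\<sigma> > 1"
    and td: "twice_differentiable f" and C: "C > 0" and f: "\<And>x. f x \<ge> - C * (1 + norm x)"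
    and lap: "\<And>x. a * laplacian f x \<ge> CARD('n) * (1 - 1 / \<sigma>)"
    and fin: "(\<integral>\<^sup>+x. ennreal (exp (2 * a * f x) * (gauss 1 x / gauss \<sigma> x)) \<partial>gauss_measure) < \<infinity>"
  shows "gauss_norm (a + \<tau>) (\<lambda>x. exp (hopf_lax \<tau> f x))
     \<le> gauss_norm (a + \<tau>) (\<lambda>x. exp (hopf_lax \<tau> (\<lambda>y :: real^'n. 1 / a * ln (gauss \<sigma> y / gauss 1 y)) x))
       * gauss_norm a (\<lambda>x. exp (f x))"
proof -
  let ?n = "real CARD('n)"
  interpret N: prob_space "stdn :: (real^'n) measure" by (rule prob_space_stdn)
  define l where "l = 1 - 1 / \<sigma>"
  have l: "0 < l" "l < 1" using \<sigma> by (auto simp: l_def)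
  define k where "k x = a * f x - l / 2 * (norm x)\<^sup>2" for x
  define Dk where "Dk x = a *\<^sub>R grad f x - l *\<^sub>R x" for x
  define DD where "DD x h = a *\<^sub>R frechet_derivative (grad f) (at x) h - l *\<^sub>R h" for x h
  have fd: "(f has_derivative (\<lambda>h. grad f x \<bullet> h)) (at x)" for x
    using td by (intro grad_has_derivative) (auto simp: twice_differentiable_def)
  have gd: "(grad f has_derivative frechet_derivative (grad f) (at x)) (at x)" for x
    using td by (simp add: twice_differentiable_def frechet_derivative_works[symmetric])
  have D1: "(k has_derivative (\<lambda>h. Dk x \<bullet> h)) (at x)" for x
  proof -
    have "((\<lambda>x::real^'n. x \<bullet> x) has_derivative (\<lambda>h. x \<bullet> h + h \<bullet> x)) (at x)"
      by (auto intro!: derivative_eq_intros)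
    then have "(k has_derivative (\<lambda>h. a * (grad f x \<bullet> h) - l / 2 * (x \<bullet> h + h \<bullet> x))) (at x)"
      unfolding k_def power2_norm_eq_inner by (intro has_derivative_diff has_derivative_mult_right fd)
    then show ?thesis by (simp add: Dk_def inner_diff_left inner_diff_right inner_commute)
  qed
  have D2: "(Dk has_derivative DD x) (at x)" for x
    unfolding Dk_def DD_def
    by (intro has_derivative_diff has_derivative_scaleR_right gd has_derivative_ident)
  have nn: "0 \<le> (\<Sum>i\<in>Basis. DD x i \<bullet> i)" for x
  proof -
    have "(\<Sum>i\<in>Basis. DD x i \<bullet> i) = a * laplacian f x - l * ?n"
      unfolding laplacian_eq_sum_Basis DD_def
      by (simp add: inner_diff_left sum_subtractf sum_distrib_left inner_Basis)
    then show ?thesis using lap[of x] by (simp add: l_def mult.commute)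
  qed
  have fc: "continuous_on UNIV f" using fd by (meson continuous_at_imp_continuous_on has_derivative_continuous)
  have kc: "continuous_on UNIV k" unfolding k_def by (intro continuous_intros fc)
  have [measurable]: "k \<in> borel_measurable borel" "f \<in> borel_measurable borel"
    using kc fc by (auto intro: borel_measurable_continuous_onI)
  define S where "S = enn2real (\<integral>\<^sup>+y. ennreal (exp (2 * k y - (norm y)\<^sup>2 / (2 * \<sigma>))) \<partial>lborel)"
  have S: "(\<integral>\<^sup>+y. ennreal (exp (2 * k y - (norm y)\<^sup>2 / (2 * \<sigma>))) \<partial>lborel) = ennreal S" "S \<ge> 0"
  proof -
    \<comment> \<open>Collects the normalising factors of the three Gaussians in the hypothesis
      \<open>fin\<close>: one from the measure, two from the quotient.\<close>
    define A where "A = (2 * pi) powr (- ?n / 2) * ((2 * pi) powr (- ?n / 2) / (2 * pi * \<sigma>) powr (- ?n / 2))"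
    have A: "A > 0" using \<sigma> by (simp add: A_def)
    have gm [measurable]: "(\<lambda>x. gauss \<alpha> x) \<in> borel_measurable borel" for \<alpha>
      unfolding gauss_def by measurable
    have "ennreal A * (\<integral>\<^sup>+y. ennreal (exp (2 * k y - (norm y)\<^sup>2 / (2 * \<sigma>))) \<partial>lborel)
       = (\<integral>\<^sup>+x. ennreal (exp (2 * a * f x) * (gauss 1 x / gauss \<sigma> x)) \<partial>gauss_measure)"
    proof (subst nn_integral_cmult[symmetric], simp, unfold gauss_measure_eq_stdn, subst nn_integral_stdn, measurable, intro nn_integral_cong)
      fix y :: "real^'n"
      have "stdn_density y * (exp (2 * a * f y) * (gauss 1 y / gauss \<sigma> y))
         = A * (exp (- (norm y)\<^sup>2 / 2) * (exp (2 * a * f y) * (exp (- (norm y)\<^sup>2 / 2) / exp (- (norm y)\<^sup>2 / (2 * \<sigma>)))))"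
        unfolding stdn_density_eq gauss_def A_def DIM_vec by simp
      also have "exp (- (norm y)\<^sup>2 / 2) * (exp (2 * a * f y) * (exp (- (norm y)\<^sup>2 / 2) / exp (- (norm y)\<^sup>2 / (2 * \<sigma>))))
         = exp (- (norm y)\<^sup>2 / 2 + (2 * a * f y + (- (norm y)\<^sup>2 / 2 - (- (norm y)\<^sup>2 / (2 * \<sigma>)))))"
        by (simp only: exp_add exp_diff)
      also have "- (norm y)\<^sup>2 / 2 + (2 * a * f y + (- (norm y)\<^sup>2 / 2 - (- (norm y)\<^sup>2 / (2 * \<sigma>)))) = 2 * k y - (norm y)\<^sup>2 / (2 * \<sigma>)"
        unfolding k_def l_def using \<sigma> by (simp add: field_simps)
      finally show "ennreal A * ennreal (exp (2 * k y - (norm y)\<^sup>2 / (2 * \<sigma>))) = ennreal (stdn_density y) * ennreal (exp (2 * a * f y) * (gauss 1 y / gauss \<sigma> y))"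
        using A less_imp_le[OF stdn_density_pos[of y]] gauss_pos[of \<sigma> y] gauss_pos[of 1 y] \<sigma>
        by (simp add: ennreal_mult[symmetric])
    qed
    then have "(\<integral>\<^sup>+y. ennreal (exp (2 * k y - (norm y)\<^sup>2 / (2 * \<sigma>))) \<partial>lborel) \<noteq> \<infinity>"
      using fin A by (metis ennreal_eq_0_iff ennreal_mult_top infinity_ennreal_def less_irrefl not_le)
    then show "(\<integral>\<^sup>+y. ennreal (exp (2 * k y - (norm y)\<^sup>2 / (2 * \<sigma>))) \<partial>lborel) = ennreal S" "S \<ge> 0"
      by (simp_all add: S_def less_top)
  qed
  define K where "K = 2 * a * C + 1"
  have klo: "- K * (1 + (norm x)\<^sup>2) \<le> k x" for x
  proof -
    have "a * (- C * (1 + norm x)) \<le> a * f x" using f[of x] a by (intro mult_left_mono) auto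
    moreover have "a * C * norm x \<le> a * C * (1 + (norm x)\<^sup>2)" using norm_le_one_add_square[of x] a C by (intro mult_left_mono) auto
    moreover have "a * C * 1 \<le> a * C * (1 + (norm x)\<^sup>2)" using a C by (intro mult_left_mono) auto
    moreover have "a * (- C * (1 + norm x)) = - (a * C * 1) - a * C * norm x" by (simp add: algebra_simps)
    moreover have "l / 2 * (norm x)\<^sup>2 \<le> 1 * (norm x)\<^sup>2" using l by (intro mult_right_mono) auto
    moreover have "K * (1 + (norm x)\<^sup>2) = a * C * (1 + (norm x)\<^sup>2) + a * C * (1 + (norm x)\<^sup>2) + (1 + (norm x)\<^sup>2)"
      by (simp add: K_def algebra_simps)
    ultimately show ?thesis unfolding k_def mult_minus_left by linarith
  qed
  have K0: "K > 0" using a C by (simp add: K_def add_pos_pos)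
  note bound = gauss_mean_exp_bound[OF kc _ S]
  have expi: "integrable stdn (\<lambda>g. exp (2 * k (\<xi> + e *\<^sub>R g)))" if e: "0 < e" "e\<^sup>2 < \<sigma>" for \<xi> e
  proof (rule integrableI_nonneg)
    show "(\<integral>\<^sup>+g. ennreal (exp (2 * k (\<xi> + e *\<^sub>R g))) \<partial>stdn) < \<infinity>"
      using le_less_trans[OF bound[OF _ e]] \<sigma> by simp
  qed auto
  \<comment> \<open>\<open>k\<close> is dominated from above by \<open>exp (2 * k)\<close> and from
    below by a quadratic, so no upper bound on \<open>k\<close> is presupposed.\<close>
  have ki: "integrable stdn (\<lambda>g. k (\<xi> + e *\<^sub>R g))" if e: "0 < e" "e\<^sup>2 < \<sigma>" for \<xi> e
  proof (rule Bochner_Integration.integrable_bound)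
    show "integrable stdn (\<lambda>g. exp (2 * k (\<xi> + e *\<^sub>R g)) + K * (1 + (norm (\<xi> + e *\<^sub>R g))\<^sup>2))"
      by (intro Bochner_Integration.integrable_add integrable_mult_right N.integrable_const expi[OF e] stdn_moments(1))
    show "AE g in stdn. norm (k (\<xi> + e *\<^sub>R g)) \<le> norm (exp (2 * k (\<xi> + e *\<^sub>R g)) + K * (1 + (norm (\<xi> + e *\<^sub>R g))\<^sup>2))"
    proof (rule AE_I2)
      fix g
      let ?y = "\<xi> + e *\<^sub>R g"
      have "2 * k ?y \<le> exp (2 * k ?y)" using exp_ge_add_one_self[of "2 * k ?y"] by linarith
      moreover have "0 \<le> exp (2 * k ?y)" by simp
      moreover have "0 \<le> K * (1 + (norm ?y)\<^sup>2)" using K0 by simp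
      moreover have "- (K * (1 + (norm ?y)\<^sup>2)) \<le> k ?y" using klo[of ?y] by simp
      ultimately have "\<bar>k ?y\<bar> \<le> exp (2 * k ?y) + K * (1 + (norm ?y)\<^sup>2)" unfolding abs_le_iff by linarith
      then show "norm (k ?y) \<le> norm (exp (2 * k ?y) + K * (1 + (norm ?y)\<^sup>2))" by simp
    qed
  qed simp
  have kmean: "k \<xi> \<le> (\<integral>g. k (\<xi> + e *\<^sub>R g) \<partial>stdn)" if e: "0 < e" "e\<^sup>2 < \<sigma>" for \<xi> e
    by (rule subharmonic_gauss_mean[OF D1 D2 nn _ ki[OF e]]) (use e in auto)
  \<comment> \<open>The resulting bound on \<open>k\<close> grows like
    \<open>|\<xi>|^2 / (4 * (\<sigma> - e0^2))\<close>. This must stay below the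
    \<open>|\<xi>|^2 / (2 * \<sigma>)\<close> that separates \<open>k\<close> from
    \<open>ln v\<close>, that is \<open>e0^2 < \<sigma> / 2\<close>. The present choice leaves a
    decay rate of \<open>1 / (6 * \<sigma>)\<close>.\<close>
  define e0 where "e0 = sqrt \<sigma> / 2"
  have e0: "0 < e0" "e0\<^sup>2 < \<sigma>" and e0s: "e0\<^sup>2 = \<sigma> / 4" using \<sigma> by (auto simp: e0_def power_divide)
  \<comment> \<open>The added one makes \<open>M0\<close> positive, since only
    \<open>S \<ge> 0\<close> has been recorded.\<close>
  define M0 where "M0 = (2 * pi) powr (- real DIM(real^'n) / 2) / e0 ^ DIM(real^'n) * S + 1"
  have M0: "M0 > 0" using S(2) e0(1) unfolding M0_def by (intro add_nonneg_pos mult_nonneg_nonneg divide_nonneg_pos) auto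
  have kup: "k \<xi> \<le> ln M0 / 2 + (norm \<xi>)\<^sup>2 / (3 * \<sigma>)" for \<xi>
  proof -
    define M where "M = M0 * exp ((norm \<xi>)\<^sup>2 / (2 * (\<sigma> - e0\<^sup>2)))"
    have M: "M > 0" using M0 by (simp add: M_def)
    have "ennreal (\<integral>g. exp (2 * k (\<xi> + e0 *\<^sub>R g)) \<partial>stdn) = (\<integral>\<^sup>+g. ennreal (exp (2 * k (\<xi> + e0 *\<^sub>R g))) \<partial>stdn)"
      by (rule nn_integral_eq_integral[symmetric, OF expi[OF e0]]) simp
    also have "\<dots> \<le> ennreal M"
      by (rule order_trans[OF bound[OF _ e0]]) (use \<sigma> in \<open>auto simp: M_def M0_def algebra_simps intro!: ennreal_leI\<close>)
    finally have iM: "(\<integral>g. exp (2 * k (\<xi> + e0 *\<^sub>R g)) \<partial>stdn) \<le> M" using M by (simp add: ennreal_le_iff)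
    \<comment> \<open>Jensen's inequality in tangent form, with the tangent of \<open>ln\<close> at
      \<open>M\<close>; the expectation of \<open>exp (2 * k) / M\<close> is at most one.\<close>
    have "(\<integral>g. k (\<xi> + e0 *\<^sub>R g) \<partial>stdn) \<le> (\<integral>g. (exp (2 * k (\<xi> + e0 *\<^sub>R g)) * (1 / M) - 1 + ln M) / 2 \<partial>stdn)"
    proof (rule integral_mono[OF ki[OF e0]])
      show "integrable stdn (\<lambda>g. (exp (2 * k (\<xi> + e0 *\<^sub>R g)) * (1 / M) - 1 + ln M) / 2)"
        by (intro integrable_divide_zero Bochner_Integration.integrable_add Bochner_Integration.integrable_diff integrable_mult_left N.integrable_const expi[OF e0])
      fix g :: "real^'n"
      define y where "y = \<xi> + e0 *\<^sub>R g"
      have "2 * k y - ln M + 1 \<le> exp (2 * k y - ln M)" using exp_ge_add_one_self[of "2 * k y - ln M"] by linarith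
      also have "\<dots> = exp (2 * k y) * (1 / M)" using M by (simp add: exp_diff)
      finally show "k (\<xi> + e0 *\<^sub>R g) \<le> (exp (2 * k (\<xi> + e0 *\<^sub>R g)) * (1 / M) - 1 + ln M) / 2"
        unfolding y_def by simp
    qed
    also have "\<dots> = ((\<integral>g. exp (2 * k (\<xi> + e0 *\<^sub>R g)) \<partial>stdn) * (1 / M) - 1 + ln M) / 2"
      using expi[OF e0] by (simp add: N.prob_space[unfolded space_stdn])
    also have "\<dots> \<le> ln M / 2" using iM M by (simp add: divide_le_eq)
    also have "ln M = ln M0 + (norm \<xi>)\<^sup>2 / (2 * (\<sigma> - e0\<^sup>2))" unfolding M_def using M0 by (simp add: ln_mult_pos)
    also have "(norm \<xi>)\<^sup>2 / (2 * (\<sigma> - e0\<^sup>2)) = 2 * ((norm \<xi>)\<^sup>2 / (3 * \<sigma>))" unfolding e0s using \<sigma> by (simp add: field_simps)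
    finally have "(\<integral>g. k (\<xi> + e0 *\<^sub>R g) \<partial>stdn) \<le> ln M0 / 2 + (norm \<xi>)\<^sup>2 / (3 * \<sigma>)" by (simp add: add_divide_distrib)
    then show ?thesis using kmean[OF e0, of \<xi>] by linarith
  qed
  define v where "v x = exp (a * f x) * stdn_density x" for x
  have lnv: "ln (v x) = k x - (norm x)\<^sup>2 / (2 * \<sigma>) - ?n * ln (2 * pi) / 2" for x
  proof -
    have "ln (v x) = a * f x - ?n * ln (2 * pi) / 2 - (norm x)\<^sup>2 / 2"
      unfolding v_def using stdn_density_pos[of x] by (simp add: ln_mult_pos ln_stdn_density)
    also have "\<dots> = k x - (norm x)\<^sup>2 / (2 * \<sigma>) - ?n * ln (2 * pi) / 2"
      unfolding k_def l_def using \<sigma> by (simp add: field_simps)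
    finally show ?thesis .
  qed
  have vb: "gauss_bounded Basis v"
  proof (rule gauss_boundedI)
    show "continuous_on UNIV v" unfolding v_def stdn_density_eq by (intro continuous_intros fc) auto
    show "0 < v y" for y unfolding v_def using stdn_density_pos[of y] by simp
    show "1 / (6 * \<sigma>) > 0" using \<sigma> by simp
    have l2: "ln (2 * pi) > 0" using pi_gt3 by simp
    show "ln (v y) \<le> ln M0 / 2 - 1 / (6 * \<sigma>) * (norm y)\<^sup>2" for y
    proof -
      have "(norm y)\<^sup>2 / (3 * \<sigma>) - (norm y)\<^sup>2 / (2 * \<sigma>) = - (1 / (6 * \<sigma>) * (norm y)\<^sup>2)" using \<sigma> by (simp add: field_simps)
      moreover have "?n * ln (2 * pi) / 2 \<ge> 0" using l2 by simp
      ultimately show ?thesis using kup[of y] unfolding lnv by linarith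
    qed
    show "- (K + 1 / (2 * \<sigma>) + ?n * ln (2 * pi) / 2) * (1 + (norm y)\<^sup>2) \<le> ln (v y)" for y
    proof -
      have "?n * ln (2 * pi) / 2 * 1 \<le> ?n * ln (2 * pi) / 2 * (1 + (norm y)\<^sup>2)" using l2 by (intro mult_left_mono) auto
      moreover have "(norm y)\<^sup>2 / (2 * \<sigma>) \<le> 1 / (2 * \<sigma>) * (1 + (norm y)\<^sup>2)" using \<sigma> by (simp add: field_simps)
      moreover have "(K + 1 / (2 * \<sigma>) + ?n * ln (2 * pi) / 2) * (1 + (norm y)\<^sup>2) = K * (1 + (norm y)\<^sup>2) + 1 / (2 * \<sigma>) * (1 + (norm y)\<^sup>2) + ?n * ln (2 * pi) / 2 * (1 + (norm y)\<^sup>2)"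
        by (simp only: distrib_right)
      ultimately show ?thesis using klo[of y] unfolding lnv mult_minus_left by linarith
    qed
  qed
  have mean: "ln (v \<xi>) + (norm \<xi>)\<^sup>2 / (2 * \<sigma>) \<le> (\<integral>g. ln (v (\<xi> + e *\<^sub>R g)) + (norm (\<xi> + e *\<^sub>R g))\<^sup>2 / (2 * \<sigma>) \<partial>stdn)"
    if e: "0 < e" "e\<^sup>2 < \<sigma>" for \<xi> e
  proof -
    have "ln (v y) + (norm y)\<^sup>2 / (2 * \<sigma>) = k y - ?n * ln (2 * pi) / 2" for y unfolding lnv by simp
    then show ?thesis using kmean[OF e, of \<xi>] ki[OF e, of \<xi>] by (simp add: N.prob_space[unfolded space_stdn])
  qed
  define t where "t = \<tau> / (a + \<tau>)"
  obtain m where m: "m > 0" "(\<integral>\<^sup>+x. ennreal (v x) \<partial>lborel) = ennreal m"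
    "(\<integral>\<^sup>+x. ennreal (exp ((a + \<tau>) * hopf_lax \<tau> f x) * stdn_density x) \<partial>lborel)
       \<le> ennreal (exp ((ln m - CARD('n) * gain t \<sigma>) / (1 - t)))"
    by (rule hopf_lax_core_bound[OF a \<tau> \<sigma> C f v_def vb mean t_def]) auto
  show ?thesis
    by (rule gauss_norm_combine[OF a \<tau> \<sigma> t_def fc hopf_lax_bounds(4)[OF f C \<tau>] m(1) m(2)[unfolded v_def] m(3)])
qed

subsection \<open>Fokker--Planck solutions\<close>

text \<open>Infimum and increasing limit commute by compactness. If the infima stayed below some
  \<open>r < Q f\<close>, the sublevel sets at a level in between would be nested, compact and
  nonempty, and a common point would violate the definition of \<open>Q f\<close> in the
  limit.\<close>

lemma hopf_lax_increasing_limit: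
  fixes f :: "real^'n \<Rightarrow> real" and F :: "nat \<Rightarrow> real^'n \<Rightarrow> real"
  assumes Fc: "\<And>N. continuous_on UNIV (F N)" and inc: "\<And>y. incseq (\<lambda>N. F N y)"
    and lim: "\<And>y. (\<lambda>N. F N y) \<longlonglongrightarrow> f y"
    and C: "C > 0" and lo: "\<And>y. F 0 y \<ge> - C * (1 + norm y)" and \<tau>: "\<tau> > 0"
  shows "(\<lambda>N. hopf_lax \<tau> (F N) x) \<longlonglongrightarrow> hopf_lax \<tau> f x"
proof -
  have F0: "F 0 y \<le> F N y" for N y using incseqD[OF inc, of 0 N y] by simp
  have Ff: "F N y \<le> f y" for N y by (rule incseq_le[OF inc lim])
  have Flo: "F N y \<ge> - C * (1 + norm y)" for N y using lo[of y] F0[of y N] by linarith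
  have flo: "f y \<ge> - C * (1 + norm y)" for y using Flo[of y 0] Ff[of 0 y] by linarith
  have HF: "hopf_lax \<tau> (F N) x \<le> F N y + 1 / (2 * \<tau>) * (norm (x - y))\<^sup>2" for N y
    using hopf_lax_bounds(2)[where f="F N", OF _ C \<tau>] Flo by blast
  note Hf = hopf_lax_bounds[OF flo C \<tau>]
  have le: "hopf_lax \<tau> (F N) x \<le> hopf_lax \<tau> f x" for N
  proof -
    have "hopf_lax \<tau> (F N) x \<le> f y + 1 / (2 * \<tau>) * (norm (x - y))\<^sup>2" for y
      using HF[of N y] Ff[of N y] by linarith
    then show ?thesis unfolding hopf_lax_def[of \<tau> f] by (intro cINF_greatest) auto
  qed
  have mono: "hopf_lax \<tau> (F N) x \<le> hopf_lax \<tau> (F N') x" if "N \<le> N'" for N N'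
  proof -
    have "hopf_lax \<tau> (F N) x \<le> F N' y + 1 / (2 * \<tau>) * (norm (x - y))\<^sup>2" for y
      using HF[of N y] incseqD[OF inc that, of y] by linarith
    then show ?thesis unfolding hopf_lax_def[of \<tau> "F N'"] by (intro cINF_greatest) auto
  qed
  show ?thesis
  proof (rule order_tendstoI)
    fix r assume "hopf_lax \<tau> f x < r"
    then show "\<forall>\<^sub>F N in sequentially. hopf_lax \<tau> (F N) x < r"
      using le by (intro always_eventually allI) (meson le_less_trans)
  next
    fix r assume r: "r < hopf_lax \<tau> f x"
    have "\<exists>N. r < hopf_lax \<tau> (F N) x"
    proof (rule ccontr)
      assume "\<not> ?thesis"
      then have Nr: "hopf_lax \<tau> (F N) x \<le> r" for N by (simp add: not_less)
      \<comment> \<open>The infimum \<open>\<le> r\<close> need not be known to be attained; the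
        strictly larger level \<open>r'\<close> makes the closed sublevel sets nonempty.\<close>
      obtain r' where r': "r < r'" "r' < hopf_lax \<tau> f x" using r dense by blast
      define K where "K N = {y. F N y + 1 / (2 * \<tau>) * (norm (x - y))\<^sup>2 \<le> r'}" for N
      \<comment> \<open>The lower bound of \<open>hopf_lax_bounds\<close> for
        \<open>2 * \<tau>\<close> uses up half of the quadratic cost. The other half confines the
        sublevel sets to a ball that does not depend on \<open>N\<close>.\<close>
      define M where "M = - C * (1 + norm x) - C\<^sup>2 * (2 * \<tau>) / 2"
      define B where "B = 1 + 4 * \<tau> * \<bar>r' - M\<bar>"
      have "\<Inter> (range K) \<noteq> {}"
      proof (rule compact_nest)
        show "compact (K N)" for N
        proof -
          have "closed (K N)" unfolding K_def by (intro closed_Collect_le continuous_intros Fc)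
          moreover have "K N \<subseteq> cball x B"
          proof
            fix y assume y: "y \<in> K N"
            define d where "d = norm (x - y)"
            have "F N y + 1 / (2 * (2 * \<tau>)) * d\<^sup>2 \<ge> M"
              unfolding d_def M_def using hopf_lax_bounds(1)[where f="F N" and \<tau>="2 * \<tau>", OF _ C] Flo \<tau> by simp
            moreover have "F N y + 1 / (2 * \<tau>) * d\<^sup>2 \<le> r'" using y by (simp add: K_def d_def)
            moreover have "1 / (2 * \<tau>) * d\<^sup>2 = 1 / (2 * (2 * \<tau>)) * d\<^sup>2 + 1 / (4 * \<tau>) * d\<^sup>2" using \<tau> by (simp add: field_simps)
            ultimately have "1 / (4 * \<tau>) * d\<^sup>2 \<le> \<bar>r' - M\<bar>" by linarith
            then have dd: "d\<^sup>2 \<le> 4 * \<tau> * \<bar>r' - M\<bar>" using \<tau> by (simp add: field_simps)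
            have "2 * d \<le> d\<^sup>2 + 1" using sum_squares_bound[of d 1] by simp
            moreover have "d \<ge> 0" by (simp add: d_def)
            ultimately have "d \<le> B" using dd unfolding B_def by linarith
            then show "y \<in> cball x B" by (simp add: d_def dist_norm)
          qed
          ultimately show ?thesis using compact_eq_bounded_closed bounded_subset[OF bounded_cball] by blast
        qed
        show "K N \<noteq> {}" for N
        proof -
          have "(INF y. F N y + 1 / (2 * \<tau>) * (norm (x - y))\<^sup>2) < r'" using Nr[of N] r' unfolding hopf_lax_def by simp
          then have "\<exists>y. F N y + 1 / (2 * \<tau>) * (norm (x - y))\<^sup>2 < r'"
            by (metis (no_types, lifting) UNIV_not_empty cINF_greatest not_less)
          then show ?thesis by (auto simp: K_def intro: less_imp_le)
        qed
        show "K N' \<subseteq> K N" if "N \<le> N'" for N N'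
        proof
          fix y assume "y \<in> K N'"
          then show "y \<in> K N" using incseqD[OF inc that, of y] unfolding K_def mem_Collect_eq by linarith
        qed
      qed
      then obtain y where y: "\<And>N. y \<in> K N" by blast
      have "f y + 1 / (2 * \<tau>) * (norm (x - y))\<^sup>2 \<le> r'"
        by (rule LIMSEQ_le_const2[OF tendsto_add[OF lim[of y] tendsto_const]]) (use y in \<open>auto simp: K_def\<close>)
      then show False using Hf(2)[of x y] r' by linarith
    qed
    then obtain N where N: "r < hopf_lax \<tau> (F N) x" by blast
    then show "\<forall>\<^sub>F N in sequentially. r < hopf_lax \<tau> (F N) x"
      using mono by (intro eventually_sequentiallyI[of N]) (meson less_le_trans)
  qed
qed

section \<open>Averages of heat kernels\<close>

definition heat_kernel_average :: "real \<Rightarrow> real \<Rightarrow> (real^'n) measure \<Rightarrow> real^'n \<Rightarrow> real" where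
  "heat_kernel_average \<sigma> \<rho> \<nu> x =
     (2 * pi * \<sigma>) powr (- real CARD('n) / 2) * (\<integral>y. exp (- (norm (x - \<rho> *\<^sub>R y))\<^sup>2 / (2 * \<sigma>)) \<partial>\<nu>)"

text \<open>At this time \<open>1 - exp (- 2 * t) = 1 / 2\<close>, so the kernel has variance
  exactly \<open>\<sigma>\<close>, and the only trace of the drift is the contraction of the initial
  measure by \<open>\<rho> = exp (- t)\<close>.\<close>

lemma fp_solution_eq:
  fixes \<mu> :: "(real^'n) measure"
  shows "fp_solution \<sigma> \<mu> (1 / 2 * ln 2) = heat_kernel_average \<sigma> (exp (- (1 / 2 * ln 2))) \<mu>"
proof
  fix x :: "real^'n"
  have 1: "exp (- 2 * (1 / 2 * ln 2)) = (1 / 2 :: real)" by (simp add: exp_minus)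
  have 2: "4 * pi * \<sigma> * (1 - 1 / 2) = 2 * pi * \<sigma>" "4 * \<sigma> * (1 - 1 / 2) = 2 * \<sigma>" by auto
  show "fp_solution \<sigma> \<mu> (1 / 2 * ln 2) x = heat_kernel_average \<sigma> (exp (- (1 / 2 * ln 2))) \<mu> x"
    unfolding fp_solution_def heat_kernel_average_def 1 2 ..
qed

lemma finite_measure_integral_exp_pos:
  fixes \<nu> :: "(real^'n) measure"
  assumes \<nu>: "finite_measure \<nu>" "sets \<nu> = sets borel" "emeasure \<nu> UNIV \<noteq> 0" and \<sigma>: "\<sigma> > 0"
  shows "integrable \<nu> (\<lambda>y. exp (- (norm (x - \<rho> *\<^sub>R y))\<^sup>2 / (2 * \<sigma>)))"
    and "0 < (\<integral>y. exp (- (norm (x - \<rho> *\<^sub>R y))\<^sup>2 / (2 * \<sigma>)) \<partial>\<nu>)"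
proof -
  interpret finite_measure \<nu> by fact
  note [measurable_cong] = \<nu>(2)
  have sp: "space \<nu> = UNIV" using sets_eq_imp_space_eq[OF \<nu>(2)] by simp
  show i: "integrable \<nu> (\<lambda>y. exp (- (norm (x - \<rho> *\<^sub>R y))\<^sup>2 / (2 * \<sigma>)))"
    by (rule integrable_const_bound[where B=1]) (use \<sigma> in auto)
  have "(\<integral>y. exp (- (norm (x - \<rho> *\<^sub>R y))\<^sup>2 / (2 * \<sigma>)) \<partial>\<nu>) \<noteq> 0"
  proof
    assume "(\<integral>y. exp (- (norm (x - \<rho> *\<^sub>R y))\<^sup>2 / (2 * \<sigma>)) \<partial>\<nu>) = 0"
    then have "AE y in \<nu>. exp (- (norm (x - \<rho> *\<^sub>R y))\<^sup>2 / (2 * \<sigma>)) = 0"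
      by (subst (asm) integral_nonneg_eq_0_iff_AE[OF i]) auto
    then have "AE y in \<nu>. False" by eventually_elim simp
    then show False using \<nu>(3) by (simp add: AE_iff_null null_sets_def sp)
  qed
  moreover have "0 \<le> (\<integral>y. exp (- (norm (x - \<rho> *\<^sub>R y))\<^sup>2 / (2 * \<sigma>)) \<partial>\<nu>)" by (rule integral_nonneg_AE) simp
  ultimately show "0 < (\<integral>y. exp (- (norm (x - \<rho> *\<^sub>R y))\<^sup>2 / (2 * \<sigma>)) \<partial>\<nu>)" by linarith
qed

lemma heat_kernel_average_pos:
  fixes \<nu> :: "(real^'n) measure"
  assumes "finite_measure \<nu>" "sets \<nu> = sets borel" "emeasure \<nu> UNIV \<noteq> 0" "\<sigma> > 0"
  shows "0 < heat_kernel_average \<sigma> \<rho> \<nu> x"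
  unfolding heat_kernel_average_def using finite_measure_integral_exp_pos(2)[OF assms] assms(4) by simp

lemma heat_kernel_average_continuous:
  fixes \<nu> :: "(real^'n) measure"
  assumes \<nu>: "finite_measure \<nu>" "sets \<nu> = sets borel" and \<sigma>: "\<sigma> > 0"
  shows "continuous_on UNIV (heat_kernel_average \<sigma> \<rho> \<nu>)"
proof (rule continuous_at_imp_continuous_on, rule ballI, rule continuous_at_sequentiallyI)
  interpret finite_measure \<nu> by fact
  note [measurable_cong] = \<nu>(2)
  fix x :: "real^'n" and u assume u: "u \<longlonglongrightarrow> x"
  have "(\<lambda>n. \<integral>y. exp (- (norm (u n - \<rho> *\<^sub>R y))\<^sup>2 / (2 * \<sigma>)) \<partial>\<nu>) \<longlonglongrightarrow> (\<integral>y. exp (- (norm (x - \<rho> *\<^sub>R y))\<^sup>2 / (2 * \<sigma>)) \<partial>\<nu>)"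
  proof (rule integral_dominated_convergence[where w="\<lambda>_. 1"])
    show "AE y in \<nu>. (\<lambda>n. exp (- (norm (u n - \<rho> *\<^sub>R y))\<^sup>2 / (2 * \<sigma>))) \<longlonglongrightarrow> exp (- (norm (x - \<rho> *\<^sub>R y))\<^sup>2 / (2 * \<sigma>))"
      using \<sigma> by (intro AE_I2 tendsto_intros u) auto
  qed (use \<sigma> in auto)
  then show "(\<lambda>n. heat_kernel_average \<sigma> \<rho> \<nu> (u n)) \<longlonglongrightarrow> heat_kernel_average \<sigma> \<rho> \<nu> x"
    unfolding heat_kernel_average_def by (rule tendsto_mult_left)
qed

lemma nn_integral_heat_kernel:
  fixes w :: "real^'n"
  assumes \<sigma>: "\<sigma> > 0"
  shows "(\<integral>\<^sup>+x. ennreal ((2 * pi * \<sigma>) powr (- real CARD('n) / 2) * exp (- (norm (x - w))\<^sup>2 / (2 * \<sigma>))) \<partial>lborel) = 1"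
proof -
  define s where "s = sqrt \<sigma>"
  have s: "s > 0" "s\<^sup>2 = \<sigma>" using \<sigma> by (auto simp: s_def)
  define c where "c = (2 * pi * \<sigma>) powr (- real CARD('n) / 2)"
  have cs: "s ^ CARD('n) * c = (2 * pi) powr (- real CARD('n) / 2)"
  proof -
    have "\<sigma> powr (- real CARD('n) / 2) * s ^ CARD('n) = 1"
    proof -
      have "s ^ CARD('n) = \<sigma> powr (real CARD('n) / 2)"
        using s \<sigma> by (simp add: s_def powr_half_sqrt[symmetric] powr_realpow[symmetric] powr_powr)
      then show ?thesis using \<sigma> by (simp add: powr_add[symmetric])
    qed
    then show ?thesis unfolding c_def using \<sigma> by (simp add: powr_mult mult_ac)
  qed
  have "(\<integral>\<^sup>+x. ennreal (c * exp (- (norm (x - w))\<^sup>2 / (2 * \<sigma>))) \<partial>lborel)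
     = ennreal (s ^ CARD('n)) * (\<integral>\<^sup>+x. ennreal (c * exp (- (norm (w + s *\<^sub>R x - w))\<^sup>2 / (2 * \<sigma>))) \<partial>lborel)"
    using nn_integral_lborel_affine[of "\<lambda>x. ennreal (c * exp (- (norm (x - w))\<^sup>2 / (2 * \<sigma>)))" s w] s by simp
  also have "\<dots> = (\<integral>\<^sup>+x. ennreal (s ^ CARD('n)) * ennreal (c * exp (- (norm (w + s *\<^sub>R x - w))\<^sup>2 / (2 * \<sigma>))) \<partial>lborel)"
    by (rule nn_integral_cmult[symmetric]) measurable
  also have "\<dots> = (\<integral>\<^sup>+(x::real^'n). ennreal (stdn_density x) \<partial>lborel)"
  proof (intro nn_integral_cong)
    fix x :: "real^'n"
    have "- (norm (w + s *\<^sub>R x - w))\<^sup>2 / (2 * \<sigma>) = - (norm x)\<^sup>2 / 2" using s \<sigma> by (simp add: power_mult_distrib)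
    then have "s ^ CARD('n) * (c * exp (- (norm (w + s *\<^sub>R x - w))\<^sup>2 / (2 * \<sigma>))) = stdn_density x"
      unfolding stdn_density_eq DIM_vec cs[symmetric] by simp
    moreover have "0 \<le> s ^ CARD('n)" "0 \<le> c * exp (- (norm (w + s *\<^sub>R x - w))\<^sup>2 / (2 * \<sigma>))" using s by (auto simp: c_def)
    ultimately show "ennreal (s ^ CARD('n)) * ennreal (c * exp (- (norm (w + s *\<^sub>R x - w))\<^sup>2 / (2 * \<sigma>))) = ennreal (stdn_density x)"
      by (simp only: ennreal_mult[symmetric])
  qed
  also have "\<dots> = 1"
    using prob_space.emeasure_space_1[OF prob_space_stdn[where ?'a="real^'n"]]
    by (simp add: stdn_def emeasure_density)
  finally show ?thesis unfolding c_def .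
qed

lemma nn_integral_heat_kernel_average:
  fixes \<nu> :: "(real^'n) measure"
  assumes \<nu>: "finite_measure \<nu>" "sets \<nu> = sets borel" and \<sigma>: "\<sigma> > 0"
  shows "(\<integral>\<^sup>+x. ennreal (heat_kernel_average \<sigma> \<rho> \<nu> x) \<partial>lborel) = emeasure \<nu> UNIV"
proof -
  interpret finite_measure \<nu> by fact
  note [measurable_cong] = \<nu>(2)
  have sp: "space \<nu> = UNIV" using sets_eq_imp_space_eq[OF \<nu>(2)] by simp
  interpret P: pair_sigma_finite "lborel :: (real^'n) measure" \<nu> ..
  define c where "c = (2 * pi * \<sigma>) powr (- real CARD('n) / 2)"
  have c: "c \<ge> 0" by (simp add: c_def)
  define k where "k x y = c * exp (- (norm (x - \<rho> *\<^sub>R y))\<^sup>2 / (2 * \<sigma>))" for x y :: "real^'n"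
  have "(\<integral>\<^sup>+x. ennreal (heat_kernel_average \<sigma> \<rho> \<nu> x) \<partial>lborel) = (\<integral>\<^sup>+x. \<integral>\<^sup>+y. ennreal (k x y) \<partial>\<nu> \<partial>lborel)"
  proof (intro nn_integral_cong)
    fix x
    have "integrable \<nu> (k x)" unfolding k_def
      by (rule integrable_mult_right, rule integrable_const_bound[where B=1]) (use \<sigma> in auto)
    then have "(\<integral>\<^sup>+y. ennreal (k x y) \<partial>\<nu>) = ennreal (\<integral>y. k x y \<partial>\<nu>)"
      by (rule nn_integral_eq_integral) (use c in \<open>auto simp: k_def\<close>)
    then show "ennreal (heat_kernel_average \<sigma> \<rho> \<nu> x) = (\<integral>\<^sup>+y. ennreal (k x y) \<partial>\<nu>)"
      by (simp add: k_def heat_kernel_average_def c_def)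
  qed
  also have "\<dots> = (\<integral>\<^sup>+y. \<integral>\<^sup>+x. ennreal (k x y) \<partial>lborel \<partial>\<nu>)"
    unfolding k_def by (rule P.Fubini'[symmetric]) measurable
  also have "\<dots> = (\<integral>\<^sup>+y. 1 \<partial>\<nu>)"
    unfolding k_def c_def by (simp only: nn_integral_heat_kernel[OF \<sigma>])
  finally show ?thesis by (simp add: sp)
qed

text \<open>Log-convexity of the average relative to \<open>gauss \<sigma>\<close>, in midpoint form: by Cauchy--Schwarz,
  as \<open>E (\<xi> + h) * E (\<xi> - h) = E \<xi> ^ 2 * exp (- |h|^2 / \<sigma>)\<close> for the kernel \<open>E\<close>.\<close>

lemma heat_kernel_average_midpoint:
  fixes \<nu> :: "(real^'n) measure"
  assumes \<nu>: "finite_measure \<nu>" "sets \<nu> = sets borel" "emeasure \<nu> UNIV \<noteq> 0" and \<sigma>: "\<sigma> > 0"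
  shows "ln (heat_kernel_average \<sigma> \<rho> \<nu> \<xi>) - (norm h)\<^sup>2 / (2 * \<sigma>)
     \<le> (ln (heat_kernel_average \<sigma> \<rho> \<nu> (\<xi> + h)) + ln (heat_kernel_average \<sigma> \<rho> \<nu> (\<xi> - h))) / 2"
proof -
  define E where "E z y = exp (- (norm (z - \<rho> *\<^sub>R y))\<^sup>2 / (2 * \<sigma>))" for z y :: "real^'n"
  define J where "J z = (\<integral>y. E z y \<partial>\<nu>)" for z
  define c where "c = (2 * pi * \<sigma>) powr (- real CARD('n) / 2)"
  have c: "c > 0" using \<sigma> by (simp add: c_def)
  note fm = finite_measure_integral_exp_pos[OF \<nu> \<sigma>, where \<rho>=\<rho>, folded E_def]
  have J: "J z > 0" for z unfolding J_def by (rule fm(2))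
  have hk: "ln (heat_kernel_average \<sigma> \<rho> \<nu> z) = ln c + ln (J z)" for z
    unfolding heat_kernel_average_def E_def[symmetric] J_def[symmetric] c_def[symmetric] using c J[of z] by (simp add: ln_mult_pos)
  define d where "d = exp (- (norm h)\<^sup>2 / (2 * \<sigma>))"
  \<comment> \<open>The weight that makes \<open>l * J (\<xi> + h)\<close> and
    \<open>J (\<xi> - h) / l\<close> equal. With it, integrating
    \<open>2 * p * q \<le> l * p^2 + q^2 / l\<close> yields the Cauchy--Schwarz inequality.\<close>
  define l where "l = sqrt (J (\<xi> - h) / J (\<xi> + h))"
  have l: "l > 0" using J by (simp add: l_def)
  have "(\<integral>y. (2 * d) * E \<xi> y \<partial>\<nu>) \<le> (\<integral>y. l * E (\<xi> + h) y + (1 / l) * E (\<xi> - h) y \<partial>\<nu>)"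
  proof (rule integral_mono)
    show "integrable \<nu> (\<lambda>y. (2 * d) * E \<xi> y)" "integrable \<nu> (\<lambda>y. l * E (\<xi> + h) y + (1 / l) * E (\<xi> - h) y)"
      by (intro Bochner_Integration.integrable_add integrable_mult_right fm(1))+
    fix y
    define p where "p = exp (- (norm (\<xi> + h - \<rho> *\<^sub>R y))\<^sup>2 / (4 * \<sigma>))"
    define q where "q = exp (- (norm (\<xi> - h - \<rho> *\<^sub>R y))\<^sup>2 / (4 * \<sigma>))"
    have pE: "E (\<xi> + h) y = p\<^sup>2" "E (\<xi> - h) y = q\<^sup>2"
      unfolding E_def p_def q_def by (simp_all add: exp_double[symmetric])
    \<comment> \<open>The parallelogram law for \<open>\<xi> - \<rho> y\<close> and
      \<open>h\<close>.\<close>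
    have "d * E \<xi> y = p * q"
    proof -
      define z where "z = \<xi> - \<rho> *\<^sub>R y"
      have "(norm (z + h))\<^sup>2 + (norm (z - h))\<^sup>2 = 2 * (norm z)\<^sup>2 + 2 * (norm h)\<^sup>2"
        unfolding power2_norm_eq_inner by (simp add: inner_add_left inner_add_right inner_diff_left inner_diff_right inner_commute)
      moreover have "\<xi> + h - \<rho> *\<^sub>R y = z + h" "\<xi> - h - \<rho> *\<^sub>R y = z - h" by (auto simp: z_def)
      moreover have "- (norm h)\<^sup>2 / (2 * \<sigma>) + - (norm z)\<^sup>2 / (2 * \<sigma>) = - (2 * (norm z)\<^sup>2 + 2 * (norm h)\<^sup>2) / (4 * \<sigma>)"
        using \<sigma> by (simp add: field_simps)
      moreover have "- ((norm (z + h))\<^sup>2 + (norm (z - h))\<^sup>2) / (4 * \<sigma>) = - (norm (z + h))\<^sup>2 / (4 * \<sigma>) + - (norm (z - h))\<^sup>2 / (4 * \<sigma>)"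
        by (simp add: add_divide_distrib diff_divide_distrib)
      ultimately have "- (norm h)\<^sup>2 / (2 * \<sigma>) + - (norm (\<xi> - \<rho> *\<^sub>R y))\<^sup>2 / (2 * \<sigma>)
          = - (norm (\<xi> + h - \<rho> *\<^sub>R y))\<^sup>2 / (4 * \<sigma>) + - (norm (\<xi> - h - \<rho> *\<^sub>R y))\<^sup>2 / (4 * \<sigma>)"
        unfolding z_def[symmetric] by presburger
      then show ?thesis unfolding d_def E_def p_def q_def exp_add[symmetric] by simp
    qed
    moreover have "2 * (p * q) \<le> l * p\<^sup>2 + (1 / l) * q\<^sup>2"
    proof -
      have "0 \<le> (l * p - q)\<^sup>2 / l" using l by simp
      also have "\<dots> = l * p\<^sup>2 + (1 / l) * q\<^sup>2 - 2 * (p * q)" using l by (simp add: power2_eq_square field_simps)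
      finally show ?thesis by simp
    qed
    ultimately show "(2 * d) * E \<xi> y \<le> l * E (\<xi> + h) y + (1 / l) * E (\<xi> - h) y" unfolding pE by simp
  qed
  then have "2 * d * J \<xi> \<le> l * J (\<xi> + h) + (1 / l) * J (\<xi> - h)"
    unfolding J_def using fm(1) by simp
  also have "\<dots> = 2 * sqrt (J (\<xi> + h) * J (\<xi> - h))"
  proof -
    define s1 s2 where "s1 = sqrt (J (\<xi> + h))" and "s2 = sqrt (J (\<xi> - h))"
    have s: "s1 > 0" "s2 > 0" and JJ: "J (\<xi> + h) = s1 * s1" "J (\<xi> - h) = s2 * s2"
      using J by (auto simp: s1_def s2_def less_imp_le)
    have l': "l = s2 / s1" by (simp add: l_def s1_def s2_def real_sqrt_divide)
    show ?thesis unfolding JJ l' using s by (simp add: real_sqrt_mult)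
  qed
  finally have "d * J \<xi> \<le> sqrt (J (\<xi> + h) * J (\<xi> - h))" by simp
  then have "ln (d * J \<xi>) \<le> ln (sqrt (J (\<xi> + h) * J (\<xi> - h)))" by (rule ln_mono) (use J in \<open>simp add: d_def\<close>)
  also have "ln (d * J \<xi>) = - (norm h)\<^sup>2 / (2 * \<sigma>) + ln (J \<xi>)" using J[of \<xi>] by (simp add: d_def ln_mult_pos)
  also have "ln (sqrt (J (\<xi> + h) * J (\<xi> - h))) = (ln (J (\<xi> + h)) + ln (J (\<xi> - h))) / 2"
    unfolding ln_sqrt[OF less_imp_le[OF mult_pos_pos[OF J J]]] ln_mult_pos[OF J J] ..
  finally show ?thesis unfolding hk by (simp add: field_simps)
qed

lemma norm_scaleR_bound: "0 \<le> \<rho> \<Longrightarrow> \<rho> \<le> 1 \<Longrightarrow> norm y \<le> R \<Longrightarrow> norm (\<rho> *\<^sub>R y) \<le> R"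
  for y :: "'a::real_normed_vector"
  using mult_mono[of \<rho> 1 "norm y" R] by simp

text \<open>With bounded support all kernel centres lie within distance \<open>R\<close> of the
  origin, so the average is comparable to a single Gaussian up to factors exponential in
  \<open>norm x\<close>. The mean inequality is the midpoint inequality with \<open>h = e g\<close>,
  averaged over the symmetric noise.\<close>

lemma heat_kernel_average_compact:
  fixes \<nu> :: "(real^'n) measure"
  assumes \<nu>: "finite_measure \<nu>" "sets \<nu> = sets borel" "emeasure \<nu> UNIV \<noteq> 0" and \<sigma>: "\<sigma> > 1"
    and \<rho>: "0 \<le> \<rho>" "\<rho> \<le> 1" and R: "AE y in \<nu>. norm y \<le> R" "R > 0" and a: "a > 0"
  defines "w \<equiv> heat_kernel_average \<sigma> \<rho> \<nu>"
  shows "gauss_bounded Basis w"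
    and "\<exists>C>0. \<forall>x. 1 / a * ln (w x / gauss 1 x) \<ge> - C * (1 + norm x)"
    and "ln (w \<xi>) + (norm \<xi>)\<^sup>2 / (2 * \<sigma>) \<le> (\<integral>g. ln (w (\<xi> + e *\<^sub>R g)) + (norm (\<xi> + e *\<^sub>R g))\<^sup>2 / (2 * \<sigma>) \<partial>stdn)"
proof -
  interpret finite_measure \<nu> by fact
  have sp: "space \<nu> = UNIV" using sets_eq_imp_space_eq[OF \<nu>(2)] by simp
  have \<sigma>0: "\<sigma> > 0" using \<sigma> by simp
  define c where "c = (2 * pi * \<sigma>) powr (- real CARD('n) / 2)"
  have c: "c > 0" using \<sigma> by (simp add: c_def)
  define J where "J x = (\<integral>y. exp (- (norm (x - \<rho> *\<^sub>R y))\<^sup>2 / (2 * \<sigma>)) \<partial>\<nu>)" for x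
  note fm = finite_measure_integral_exp_pos[OF \<nu> \<sigma>0, where \<rho>=\<rho>, folded J_def]
  have wJ: "w x = c * J x" for x unfolding w_def heat_kernel_average_def c_def J_def ..
  have lw: "ln (w x) = ln c + ln (J x)" for x unfolding wJ using c fm(2)[of x] by (simp add: ln_mult_pos)
  define m where "m = measure \<nu> UNIV"
  have m: "m > 0" using \<nu>(3) emeasure_eq_measure[of UNIV] by (auto simp: m_def zero_less_measure_iff)
  have wpos: "w x > 0" for x unfolding wJ using c fm(2)[of x] by simp
  have Jle: "J x \<le> m * exp B" if "\<And>y. norm y \<le> R \<Longrightarrow> - (norm (x - \<rho> *\<^sub>R y))\<^sup>2 / (2 * \<sigma>) \<le> B" for x B
  proof -
    have "J x \<le> (\<integral>y. exp B \<partial>\<nu>)" unfolding J_def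
    proof (rule integral_mono_AE[OF fm(1)])
      show "AE y in \<nu>. exp (- (norm (x - \<rho> *\<^sub>R y))\<^sup>2 / (2 * \<sigma>)) \<le> exp B"
        using R(1) by eventually_elim (intro iffD2[OF exp_le_cancel_iff] that)
    qed simp
    then show ?thesis by (simp add: sp m_def)
  qed
  have Jge: "m * exp B \<le> J x" if "\<And>y. norm y \<le> R \<Longrightarrow> B \<le> - (norm (x - \<rho> *\<^sub>R y))\<^sup>2 / (2 * \<sigma>)" for x B
  proof -
    have "(\<integral>y. exp B \<partial>\<nu>) \<le> J x" unfolding J_def
    proof (rule integral_mono_AE[OF _ fm(1)])
      show "AE y in \<nu>. exp B \<le> exp (- (norm (x - \<rho> *\<^sub>R y))\<^sup>2 / (2 * \<sigma>))"
        using R(1) by eventually_elim (intro iffD2[OF exp_le_cancel_iff] that)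
    qed simp
    then show ?thesis by (simp add: sp m_def)
  qed
  have lJle: "ln (J x) \<le> ln m + B" if "\<And>y. norm y \<le> R \<Longrightarrow> - (norm (x - \<rho> *\<^sub>R y))\<^sup>2 / (2 * \<sigma>) \<le> B" for x B
    using ln_mono[OF Jle[OF that] fm(2)] m by (simp add: ln_mult_pos)
  have lJge: "ln m + B \<le> ln (J x)" if "\<And>y. norm y \<le> R \<Longrightarrow> B \<le> - (norm (x - \<rho> *\<^sub>R y))\<^sup>2 / (2 * \<sigma>)" for x B
    using ln_mono[OF Jge[OF that]] m by (simp add: ln_mult_pos)
  have lo: "ln c + ln m - ((norm x)\<^sup>2 + 2 * R * norm x + R\<^sup>2) / (2 * \<sigma>) \<le> ln (w x)" for x
  proof -
    have "ln m + - ((norm x)\<^sup>2 + 2 * R * norm x + R\<^sup>2) / (2 * \<sigma>) \<le> ln (J x)"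
    proof (rule lJge)
      fix y :: "real^'n" assume "norm y \<le> R"
      from norm_scaleR_bound[OF \<rho> this] have "norm (x - \<rho> *\<^sub>R y) \<le> norm x + R"
        using norm_triangle_ineq4[of x "\<rho> *\<^sub>R y"] by linarith
      then have "(norm (x - \<rho> *\<^sub>R y))\<^sup>2 \<le> (norm x + R)\<^sup>2" by (rule power_mono) simp
      also have "(norm x + R)\<^sup>2 = (norm x)\<^sup>2 + 2 * R * norm x + R\<^sup>2" by (simp add: power2_eq_square algebra_simps)
      finally show "- ((norm x)\<^sup>2 + 2 * R * norm x + R\<^sup>2) / (2 * \<sigma>) \<le> - (norm (x - \<rho> *\<^sub>R y))\<^sup>2 / (2 * \<sigma>)"
        using \<sigma>0 by (intro divide_right_mono) auto
    qed
    then show ?thesis unfolding lw minus_divide_left[symmetric] by linarith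
  qed
  have up: "ln (w x) \<le> ln c + ln m + R\<^sup>2 / (2 * \<sigma>) - 1 / (4 * \<sigma>) * (norm x)\<^sup>2" for x
  proof -
    have "ln (J x) \<le> ln m + (R\<^sup>2 / (2 * \<sigma>) - 1 / (4 * \<sigma>) * (norm x)\<^sup>2)"
    proof (rule lJle)
      fix y :: "real^'n" assume y: "norm y \<le> R"
      have "(norm (\<rho> *\<^sub>R y))\<^sup>2 \<le> R\<^sup>2" using norm_scaleR_bound[OF \<rho> y] by (rule power_mono) simp
      moreover have "(norm x)\<^sup>2 \<le> 2 * (norm (x - \<rho> *\<^sub>R y))\<^sup>2 + 2 * (norm (\<rho> *\<^sub>R y))\<^sup>2"
        using norm_add_square_le[of "x - \<rho> *\<^sub>R y" "\<rho> *\<^sub>R y"] by simp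
      ultimately have "- (norm (x - \<rho> *\<^sub>R y))\<^sup>2 \<le> R\<^sup>2 - (norm x)\<^sup>2 / 2" by linarith
      then have "- (norm (x - \<rho> *\<^sub>R y))\<^sup>2 / (2 * \<sigma>) \<le> (R\<^sup>2 - (norm x)\<^sup>2 / 2) / (2 * \<sigma>)"
        using \<sigma>0 by (intro divide_right_mono) auto
      also have "\<dots> = R\<^sup>2 / (2 * \<sigma>) - 1 / (4 * \<sigma>) * (norm x)\<^sup>2" by (simp add: diff_divide_distrib)
      finally show "- (norm (x - \<rho> *\<^sub>R y))\<^sup>2 / (2 * \<sigma>) \<le> R\<^sup>2 / (2 * \<sigma>) - 1 / (4 * \<sigma>) * (norm x)\<^sup>2" .
    qed
    then show ?thesis unfolding lw by simp
  qed
  show gb: "gauss_bounded Basis w"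
  proof (rule gauss_boundedI[OF _ wpos])
    show "continuous_on UNIV w" unfolding w_def by (rule heat_kernel_average_continuous[OF \<nu>(1,2) \<sigma>0])
    show "1 / (4 * \<sigma>) > 0" using \<sigma>0 by simp
    show "ln (w y) \<le> ln c + ln m + R\<^sup>2 / (2 * \<sigma>) - 1 / (4 * \<sigma>) * (norm y)\<^sup>2" for y by (rule up)
    show "- (\<bar>ln c + ln m\<bar> + (1 + 2 * R + R\<^sup>2) / (2 * \<sigma>)) * (1 + (norm y)\<^sup>2) \<le> ln (w y)" for y
    proof -
      define X where "X = 1 + (norm y)\<^sup>2"
      have X: "X \<ge> 1" by (simp add: X_def)
      have "(norm y)\<^sup>2 \<le> X" "2 * R * norm y \<le> 2 * R * X" "R\<^sup>2 * 1 \<le> R\<^sup>2 * X"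
        using norm_le_one_add_square[of y] R(2) X by (auto simp: X_def intro!: mult_left_mono)
      then have "(norm y)\<^sup>2 + 2 * R * norm y + R\<^sup>2 \<le> (1 + 2 * R + R\<^sup>2) * X" by (simp add: distrib_right)
      then have 1: "((norm y)\<^sup>2 + 2 * R * norm y + R\<^sup>2) / (2 * \<sigma>) \<le> (1 + 2 * R + R\<^sup>2) * X / (2 * \<sigma>)"
        using \<sigma>0 by (intro divide_right_mono) auto
      have 2: "\<bar>ln c + ln m\<bar> * 1 \<le> \<bar>ln c + ln m\<bar> * X" using X by (intro mult_left_mono) auto
      have 3: "(\<bar>ln c + ln m\<bar> + (1 + 2 * R + R\<^sup>2) / (2 * \<sigma>)) * X = \<bar>ln c + ln m\<bar> * X + (1 + 2 * R + R\<^sup>2) * X / (2 * \<sigma>)"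
        by (simp add: distrib_right)
      have "P \<le> Q \<Longrightarrow> \<bar>A\<bar> * 1 \<le> E \<Longrightarrow> T = E + Q \<Longrightarrow> A - P \<le> l \<Longrightarrow> - T \<le> l" for P Q A E T l :: real
        by linarith
      from this[OF 1 2 3 lo[of y]] show ?thesis unfolding X_def[symmetric] mult_minus_left .
    qed
  qed
  show "\<exists>C>0. \<forall>x. 1 / a * ln (w x / gauss 1 x) \<ge> - C * (1 + norm x)"
  proof (intro exI conjI allI)
    define B where "B = \<bar>ln c + ln m\<bar> + R\<^sup>2 / (2 * \<sigma>) + R / \<sigma> + 1"
    have B: "B > 0" unfolding B_def using R(2) \<sigma>0 by (intro add_nonneg_pos add_nonneg_nonneg) auto
    show "B / a > 0" using B a by simp
    fix x
    have "ln (w x / gauss 1 x) = ln (w x) - ln (gauss 1 x)"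
      using wpos[of x] gauss_pos[of 1 x] by (simp add: ln_div)
    moreover have "ln (gauss 1 x) \<le> - (norm x)\<^sup>2 / 2" using pi_gt3 by (simp add: ln_gauss)
    moreover have "((norm x)\<^sup>2 + 2 * R * norm x + R\<^sup>2) / (2 * \<sigma>) = (norm x)\<^sup>2 / (2 * \<sigma>) + R / \<sigma> * norm x + R\<^sup>2 / (2 * \<sigma>)"
      by (simp add: add_divide_distrib)
    \<comment> \<open>Here \<open>\<sigma> > 1\<close> matters: dividing by \<open>gauss 1\<close>
      outweighs the quadratic decay of \<open>w\<close>, so that only a linear loss remains.\<close>
    moreover have "(norm x)\<^sup>2 / (2 * \<sigma>) \<le> (norm x)\<^sup>2 / 2" using \<sigma> by (intro divide_left_mono) auto
    moreover have "R / \<sigma> * norm x \<le> B * norm x" unfolding B_def using R(2) \<sigma>0 by (intro mult_right_mono) auto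
    moreover have "\<bar>ln c + ln m\<bar> + R\<^sup>2 / (2 * \<sigma>) \<le> B" unfolding B_def using R(2) \<sigma>0 by simp
    ultimately have "- (B * (1 + norm x)) \<le> ln (w x / gauss 1 x)" using lo[of x] by (simp add: distrib_left)
    then have "1 / a * - (B * (1 + norm x)) \<le> 1 / a * ln (w x / gauss 1 x)" using a by (intro mult_left_mono) auto
    then show "1 / a * ln (w x / gauss 1 x) \<ge> - (B / a) * (1 + norm x)" by simp
  qed
  define H where "H x = ln (w x) + (norm x)\<^sup>2 / (2 * \<sigma>)" for x
  have Hi: "integrable stdn (\<lambda>g. H (\<xi> + s *\<^sub>R g))" for s
    unfolding H_def by (intro Bochner_Integration.integrable_add integrable_stdn_ln_gauss_bounded[OF gb] integrable_divide_zero stdn_moments(1))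
  have wc: "continuous_on UNIV w" by (rule gauss_bounded_continuous[OF gb])
  then have [measurable]: "w \<in> borel_measurable borel" by (rule borel_measurable_continuous_onI)
  have [measurable]: "H \<in> borel_measurable borel" unfolding H_def by measurable
  interpret N: prob_space "stdn :: (real^'n) measure" by (rule prob_space_stdn)
  have mid: "H \<xi> \<le> (H (\<xi> + e *\<^sub>R g) + H (\<xi> + (- e) *\<^sub>R g)) / 2" for g
  proof -
    have "(norm (\<xi> + e *\<^sub>R g))\<^sup>2 + (norm (\<xi> - e *\<^sub>R g))\<^sup>2 = 2 * (norm \<xi>)\<^sup>2 + 2 * (norm (e *\<^sub>R g))\<^sup>2"
      unfolding power2_norm_eq_inner by (simp add: inner_add_left inner_add_right inner_diff_left inner_diff_right inner_commute)
    then have "((norm (\<xi> + e *\<^sub>R g))\<^sup>2 + (norm (\<xi> - e *\<^sub>R g))\<^sup>2) / (2 * \<sigma>) / 2 = (2 * (norm \<xi>)\<^sup>2 + 2 * (norm (e *\<^sub>R g))\<^sup>2) / (2 * \<sigma>) / 2" by simp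
    also have "\<dots> = (norm \<xi>)\<^sup>2 / (2 * \<sigma>) + (norm (e *\<^sub>R g))\<^sup>2 / (2 * \<sigma>)" by (simp add: add_divide_distrib)
    finally have "(norm \<xi>)\<^sup>2 / (2 * \<sigma>) + (norm (e *\<^sub>R g))\<^sup>2 / (2 * \<sigma>) = (norm (\<xi> + e *\<^sub>R g))\<^sup>2 / (2 * \<sigma>) / 2 + (norm (\<xi> - e *\<^sub>R g))\<^sup>2 / (2 * \<sigma>) / 2"
      by (simp add: add_divide_distrib)
    then show ?thesis
      using heat_kernel_average_midpoint[OF \<nu> \<sigma>0, of \<rho> \<xi> "e *\<^sub>R g", folded w_def]
      unfolding H_def scaleR_minus_left add_uminus_conv_diff add_divide_distrib by linarith
  qed
  have "(\<integral>(g::real^'n). H \<xi> \<partial>stdn) \<le> (\<integral>g. (H (\<xi> + e *\<^sub>R g) + H (\<xi> + (- e) *\<^sub>R g)) / 2 \<partial>stdn)"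
    by (rule integral_mono[OF N.integrable_const _ mid]) (intro integrable_divide_zero Bochner_Integration.integrable_add Hi)
  also have "\<dots> = ((\<integral>g. H (\<xi> + e *\<^sub>R g) \<partial>stdn) + (\<integral>g. H (\<xi> + (- e) *\<^sub>R g) \<partial>stdn)) / 2"
    using Bochner_Integration.integral_add[OF Hi[of e] Hi[of "- e"]] by simp
  \<comment> \<open>The reflection \<open>g \<mapsto> - g\<close> preserves the Gaussian
    measure.\<close>
  also have "(\<integral>g. H (\<xi> + (- e) *\<^sub>R g) \<partial>stdn) = (\<integral>g. H (\<xi> + e *\<^sub>R g) \<partial>stdn)"
  proof -
    have "(\<integral>g. H (\<xi> + (- e) *\<^sub>R g) \<partial>stdn) = (\<integral>g. stdn_density g * H (\<xi> + (- e) *\<^sub>R g) \<partial>lborel)"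
      by (rule integral_stdn) measurable
    also have "\<dots> = (\<integral>g. stdn_density g * H (\<xi> + e *\<^sub>R g) \<partial>lborel)"
      using integral_lborel_affine[of "\<lambda>g. stdn_density g * H (\<xi> + (- e) *\<^sub>R g)" "-1" 0]
      by (simp add: stdn_density_eq)
    also have "\<dots> = (\<integral>g. H (\<xi> + e *\<^sub>R g) \<partial>stdn)" by (rule integral_stdn[symmetric]) measurable
    finally show ?thesis .
  qed
  finally show "ln (w \<xi>) + (norm \<xi>)\<^sup>2 / (2 * \<sigma>) \<le> (\<integral>g. ln (w (\<xi> + e *\<^sub>R g)) + (norm (\<xi> + e *\<^sub>R g))\<^sup>2 / (2 * \<sigma>) \<partial>stdn)"
    by (simp add: H_def N.prob_space[unfolded space_stdn])
qed

text \<open>The initial measure is restricted to balls, where the Gaussian bounds hold, and the core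
  bound is passed to the limit. The truncated potentials increase to \<open>f\<close>, so their
  Hopf--Lax transforms converge, and Fatou's lemma carries the upper bound over.\<close>

lemma fp_contraction:
  fixes v :: "real^'n \<Rightarrow> real" and a \<tau> \<sigma> :: real
  assumes a: "a > 0" and \<tau>: "\<tau> > 0" and \<sigma>: "\<sigma> > 1" and v: "v \<in> FP \<sigma>"
  defines "f \<equiv> \<lambda>x. 1 / a * ln (v x / gauss 1 x)"
  shows "gauss_norm (a + \<tau>) (\<lambda>x. exp (hopf_lax \<tau> f x))
     \<le> gauss_norm (a + \<tau>) (\<lambda>x. exp (hopf_lax \<tau> (\<lambda>y :: real^'n. 1 / a * ln (gauss \<sigma> y / gauss 1 y)) x))
       * gauss_norm a (\<lambda>x. exp (f x))"
proof -
  obtain \<mu> :: "(real^'n) measure" where v': "v = fp_solution \<sigma> \<mu> (1 / 2 * ln 2)"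
    and \<mu>: "finite_measure \<mu>" "sets \<mu> = sets borel" "emeasure \<mu> UNIV \<noteq> 0"
    using v unfolding FP_def by blast
  interpret finite_measure \<mu> by fact
  note [measurable_cong] = \<mu>(2)
  have sp: "space \<mu> = UNIV" using sets_eq_imp_space_eq[OF \<mu>(2)] by simp
  have \<sigma>0: "\<sigma> > 0" using \<sigma> by simp
  define \<rho> :: real where "\<rho> = exp (- (1 / 2 * ln 2))"
  have \<rho>: "0 \<le> \<rho>" "\<rho> \<le> 1" by (auto simp: \<rho>_def)
  have vh: "v = heat_kernel_average \<sigma> \<rho> \<mu>" unfolding v' fp_solution_eq \<rho>_def ..
  have vpos: "v x > 0" for x unfolding vh by (rule heat_kernel_average_pos[OF \<mu> \<sigma>0])
  have vc: "continuous_on UNIV v" unfolding vh by (rule heat_kernel_average_continuous[OF \<mu>(1,2) \<sigma>0])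
  \<comment> \<open>A zero truncation would have no logarithm, so the exhaustion starts at a ball of
    positive mass.\<close>
  obtain N0 :: nat where N0: "emeasure \<mu> (cball 0 (real N0)) \<noteq> 0"
  proof (rule ccontr)
    assume "\<not> thesis"
    then have z: "emeasure \<mu> (cball 0 (real N)) = 0" for N using that by blast
    have "emeasure \<mu> (\<Union>N. cball 0 (real N)) = 0" by (rule emeasure_UN_eq_0) (use z \<mu>(2) in auto)
    moreover have "(\<Union>N. cball (0::real^'n) (real N)) = UNIV" by (auto intro: real_arch_simple)
    ultimately show False using \<mu>(3) by simp
  qed
  \<comment> \<open>The offset \<open>N0\<close> keeps all truncations nonzero from index
    \<open>0\<close> on, and the added one makes the radius positive. Index \<open>0\<close> also
    supplies the linear lower bound for the whole increasing sequence.\<close>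
  define R where "R N = real (N + N0 + 1)" for N
  define \<nu> where "\<nu> N = density \<mu> (\<lambda>y. indicator (cball 0 (R N)) y)" for N
  have s\<nu>: "sets (\<nu> N) = sets borel" for N unfolding \<nu>_def using \<mu>(2) by simp
  have e\<nu>: "emeasure (\<nu> N) UNIV = emeasure \<mu> (cball 0 (R N))" for N
    unfolding \<nu>_def by (subst emeasure_density) (auto simp: \<mu>(2) intro!: borel_measurable_indicator)
  have f\<nu>: "finite_measure (\<nu> N)" for N
    by (rule finite_measureI) (use e\<nu>[of N] sets_eq_imp_space_eq[OF s\<nu>[of N]] in \<open>simp add: emeasure_eq_measure\<close>)
  have n\<nu>: "emeasure (\<nu> N) UNIV \<noteq> 0" for N
  proof -
    have "emeasure \<mu> (cball 0 (real N0)) \<le> emeasure \<mu> (cball 0 (R N))"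
      by (rule emeasure_mono) (auto simp: R_def \<mu>(2))
    then show ?thesis unfolding e\<nu> using N0 by (metis le_zero_eq)
  qed
  have AE\<nu>: "AE y in \<nu> N. norm y \<le> R N" for N
    unfolding \<nu>_def by (subst AE_density) (auto simp: \<mu>(2) indicator_def intro!: borel_measurable_indicator)
  have Rpos: "R N > 0" for N by (simp add: R_def)
  define w where "w N = heat_kernel_average \<sigma> \<rho> (\<nu> N)" for N
  define c where "c = (2 * pi * \<sigma>) powr (- real CARD('n) / 2)"
  have c: "c \<ge> 0" by (simp add: c_def)
  define E where "E x y = exp (- (norm (x - \<rho> *\<^sub>R y))\<^sup>2 / (2 * \<sigma>))" for x y :: "real^'n"
  have Em [measurable]: "E x \<in> borel_measurable borel" for x unfolding E_def by measurable
  have E01: "0 \<le> E x y" "E x y \<le> 1" for x y using \<sigma>0 by (auto simp: E_def)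
  have Ei: "integrable \<mu> (\<lambda>y. indicator (cball 0 r) y * E x y)" for x r
    by (rule integrable_const_bound[where B=1]) (use E01 in \<open>auto simp: indicator_def\<close>)
  have wE: "w N x = c * (\<integral>y. indicator (cball 0 (R N)) y * E x y \<partial>\<mu>)" for N x
  proof -
    have "(\<integral>y. E x y \<partial>\<nu> N) = (\<integral>y. indicator (cball 0 (R N)) y *\<^sub>R E x y \<partial>\<mu>)"
    proof -
      have "\<nu> N = density \<mu> (\<lambda>y. ennreal (indicator (cball 0 (R N)) y))" unfolding \<nu>_def by (simp add: ennreal_indicator)
      moreover have "E x \<in> borel_measurable \<mu>" using Em by (subst measurable_cong_sets[OF \<mu>(2) refl])
      moreover have "(indicator (cball 0 (R N)) :: real^'n \<Rightarrow> real) \<in> borel_measurable \<mu>"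
        by (rule borel_measurable_indicator) (simp add: \<mu>(2))
      ultimately show ?thesis by (simp add: integral_density)
    qed
    then show ?thesis unfolding w_def heat_kernel_average_def c_def E_def by simp
  qed
  have wpos: "w N x > 0" for N x unfolding w_def by (rule heat_kernel_average_pos[OF f\<nu> s\<nu> n\<nu> \<sigma>0])
  have winc: "incseq (\<lambda>N. w N x)" for x
  proof (rule incseq_SucI)
    fix N
    have "(\<integral>y. indicator (cball 0 (R N)) y * E x y \<partial>\<mu>) \<le> (\<integral>y. indicator (cball 0 (R (Suc N))) y * E x y \<partial>\<mu>)"
      by (rule integral_mono[OF Ei Ei]) (use E01 in \<open>auto simp: indicator_def R_def\<close>)
    then show "w N x \<le> w (Suc N) x" unfolding wE using c by (rule mult_left_mono)
  qed
  have wlim: "(\<lambda>N. w N x) \<longlonglongrightarrow> v x" for x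
  proof -
    have "(\<lambda>N. \<integral>y. indicator (cball 0 (R N)) y * E x y \<partial>\<mu>) \<longlonglongrightarrow> (\<integral>y. E x y \<partial>\<mu>)"
    proof (rule integral_dominated_convergence[where w="\<lambda>_. 1"])
      show "AE y in \<mu>. (\<lambda>N. indicator (cball 0 (R N)) y * E x y) \<longlonglongrightarrow> E x y"
      proof (rule AE_I2, rule tendsto_eventually)
        fix y :: "real^'n"
        obtain M :: nat where "norm y \<le> real M" using real_arch_simple by blast
        then show "\<forall>\<^sub>F N in sequentially. indicator (cball 0 (R N)) y * E x y = E x y"
          by (intro eventually_sequentiallyI[of M]) (auto simp: R_def indicator_def)
      qed
      show "AE y in \<mu>. norm (indicator (cball 0 (R N)) y * E x y) \<le> 1" for N
        using E01 by (intro AE_I2) (auto simp: indicator_def)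
    qed (auto intro: borel_measurable_integrable[OF Ei])
    from tendsto_mult_left[OF this, of c] show ?thesis
      unfolding wE vh heat_kernel_average_def c_def E_def .
  qed
  define F where "F N x = 1 / a * ln (w N x / gauss 1 x)" for N x
  have g1: "gauss 1 x > 0" for x :: "real^'n" by (rule gauss_pos) simp
  have gc: "continuous_on UNIV (gauss 1 :: real^'n \<Rightarrow> real)" unfolding gauss_def by (intro continuous_intros) auto
  have wF: "w N x = exp (a * F N x) * stdn_density x" for N x
    unfolding F_def using a wpos[of N x] g1[of x] by (simp add: gauss_eq_stdn_density)
  have vf: "exp (a * f x) * stdn_density x = v x" for x
    unfolding f_def using a vpos[of x] g1[of x] by (simp add: gauss_eq_stdn_density)
  note HC = heat_kernel_average_compact[OF f\<nu> s\<nu> n\<nu> \<sigma> \<rho> AE\<nu> Rpos a, folded w_def]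
  have Fc: "continuous_on UNIV (F N)" for N
    unfolding F_def
    by (intro continuous_intros gauss_bounded_continuous[OF HC(1)] gc)
      (use wpos g1 in \<open>auto simp: less_imp_neq[THEN not_sym] less_imp_neq\<close>)
  have fc: "continuous_on UNIV f"
    unfolding f_def by (intro continuous_intros vc gc)
      (use vpos g1 in \<open>auto simp: less_imp_neq[THEN not_sym] less_imp_neq\<close>)
  have Finc: "incseq (\<lambda>N. F N x)" for x
  proof (rule incseq_SucI)
    fix N
    have "w N x / gauss 1 x \<le> w (Suc N) x / gauss 1 x" using incseqD[OF winc, of N "Suc N" x] g1[of x] by (simp add: divide_right_mono)
    then have "ln (w N x / gauss 1 x) \<le> ln (w (Suc N) x / gauss 1 x)" by (rule ln_mono) (use wpos g1 in simp)
    then show "F N x \<le> F (Suc N) x" unfolding F_def using a by (simp add: divide_right_mono)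
  qed
  have Flim: "(\<lambda>N. F N x) \<longlonglongrightarrow> f x" for x
    unfolding F_def f_def
    by (intro tendsto_intros wlim) (use vpos[of x] g1[of x] in \<open>auto simp: less_imp_neq[THEN not_sym]\<close>)
  obtain C where C: "C > 0" "\<And>x. F 0 x \<ge> - C * (1 + norm x)" using HC(2)[of 0] unfolding F_def by blast
  have FC: "F N x \<ge> - C * (1 + norm x)" for N x
    using C(2)[of x] incseqD[OF Finc, of 0 N x] by simp
  have fC: "f x \<ge> - C * (1 + norm x)" for x
    using FC[of x 0] incseq_le[OF Finc Flim, of 0 x] by linarith
  note Qlim = hopf_lax_increasing_limit[OF Fc Finc Flim C \<tau>]
  define t where "t = \<tau> / (a + \<tau>)"
  have t1: "1 - t > 0" using a \<tau> by (simp add: t_def field_simps)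
  define m where "m = measure \<mu> UNIV"
  have m: "m > 0" using \<mu>(3) emeasure_eq_measure[of UNIV] by (auto simp: m_def zero_less_measure_iff)
  have vm: "(\<integral>\<^sup>+x. ennreal (v x) \<partial>lborel) = ennreal m"
    unfolding vh nn_integral_heat_kernel_average[OF \<mu>(1,2) \<sigma>0] m_def by (rule emeasure_eq_measure)
  define B where "B = ennreal (exp ((ln m - CARD('n) * gain t \<sigma>) / (1 - t)))"
  define G where "G N x = ennreal (exp ((a + \<tau>) * hopf_lax \<tau> (F N) x) * stdn_density x)" for N x
  have GB: "(\<integral>\<^sup>+x. G N x \<partial>lborel) \<le> B" for N
  proof -
    obtain mN where mN: "mN > 0" "(\<integral>\<^sup>+x. ennreal (w N x) \<partial>lborel) = ennreal mN"
      "(\<integral>\<^sup>+x. ennreal (exp ((a + \<tau>) * hopf_lax \<tau> (F N) x) * stdn_density x) \<partial>lborel)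
       \<le> ennreal (exp ((ln mN - CARD('n) * gain t \<sigma>) / (1 - t)))"
      by (rule hopf_lax_core_bound[where f="F N" and v="w N", OF a \<tau> \<sigma> C(1) FC wF HC(1,3) t_def]) auto
    \<comment> \<open>Truncation only lowers the mass, and the core bound increases with the mass,
      so \<open>B\<close> serves all \<open>N\<close>.\<close>
    have "ennreal mN \<le> ennreal m"
      unfolding mN(2)[symmetric] vm[symmetric]
      using incseq_le[OF winc wlim] by (intro nn_integral_mono ennreal_leI)
    then have "mN \<le> m" using m by (simp add: ennreal_le_iff)
    then have "ln mN \<le> ln m" using mN(1) by simp
    then have "exp ((ln mN - CARD('n) * gain t \<sigma>) / (1 - t)) \<le> exp ((ln m - CARD('n) * gain t \<sigma>) / (1 - t))"
      using t1 by (simp add: divide_right_mono)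
    then show ?thesis unfolding G_def B_def by (rule order_trans[OF mN(3) ennreal_leI])
  qed
  have hc: "continuous_on UNIV (hopf_lax \<tau> f)" by (rule hopf_lax_bounds(4)[OF fC C(1) \<tau>])
  have Gm: "G N \<in> borel_measurable lborel" for N
  proof -
    have "continuous_on UNIV (hopf_lax \<tau> (F N))" by (rule hopf_lax_bounds(4)[where C=C, OF _ C(1) \<tau>]) (rule FC)
    then have [measurable]: "hopf_lax \<tau> (F N) \<in> borel_measurable borel" by (rule borel_measurable_continuous_onI)
    show ?thesis unfolding G_def by measurable
  qed
  have "(\<integral>\<^sup>+x. ennreal (exp ((a + \<tau>) * hopf_lax \<tau> f x) * stdn_density x) \<partial>lborel) = (\<integral>\<^sup>+x. liminf (\<lambda>N. G N x) \<partial>lborel)"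
  proof (intro nn_integral_cong)
    fix x
    have "(\<lambda>N. G N x) \<longlonglongrightarrow> ennreal (exp ((a + \<tau>) * hopf_lax \<tau> f x) * stdn_density x)"
      unfolding G_def by (intro tendsto_ennrealI tendsto_intros Qlim)
    then show "ennreal (exp ((a + \<tau>) * hopf_lax \<tau> f x) * stdn_density x) = liminf (\<lambda>N. G N x)"
      by (rule lim_imp_Liminf[symmetric, rotated]) simp
  qed
  \<comment> \<open>Fatou's lemma is enough, because only an upper bound on the limit integral is
    required.\<close>
  also have "\<dots> \<le> liminf (\<lambda>N. \<integral>\<^sup>+x. G N x \<partial>lborel)" by (rule nn_integral_liminf[OF Gm])
  also have "\<dots> \<le> liminf (\<lambda>_::nat. B)" by (intro Liminf_mono always_eventually allI GB)
  also have "\<dots> = B" by (simp add: Liminf_const)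
  finally have "(\<integral>\<^sup>+x. ennreal (exp ((a + \<tau>) * hopf_lax \<tau> f x) * stdn_density x) \<partial>lborel) \<le> B" .
  from this[unfolded B_def] show ?thesis
    by (rule gauss_norm_combine[OF a \<tau> \<sigma> t_def fc hc m vm[folded vf]])
qed

theorem theorem6p2:
  fixes a \<tau> \<beta> \<beta>a :: real
  assumes "a > 0" and "\<tau> > 0" and "\<beta> > 1" and "\<beta> * (1 - 1 / a) < 1"
    and "\<beta>a > 1" and "1 / \<beta>a = 1 - a * (1 - 1 / \<beta>)"
  shows "(\<forall>f :: real^'n \<Rightarrow> real.
            twice_differentiable f \<longrightarrow>
            (\<exists>C>0. \<forall>x. f x \<ge> - C * (1 + norm x)) \<longrightarrow>
            (\<forall>x. laplacian f x \<ge> real CARD('n) * (1 - 1 / \<beta>)) \<longrightarrow>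
            (\<integral>\<^sup>+ x. ennreal (exp (2 * a * f x) * (gauss 1 x / gauss \<beta>a x)) \<partial>gauss_measure) < \<infinity> \<longrightarrow>
            gauss_norm (a + \<tau>) (\<lambda>x. exp (hopf_lax \<tau> f x))
              \<le> gauss_norm (a + \<tau>)
                   (\<lambda>x. exp (hopf_lax \<tau> (\<lambda>y :: real^'n. 1 / a * ln (gauss \<beta>a y / gauss 1 y)) x))
                 * gauss_norm a (\<lambda>x. exp (f x)))
       \<and> (\<forall>v \<in> (FP \<beta>a :: (real^'n \<Rightarrow> real) set).
            let f = (\<lambda>x. 1 / a * ln (v x / gauss 1 x)) in
            gauss_norm (a + \<tau>) (\<lambda>x. exp (hopf_lax \<tau> f x))
              \<le> gauss_norm (a + \<tau>)
                   (\<lambda>x. exp (hopf_lax \<tau> (\<lambda>y :: real^'n. 1 / a * ln (gauss \<beta>a y / gauss 1 y)) x))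
                 * gauss_norm a (\<lambda>x. exp (f x)))"
proof (intro conjI allI impI ballI)
  fix f :: "real^'n \<Rightarrow> real"
  assume td: "twice_differentiable f" and lb: "\<exists>C>0. \<forall>x. f x \<ge> - C * (1 + norm x)"
    and lap: "\<forall>x. laplacian f x \<ge> real CARD('n) * (1 - 1 / \<beta>)"
    and fin: "(\<integral>\<^sup>+ x. ennreal (exp (2 * a * f x) * (gauss 1 x / gauss \<beta>a x)) \<partial>gauss_measure) < \<infinity>"
  obtain C where C: "C > 0" "\<And>x. f x \<ge> - C * (1 + norm x)" using lb by blast
  \<comment> \<open>The relation defining \<open>\<beta>a\<close> says that multiplying
    \<open>f\<close> by \<open>a\<close> turns the curvature \<open>1 - 1 / \<beta>\<close> into
    \<open>1 - 1 / \<beta>a\<close>, the form in which the Laplacian bound is comparable with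
    \<open>gauss \<beta>a\<close>.\<close>
  have "a * laplacian f x \<ge> CARD('n) * (1 - 1 / \<beta>a)" for x
  proof -
    have "1 - 1 / \<beta>a = a * (1 - 1 / \<beta>)" using assms(6) by simp
    then have "CARD('n) * (1 - 1 / \<beta>a) = a * (CARD('n) * (1 - 1 / \<beta>))" by simp
    also have "\<dots> \<le> a * laplacian f x" using lap assms(1) by (intro mult_left_mono) auto
    finally show ?thesis .
  qed
  then show "gauss_norm (a + \<tau>) (\<lambda>x. exp (hopf_lax \<tau> f x))
      \<le> gauss_norm (a + \<tau>) (\<lambda>x. exp (hopf_lax \<tau> (\<lambda>y :: real^'n. 1 / a * ln (gauss \<beta>a y / gauss 1 y)) x))
        * gauss_norm a (\<lambda>x. exp (f x))"
    by (rule hopf_lax_contraction[OF assms(1,2,5) td C _ fin])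
next
  fix v :: "real^'n \<Rightarrow> real" assume "v \<in> FP \<beta>a"
  from fp_contraction[OF assms(1,2,5) this]
  show "let f = (\<lambda>x. 1 / a * ln (v x / gauss 1 x)) in
      gauss_norm (a + \<tau>) (\<lambda>x. exp (hopf_lax \<tau> f x))
        \<le> gauss_norm (a + \<tau>) (\<lambda>x. exp (hopf_lax \<tau> (\<lambda>y :: real^'n. 1 / a * ln (gauss \<beta>a y / gauss 1 y)) x))
          * gauss_norm a (\<lambda>x. exp (f x))"
    unfolding Let_def .
qed

end
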